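(* Let $d\geq 3$ be odd and $p$ an odd prime such that $p\nmid d(d-1)$. For $x\in\mathbb{F}_p^{\times}$ we have $$\sum_{t\in\mathbb{F}_p}\phi(t(t-1))\;{_{d-1}G}_{d-1}\left[\begin{array}{c}\frac1d,\ \frac2d,\ \ldots,\ \frac{d-2}{d},\ \frac{d-1}{d}\\ \frac{1}{d-1},\ \frac{2}{d-1},\ \ldots,\ \frac{\frac{d-1}{2}-1}{d-1},\ \frac{\frac{d-1}{2}+1}{d-1},\ \ldots,\ \frac{d-2}{d-1},\ 0,\ 0\end{array}\Big|\ xt\right]$$ $$=-1-p\cdot{_{d-1}G}_{d-1}\left[\begin{array}{cccc}\frac1d,&\frac2d,&\ldots,&\frac{d-1}{d}\\ 0,&\frac1{d-1},&\ldots,&\frac{d-2}{d-1}\end{array}\Big|\ x\right].$$ Here, on the left-hand side, the $d-1$ upper parameters are all $h/d$ with $1\le h\le d-1$, and the $d-1$ lower parameters are the numbers $h/(d-1)$ with $1\le h\le d-2$, $h\ne\frac{d-1}{2}$, together with $0$ taken twice.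
   Context: $\phi$ is the quadratic character on $\mathbb{F}_p$, with $\phi(0)=0$. McCarthy's $p$-adic hypergeometric series: $\Gamma_p:\mathbb{Z}_p\to\mathbb{Z}_p^\times$ is the $p$-adic gamma function, i.e. the unique continuous function with $\Gamma_p(0)=1$ and $\Gamma_p(n)=(-1)^n\prod_{0<j<n,\,p\nmid j}j$ for positive integers $n$. $\omega:\mathbb{F}_p^\times\to\mathbb{Z}_p^\times$ is the Teichmüller character ($\omega(a)$ is the $(p-1)$-th root of unity with $\omega(a)\equiv a \pmod p$) and $\overline{\omega}$ its inverse; all characters, including the trivial one $\overline\omega^0$, are extended to $\mathbb{F}_p$ by the value $0$ at $0$. $\lfloor x\rfloor$ is the floor and $\langle x\rangle=x-\lfloor x\rfloor$ the fractional part of $x\in\mathbb{Q}$. For an odd prime $p$, $t\in\mathbb{F}_p$, $n\ge 1$ and $a_i,b_i\in\mathbb{Q}\cap\mathbb{Z}_p$ ($1\le i\le n$), $${_nG}_n\left[\begin{array}{cccc}a_1,&a_2,&\ldots,&a_n\\ b_1,&b_2,&\ldots,&b_n\end{array}\Big|\ t\right]:=\frac{-1}{p-1}\sum_{j=0}^{p-2}(-1)^{jn}\,\overline{\omega}^j(t)\prod_{i=1}^n(-p)^{-\lfloor\langle a_i\rangle-\frac{j}{p-1}\rfloor-\lfloor\langle -b_i\rangle+\frac{j}{p-1}\rfloor}\frac{\Gamma_p(\langle a_i-\frac{j}{p-1}\rangle)}{\Gamma_p(\langle a_i\rangle)}\frac{\Gamma_p(\langle -b_i+\frac{j}{p-1}\rangle)}{\Gamma_p(\langle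 -b_i\rangle)}.$$ *)

theory Defs
  imports
    "HOL-Analysis.Analysis"
    "HOL-Computational_Algebra.Fraction_Field"
    "Berlekamp_Zassenhaus.Finite_Field"
begin

text \<open>
  The prime is \<open>p = CARD('p)\<close> for a type \<open>'p\<close> of class \<open>prime_card\<close>, and the field with \<open>p\<close>
  elements is \<open>'p mod_ring\<close>.
\<close>

section \<open>The ring of p-adic integers\<close>

text \<open>
  The inverse limit of the rings of integers modulo \<open>p ^ n\<close>: the \<open>n\<close>-th component is the
  representative in \<open>{0..<p ^ n}\<close> of the residue class modulo \<open>p ^ n\<close>.
\<close>

typedef (overloaded) ('p::prime_card) padic_int =
  "{f :: nat \<Rightarrow> int. \<forall>n. f n = f (Suc n) mod int CARD('p) ^ n}"
  by (rule exI[of _ "\<lambda>_. 0"]) simp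

setup_lifting type_definition_padic_int

lemma int_prime_card: "prime (int CARD('p::prime_card))"
  using prime_card[where 'a = 'p] by simp

lemma mod_power_Suc_mod_power: "a mod (q :: int) ^ Suc n mod q ^ n = a mod q ^ n"
  by (rule mod_mod_cancel) simp

lemma padic_compat_add:
  "a = a' mod q ^ n \<Longrightarrow> b = b' mod q ^ n \<Longrightarrow> (a + b) mod q ^ n = (a' + b') mod (q :: int) ^ Suc n mod q ^ n"
  by (simp only: mod_power_Suc_mod_power mod_add_eq)

lemma padic_compat_minus:
  "a = a' mod q ^ n \<Longrightarrow> (- a) mod q ^ n = (- a') mod (q :: int) ^ Suc n mod q ^ n"
  by (simp only: mod_power_Suc_mod_power mod_minus_eq)

lemma padic_compat_diff:
  "a = a' mod q ^ n \<Longrightarrow> b = b' mod q ^ n \<Longrightarrow> (a - b) mod q ^ n = (a' - b') mod (q :: int) ^ Suc n mod q ^ n"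
  by (simp only: mod_power_Suc_mod_power mod_diff_eq)

lemma padic_compat_mult:
  "a = a' mod q ^ n \<Longrightarrow> b = b' mod q ^ n \<Longrightarrow> (a * b) mod q ^ n = (a' * b') mod (q :: int) ^ Suc n mod q ^ n"
  by (simp only: mod_power_Suc_mod_power mod_mult_eq)

lift_definition padic_coord :: "'p::prime_card padic_int \<Rightarrow> nat \<Rightarrow> int" is "\<lambda>f. f" .

lemma padic_coord_Suc: "padic_coord (x :: 'p::prime_card padic_int) (Suc n) mod int CARD('p) ^ n = padic_coord x n"
  by transfer (rule sym, erule spec)

lemma padic_coord_mod: "padic_coord (x :: 'p::prime_card padic_int) n mod int CARD('p) ^ n = padic_coord x n"
  by (metis padic_coord_Suc mod_mod_trivial)

lemma padic_coord_mod_le: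
  "m \<le> n \<Longrightarrow> padic_coord (x :: 'p::prime_card padic_int) n mod int CARD('p) ^ m = padic_coord x m"
proof (induction n)
  case 0
  then show ?case using padic_coord_mod[of x 0] by simp
next
  case (Suc n)
  show ?case
  proof (cases "m = Suc n")
    case True
    then show ?thesis by (simp only: padic_coord_mod)
  next
    case False
    with Suc.prems have le: "m \<le> n" by simp
    have "padic_coord x (Suc n) mod int CARD('p) ^ m
        = padic_coord x (Suc n) mod int CARD('p) ^ n mod int CARD('p) ^ m"
      by (rule mod_mod_cancel[symmetric]) (rule le_imp_power_dvd[OF le])
    also have "\<dots> = padic_coord x m"
      by (simp only: padic_coord_Suc Suc.IH[OF le])
    finally show ?thesis .
  qed
qed

lemma padic_int_eqI: "(\<And>n. padic_coord x n = padic_coord y n) \<Longrightarrow> x = y"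
  by transfer blast

instantiation padic_int :: (prime_card) comm_ring_1
begin

lift_definition zero_padic_int :: "'a padic_int" is "\<lambda>_. 0" by simp

lift_definition one_padic_int :: "'a padic_int" is "\<lambda>n. 1 mod int CARD('a) ^ n"
  unfolding mod_power_Suc_mod_power by blast

lift_definition plus_padic_int :: "'a padic_int \<Rightarrow> 'a padic_int \<Rightarrow> 'a padic_int"
  is "\<lambda>f g n. (f n + g n) mod int CARD('a) ^ n"
  using padic_compat_add by blast

lift_definition uminus_padic_int :: "'a padic_int \<Rightarrow> 'a padic_int"
  is "\<lambda>f n. (- f n) mod int CARD('a) ^ n"
  using padic_compat_minus by blast

lift_definition minus_padic_int :: "'a padic_int \<Rightarrow> 'a padic_int \<Rightarrow> 'a padic_int"
  is "\<lambda>f g n. (f n - g n) mod int CARD('a) ^ n"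
  using padic_compat_diff by blast

lift_definition times_padic_int :: "'a padic_int \<Rightarrow> 'a padic_int \<Rightarrow> 'a padic_int"
  is "\<lambda>f g n. (f n * g n) mod int CARD('a) ^ n"
  using padic_compat_mult by blast

lemma padic_coord_0 [simp]: "padic_coord (0 :: 'a padic_int) n = 0"
  by transfer (rule refl)

lemma padic_coord_1: "padic_coord (1 :: 'a padic_int) n = 1 mod int CARD('a) ^ n"
  by transfer (rule refl)

lemma padic_coord_add:
  "padic_coord (x + y :: 'a padic_int) n = (padic_coord x n + padic_coord y n) mod int CARD('a) ^ n"
  by transfer (rule refl)

lemma padic_coord_uminus:
  "padic_coord (- x :: 'a padic_int) n = (- padic_coord x n) mod int CARD('a) ^ n"
  by transfer (rule refl)

lemma padic_coord_diff:
  "padic_coord (x - y :: 'a padic_int) n = (padic_coord x n - padic_coord y n) mod int CARD('a) ^ n"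
  by transfer (rule refl)

lemma padic_coord_mult:
  "padic_coord (x * y :: 'a padic_int) n = (padic_coord x n * padic_coord y n) mod int CARD('a) ^ n"
  by transfer (rule refl)

lemmas padic_coord_ops =
  padic_coord_1 padic_coord_add padic_coord_uminus padic_coord_diff padic_coord_mult

instance
proof
  fix a b c :: "'a padic_int"
  show "a * b * c = a * (b * c)"
    by (rule padic_int_eqI) (simp add: padic_coord_ops mod_simps ac_simps)
  show "a * b = b * a"
    by (rule padic_int_eqI) (simp add: padic_coord_ops ac_simps)
  show "1 * a = a"
    by (rule padic_int_eqI) (simp add: padic_coord_ops mod_simps padic_coord_mod)
  show "a + b + c = a + (b + c)"
    by (rule padic_int_eqI) (simp add: padic_coord_ops mod_simps ac_simps)
  show "a + b = b + a"
    by (rule padic_int_eqI) (simp add: padic_coord_ops ac_simps)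
  show "0 + a = a"
    by (rule padic_int_eqI) (simp add: padic_coord_ops padic_coord_mod)
  show "- a + a = 0"
    by (rule padic_int_eqI) (simp add: padic_coord_ops mod_simps)
  show "a - b = a + - b"
    by (rule padic_int_eqI) (simp add: padic_coord_ops mod_simps)
  show "(a + b) * c = a * c + b * c"
    by (rule padic_int_eqI) (simp add: padic_coord_ops mod_simps algebra_simps)
  have "int CARD('a) > 1" using nontriv[where 'a = 'a] by simp
  then have "padic_coord (1 :: 'a padic_int) 1 \<noteq> padic_coord 0 1"
    by (simp add: padic_coord_1)
  then show "(0 :: 'a padic_int) \<noteq> 1" by metis
qed

end

lemma padic_coord_diff_eq_0_iff:
  "padic_coord (x - y :: 'p::prime_card padic_int) n = 0 \<longleftrightarrow> padic_coord x n = padic_coord y n"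
  by (metis (no_types) padic_coord_diff padic_coord_mod mod_eq_dvd_iff dvd_eq_mod_eq_0)

lemma padic_coord_eq_0_le:
  "m \<le> n \<Longrightarrow> padic_coord (x :: 'p::prime_card padic_int) n = 0 \<Longrightarrow> padic_coord x m = 0"
  using padic_coord_mod_le[of m n x] by simp

lemma padic_coord_neq_0:
  assumes "x \<noteq> (0 :: 'p::prime_card padic_int)"
  shows "\<exists>n. padic_coord x (Suc n) \<noteq> 0"
proof -
  obtain n where n: "padic_coord x n \<noteq> 0"
    using assms padic_int_eqI[of x 0] by auto
  then show ?thesis
    using padic_coord_eq_0_le[of n "Suc n" x] by auto
qed

instance padic_int :: (prime_card) idom
proof
  fix a b :: "'a padic_int"
  let ?p = "int CARD('a)"
  assume "a \<noteq> 0" "b \<noteq> 0"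
  then obtain m n where m: "padic_coord a m \<noteq> 0" and n: "padic_coord b n \<noteq> 0"
    using padic_coord_neq_0 by blast
  let ?a = "padic_coord a (m + n)" and ?b = "padic_coord b (m + n)"
  have a: "\<not> ?p ^ m dvd ?a"
    using m padic_coord_mod_le[of m "m + n" a] by (simp add: dvd_eq_mod_eq_0)
  have b: "\<not> ?p ^ n dvd ?b"
    using n padic_coord_mod_le[of n "m + n" b] by (simp add: dvd_eq_mod_eq_0)
  have p: "prime_elem ?p"
    using int_prime_card[where 'p = 'a] by (rule prime_imp_prime_elem)
  have nz: "?a \<noteq> 0" "?b \<noteq> 0" using a b by auto
  have u: "\<not> is_unit ?p" using p by (auto simp: prime_elem_def)
  have "multiplicity ?p ?a < m" "multiplicity ?p ?b < n"
    using a b nz u by (simp_all add: power_dvd_iff_le_multiplicity)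
  then have "multiplicity ?p (?a * ?b) < m + n"
    using prime_elem_multiplicity_mult_distrib[OF p nz] by linarith
  then have "\<not> ?p ^ (m + n) dvd ?a * ?b"
    using nz u by (simp add: power_dvd_iff_le_multiplicity)
  then have "padic_coord (a * b) (m + n) \<noteq> 0"
    by (simp add: padic_coord_mult dvd_eq_mod_eq_0)
  then show "a * b \<noteq> 0" by auto
qed

section \<open>The p-adic metric\<close>

text \<open>For \<open>x \<noteq> 0\<close> the exponent below is the largest \<open>n\<close> such that \<open>p ^ n\<close> divides \<open>x\<close>.\<close>

definition padic_int_abs :: "'p::prime_card padic_int \<Rightarrow> real" where
  "padic_int_abs x =
     (if x = 0 then 0 else inverse (real CARD('p) ^ (LEAST n. padic_coord x (Suc n) \<noteq> 0)))"

lemma padic_int_abs_le_iff: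
  "padic_int_abs x \<le> inverse (real CARD('p) ^ n) \<longleftrightarrow> padic_coord (x :: 'p::prime_card padic_int) n = 0"
proof (cases "x = 0")
  case True
  then show ?thesis by (simp add: padic_int_abs_def)
next
  case False
  define k where "k = (LEAST n. padic_coord x (Suc n) \<noteq> 0)"
  have k: "padic_coord x (Suc k) \<noteq> 0"
    unfolding k_def using padic_coord_neq_0[OF False] by (rule LeastI_ex)
  have k': "padic_coord x (Suc i) = 0" if "i < k" for i
    using not_less_Least that unfolding k_def by blast
  have p1: "real CARD('p) > 1" using nontriv[where 'a = 'p] by simp
  have "padic_int_abs x \<le> inverse (real CARD('p) ^ n) \<longleftrightarrow> n \<le> k"
  proof -
    have "inverse (real CARD('p) ^ k) \<le> inverse (real CARD('p) ^ n)
        \<longleftrightarrow> real CARD('p) ^ n \<le> real CARD('p) ^ k"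
      using p1 by (intro inverse_le_iff_le) auto
    also have "\<dots> \<longleftrightarrow> n \<le> k" using p1 by (rule power_increasing_iff)
    finally show ?thesis using False by (simp add: padic_int_abs_def k_def)
  qed
  also have "\<dots> \<longleftrightarrow> padic_coord x n = 0"
  proof
    assume "n \<le> k"
    then show "padic_coord x n = 0"
      using k'[of "n - 1"] padic_coord_mod[of x 0] by (cases n) auto
  next
    assume "padic_coord x n = 0"
    then show "n \<le> k" using k padic_coord_eq_0_le[of "Suc k" n x] by (meson not_less_eq_eq)
  qed
  finally show ?thesis .
qed

lemma padic_int_abs_nonneg: "padic_int_abs x \<ge> 0"
  by (simp add: padic_int_abs_def)

lemma padic_int_abs_eq_0_iff: "padic_int_abs (x :: 'p::prime_card padic_int) = 0 \<longleftrightarrow> x = 0"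
  using nontriv[where 'a = 'p] by (auto simp: padic_int_abs_def)

lemma padic_int_abs_cases:
  "padic_int_abs (x :: 'p::prime_card padic_int) = 0 \<or> (\<exists>n. padic_int_abs x = inverse (real CARD('p) ^ n))"
  by (auto simp: padic_int_abs_def)

lemma padic_int_abs_ultrametric:
  "padic_int_abs (x - y :: 'p::prime_card padic_int) \<le> max (padic_int_abs x) (padic_int_abs y)"
proof -
  let ?m = "max (padic_int_abs x) (padic_int_abs y)"
  consider "?m = 0" | n where "?m = inverse (real CARD('p) ^ n)"
    using padic_int_abs_cases[of x] padic_int_abs_cases[of y] by (metis max_def)
  then show ?thesis
  proof cases
    case 1
    then have "padic_int_abs x = 0" "padic_int_abs y = 0"
      using padic_int_abs_nonneg[of x] padic_int_abs_nonneg[of y] by linarith+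
    then have "x = 0" "y = 0" by (simp_all add: padic_int_abs_eq_0_iff)
    then show ?thesis by (simp add: padic_int_abs_def)
  next
    case (2 n)
    have "padic_int_abs x \<le> inverse (real CARD('p) ^ n)" "padic_int_abs y \<le> inverse (real CARD('p) ^ n)"
      using 2 by linarith+
    then have "padic_coord (x - y) n = 0"
      by (simp add: padic_int_abs_le_iff padic_coord_diff)
    then show ?thesis using 2 by (simp add: padic_int_abs_le_iff)
  qed
qed

instantiation padic_int :: (prime_card) metric_space
begin

definition dist_padic_int :: "'a padic_int \<Rightarrow> 'a padic_int \<Rightarrow> real" where
  "dist_padic_int x y = padic_int_abs (x - y)"

definition uniformity_padic_int :: "('a padic_int \<times> 'a padic_int) filter" where
  "uniformity_padic_int = (INF e\<in>{0<..}. principal {(x, y). dist x y < e})"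

definition open_padic_int :: "'a padic_int set \<Rightarrow> bool" where
  "open_padic_int U = (\<forall>x\<in>U. eventually (\<lambda>(x', y). x' = x \<longrightarrow> y \<in> U) uniformity)"

instance
proof
  fix x y z :: "'a padic_int"
  show "dist x y = 0 \<longleftrightarrow> x = y"
    by (simp add: dist_padic_int_def padic_int_abs_eq_0_iff)
  have "padic_int_abs ((x - z) - (y - z)) \<le> max (padic_int_abs (x - z)) (padic_int_abs (y - z))"
    by (rule padic_int_abs_ultrametric)
  then show "dist x y \<le> dist x z + dist y z"
    using padic_int_abs_nonneg[of "x - z"] padic_int_abs_nonneg[of "y - z"]
    by (simp add: dist_padic_int_def)
qed (simp_all add: uniformity_padic_int_def open_padic_int_def)

end

section \<open>p-adic numbers, the Teichmueller character and the p-adic gamma function\<close>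

text \<open>The field of p-adic numbers is the fraction field \<open>'p padic_int fract\<close>.\<close>

definition padic_embed :: "'p::prime_card padic_int \<Rightarrow> 'p padic_int fract" where
  "padic_embed z = Fract z 1"

definition padic_residue :: "'p::prime_card padic_int \<Rightarrow> 'p mod_ring" where
  "padic_residue z = of_int (padic_coord z 1)"

text \<open>
  The image in the p-adic integers of a rational number whose reduced denominator is prime to
  \<open>p\<close>; unspecified for other rational numbers.
\<close>

definition padic_of_rat :: "rat \<Rightarrow> 'p::prime_card padic_int" where
  "padic_of_rat q = (THE z. of_int (snd (quotient_of q)) * z = of_int (fst (quotient_of q)))"

definition padic_Gamma :: "'p::prime_card padic_int \<Rightarrow> 'p padic_int" where
  "padic_Gamma = (THE f. continuous_on UNIV f \<and> (\<forall>z. f z dvd 1) \<and> f 0 = 1 \<and>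
     (\<forall>n::nat. n > 0 \<longrightarrow>
        f (of_nat n) = (-1) ^ n * of_nat (\<Prod>j | 0 < j \<and> j < n \<and> \<not> CARD('p) dvd j. j)))"

text \<open>Unspecified at \<open>0\<close>.\<close>

definition teichmueller :: "'p::prime_card mod_ring \<Rightarrow> 'p padic_int" where
  "teichmueller a = (THE z. z ^ (CARD('p) - 1) = 1 \<and> padic_residue z = a)"

text \<open>
  The \<open>j\<close>-th power of the inverse Teichmueller character. As for every multiplicative character,
  the value at \<open>0\<close> is \<open>0\<close>, also for \<open>j = 0\<close>.
\<close>

definition teichmueller_bar_pow :: "nat \<Rightarrow> 'p::prime_card mod_ring \<Rightarrow> 'p padic_int fract" where
  "teichmueller_bar_pow j t = (if t = 0 then 0 else inverse (padic_embed (teichmueller t)) ^ j)"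

definition quadratic_char :: "'p::prime_card mod_ring \<Rightarrow> int" where
  "quadratic_char a = (if a = 0 then 0 else if \<exists>b. a = b\<^sup>2 then 1 else -1)"

section \<open>McCarthy's p-adic hypergeometric series\<close>

text \<open>
  The upper parameters \<open>as\<close> and the lower parameters \<open>bs\<close> are lists of the same length \<open>n\<close>,
  consisting of rational numbers with denominators prime to \<open>p\<close>. \<open>frac\<close> is the fractional part.
\<close>

definition padic_hyper_G ::
  "rat list \<Rightarrow> rat list \<Rightarrow> 'p::prime_card mod_ring \<Rightarrow> 'p padic_int fract" where
  "padic_hyper_G as bs t =
     (let p = CARD('p); n = length as;
          \<Gamma> = (\<lambda>q::rat. padic_embed (padic_Gamma (padic_of_rat q :: 'p padic_int)));
          r = (\<lambda>j::nat. of_nat j / (of_nat p - 1) :: rat)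
      in (-1) / (of_nat p - 1) *
         (\<Sum>j = 0..p - 2. (-1) ^ (j * n) * teichmueller_bar_pow j t *
            (\<Prod>i<n.
               (- of_nat p) powi (- \<lfloor>frac (as ! i) - r j\<rfloor> - \<lfloor>frac (- bs ! i) + r j\<rfloor>) *
               (\<Gamma> (frac (as ! i - r j)) / \<Gamma> (frac (as ! i))) *
               (\<Gamma> (frac (- bs ! i + r j)) / \<Gamma> (frac (- bs ! i))))))"

end

theory Submission
  imports Defs "HOL-Number_Theory.Euler_Criterion"
begin

text \<open>
  Expanding both sides in powers of \<open>\<omega>\<close>, the two series differ only in the factor of the lower
  parameter \<open>0\<close> against that of \<open>1/2\<close>, and the sum over \<open>t\<close> contributes the Jacobi sum
  \<open>\<Sum>\<phi>(t (t - 1)) \<omega>\<^sup>-\<^sup>j(t)\<close>. So the theorem is the Gross--Koblitz formula for the Jacobi sums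
  \<open>J(\<omega>\<^sup>-\<^sup>k, \<phi>) = \<Sum>\<omega>\<^sup>-\<^sup>k(t) \<phi>(1 - t)\<close>, the term \<open>j = 0\<close> accounting for the \<open>-1\<close>.

  That formula is proved modulo \<open>p\<^sup>s\<close>. Put \<open>\<mu> = (p - 1)/2\<close>, \<open>g = (p\<^sup>s - 1)/2\<close>, \<open>N = \<mu> p\<^sup>s\<close> and
  \<open>m = k (p\<^sup>s - 1)/(p - 1)\<close>. Replacing \<open>\<phi>(1 - t)\<close> by \<open>(1 - \<omega>(t))\<^sup>N\<close> shows that \<open>J\<close> is \<open>p - 1\<close> times
  the trace of \<open>\<psi> \<circ> X\<^sup>-\<^sup>k (1 - X)\<^sup>N\<close> on polynomials of degree at most \<open>g\<close>, where \<open>\<psi>\<close> maps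
  \<open>\<Sum>q\<^sub>i X\<^sup>i\<close> to \<open>\<Sum>q\<^sub>p\<^sub>u X\<^sup>u\<close>. Following Dwork, this operator almost commutes with \<open>X d/dX - m\<close> up to
  a factor \<open>p\<close>; in the basis \<open>(1 - X)\<^sup>c\<close> the cokernel is one-dimensional up to small errors, so
  \<open>(1 - p)\<close> times the trace is the eigenvalue on the cokernel, which is a quotient of the binomial
  coefficients \<open>(pg + \<mu>) choose (pm + k)\<close> and \<open>g choose m\<close>. Splitting off the multiples of \<open>p\<close> in the
  factorials turns this quotient into values of the p-adic gamma function at integers converging to
  \<open>1/2\<close>, \<open>1 - k/(p - 1)\<close> and \<open>1/2 + k/(p - 1)\<close>.
\<close>

text \<open>Write L for the operator and D for X d/dX. Since D - m intertwines p L on its source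
  with L on its target, the difference of the two traces, 1 - p times that of L, sees only the
  cokernel; and 1 - p cancels the factor p - 1 of the Jacobi sum up to sign. The value of m is
  forced by p m + k = m + k p^s, which makes the error a multiple of p^s. The obstacle is that
  inverting D - m introduces factorial denominators. They are absorbed because row c of L in the
  basis (1 - X)^c is divisible by p^(g - c); where p^s must be taken out of this as well, 2s <= g is
  needed, hence p >= 5. The method reaches only k < \<mu>: for s > 0 and k > \<mu> the exponent m
  exceeds g, so X^m leaves the space. The remaining characters follow from \<phi> = \<omega>^\<mu>
  and from J(\<omega>^-k, \<phi>) J(\<omega>^k, \<phi>) = p. For p = 3 only j = 1 is left besides j
  = 0, and its sum is evaluated directly.\<close>

hide_const (open) up_ring.coeff up_ring.monom module.smult

section \<open>The trace of a Cartier operator on polynomials\<close>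

text \<open>
  The coefficient of \<open>(1 - X)\<^sup>c\<close> in the polynomial \<open>\<Sum>\<^sub>u q\<^sub>p\<^sub>u\<^sub>+\<^sub>k X\<^sup>u\<close>, where \<open>q = \<Sum>\<^sub>i q\<^sub>i X\<^sup>i\<close>.
\<close>

definition psi_coeff :: "nat \<Rightarrow> nat \<Rightarrow> nat \<Rightarrow> int poly \<Rightarrow> int" where
  "psi_coeff p k c q = (- 1) ^ c * (\<Sum>u\<le>degree q. int (u choose c) * coeff q (p * u + k))"

lemma psi_coeff_bound:
  assumes "p > 0" "degree q \<le> B"
  shows "psi_coeff p k c q = (- 1) ^ c * (\<Sum>u\<le>B. int (u choose c) * coeff q (p * u + k))"
proof -
  have "coeff q (p * u + k) = 0" if "degree q < u" for u
  proof (rule coeff_eq_0)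
    have "u \<le> p * u" using assms by simp
    then show "degree q < p * u + k" using that by linarith
  qed
  then show ?thesis
    unfolding psi_coeff_def using assms
    by (intro arg_cong[where f = "\<lambda>x. _ * x"] sum.mono_neutral_left) auto
qed

lemma psi_coeff_diff:
  assumes "p > 0"
  shows "psi_coeff p k c (q - r) = psi_coeff p k c q - psi_coeff p k c r"
proof -
  define B where "B = max (degree q) (degree r)"
  have "degree (q - r) \<le> B" "degree q \<le> B" "degree r \<le> B"
    by (auto simp: B_def intro: degree_diff_le_max)
  then show ?thesis
    by (simp add: psi_coeff_bound[OF assms, where B = B] sum_subtractf algebra_simps sum_distrib_left)
qed

lemma psi_coeff_smult: "p > 0 \<Longrightarrow> psi_coeff p k c (smult a q) = a * psi_coeff p k c q"
  by (simp add: psi_coeff_bound[OF _ degree_smult_le] psi_coeff_def sum_distrib_left algebra_simps)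

text \<open>The operator turns a factor X^p into X, so 1 - X^p comes out as 1 - X and raises the
  index of the basis (1 - X)^c by one. The hypothesis k < p keeps X^p q out of the coefficient with
  index k.\<close>

lemma psi_coeff_mult_one_minus_power:
  assumes "k < p"
  shows "psi_coeff p k c ((1 - monom 1 p) * q) = (if c = 0 then 0 else psi_coeff p k (c - 1) q)"
proof -
  have p: "p > 0" using assms by simp
  define B where "B = degree q + p"
  define a where "a = (\<lambda>u. coeff q (p * u + k))"
  have dB: "degree q \<le> B" "degree (monom 1 p * q) \<le> Suc B" "degree q \<le> Suc B"
    using degree_mult_le[of "monom (1::int) p" q] degree_monom_le[of "1::int" p]
    unfolding B_def by linarith+
  have m: "coeff (monom 1 p * q) (p * u + k) = (if u = 0 then 0 else a (u - 1))" for u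
  proof (cases u)
    case 0
    then show ?thesis using assms by (simp add: coeff_monom_mult)
  next
    case (Suc v)
    have "p * u + k - p = p * v + k" using Suc by (simp add: algebra_simps)
    then show ?thesis using Suc by (simp add: coeff_monom_mult a_def)
  qed
  have "psi_coeff p k c ((1 - monom 1 p) * q) = psi_coeff p k c q - psi_coeff p k c (monom 1 p * q)"
    using psi_coeff_diff[OF p] by (simp add: algebra_simps)
  also have "psi_coeff p k c q = (- 1) ^ c * (\<Sum>u\<le>B. int (u choose c) * a u)"
    using psi_coeff_bound[OF p dB(1)] by (simp add: a_def)
  also have "psi_coeff p k c (monom 1 p * q) = (- 1) ^ c * (\<Sum>u\<le>B. int (Suc u choose c) * a u)"
    unfolding psi_coeff_bound[OF p dB(2)] m by (subst sum.atMost_Suc_shift) simp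
  finally have eq: "psi_coeff p k c ((1 - monom 1 p) * q)
     = (- 1) ^ c * (\<Sum>u\<le>B. (int (u choose c) - int (Suc u choose c)) * a u)"
    by (simp add: sum_subtractf algebra_simps)
  show ?thesis
  proof (cases c)
    case 0
    then show ?thesis using eq by simp
  next
    case (Suc c')
    have "psi_coeff p k c' q = (- 1) ^ c' * (\<Sum>u\<le>B. int (u choose c') * a u)"
      using psi_coeff_bound[OF p dB(1)] by (simp add: a_def)
    then show ?thesis using eq Suc by (simp add: sum_negf)
  qed
qed

lemma coeff_one_minus_X_power: "coeff ([:1, -1:] ^ n :: int poly) i = int (n choose i) * (- 1) ^ i"
proof (cases "i \<le> n")
  case True
  then show ?thesis by (simp add: coeff_linear_poly_power)
next
  case False
  then have "degree ([:1, -1:] ^ n :: int poly) < i" by (simp add: degree_power_eq)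
  then show ?thesis using False by (simp add: coeff_eq_0)
qed

text \<open>The middle binomial coefficients of (1 - X)^p are divisible by p. Moreover 1 - X^p and
  (1 - X)^p both vanish at 1, which puts the factor 1 - X into the error;
  \<open>power_dvd_psi_coeff\<close> recovers one factor from it at each use.\<close>

lemma one_minus_monom_prime:
  assumes "prime p" "odd p"
  obtains Q :: "int poly" where "1 - monom 1 p = [:1, -1:] ^ p + smult (int p) ([:1, -1:] * Q)"
proof -
  define P :: "int poly" where "P = 1 - monom 1 p - [:1, -1:] ^ p"
  have p0: "p > 0" using assms(1) by (simp add: prime_gt_0_nat)
  have dvd: "int p dvd coeff P j" for j
  proof -
    have c: "coeff ([:1, -1:] ^ p :: int poly) j = int (p choose j) * (- 1) ^ j"
      by (rule coeff_one_minus_X_power)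
    consider "j = 0" | "j = p" | "0 < j" "j < p" | "j > p" by linarith
    then show ?thesis
    proof cases
      case 3
      have "int p dvd int (p choose j)"
        using dvd_choose_prime[of j p] assms(1) 3 by simp
      then show ?thesis using 3 by (simp add: P_def c)
    qed (use p0 assms c in \<open>auto simp: P_def binomial_eq_0\<close>)
  qed
  have "[:int p:] dvd P" unfolding const_poly_dvd_iff using dvd by blast
  then obtain R where R: "P = smult (int p) R" by (auto elim!: dvdE)
  have "poly P 1 = 0" using p0 by (simp add: P_def poly_monom)
  then have "poly R 1 = 0" using R p0 by simp
  then have "[:-1, 1:] dvd R" by (simp add: poly_eq_0_iff_dvd)
  then obtain Q where Q: "R = [:-1, 1:] * Q" by (auto elim: dvdE)
  have "1 - monom 1 p = [:1, -1:] ^ p + P" by (simp add: P_def)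
  also have "P = smult (int p) ([:1, -1:] * (- Q))" using R Q by simp
  finally show ?thesis by (rule that)
qed

text \<open>
  Each factor \<open>(1 - X)\<^sup>p\<close> is \<open>1 - X\<^sup>p\<close>, which becomes a factor \<open>1 - X\<close> outside the operator, up to
  a multiple of \<open>p (1 - X)\<close>.
\<close>

lemma power_dvd_psi_coeff:
  assumes "prime p" "odd p" "k < p" "(p - 1) * a + p * c < n"
  shows "int p ^ a dvd psi_coeff p k c (q * [:1, -1:] ^ n)"
  using assms(4)
proof (induction n arbitrary: q a c rule: less_induct)
  case (less n)
  have p0: "p > 0" using assms(1) by (simp add: prime_gt_0_nat)
  show ?case
  proof (cases a)
    case 0
    then show ?thesis by simp
  next
    case (Suc b)
    obtain Q :: "int poly" where Q: "1 - monom 1 p = [:1, -1:] ^ p + smult (int p) ([:1, -1:] * Q)"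
      using one_minus_monom_prime[OF assms(1,2)] by blast
    have "(p - 1) * a = (p - 1) + (p - 1) * b" using Suc by simp
    then have n: "p \<le> n" using less.prems by linarith
    let ?y = "[:1, -1:] :: int poly"
    have "?y ^ n = ?y ^ p * ?y ^ (n - p)" using n by (simp flip: power_add)
    also have "?y ^ p = (1 - monom 1 p) - smult (int p) (?y * Q)" using Q by simp
    finally have "q * ?y ^ n = q * ((1 - monom 1 p - smult (int p) (?y * Q)) * ?y ^ (n - p))" by simp
    also have "\<dots> = (1 - monom 1 p) * (q * ?y ^ (n - p)) - smult (int p) ((q * Q) * ?y ^ Suc (n - p))"
      by (simp only: left_diff_distrib right_diff_distrib mult_smult_left mult_smult_right power_Suc mult_1_left ac_simps)
    finally have qy: "q * ?y ^ n = \<dots>" .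
    \<comment> \<open>Both terms fit the bound \<open>(p - 1) * a + p * c < n\<close>: lowering
      \<open>c\<close> by one uses up p factors 1 - X, while a factor p costs only p - 1 of
      them.\<close>
    have eq: "psi_coeff p k c (q * ?y ^ n) = (if c = 0 then 0 else psi_coeff p k (c - 1) (q * ?y ^ (n - p)))
       - int p * psi_coeff p k c ((q * Q) * ?y ^ Suc (n - p))"
      unfolding qy by (simp only: psi_coeff_diff[OF p0] psi_coeff_smult[OF p0] psi_coeff_mult_one_minus_power[OF assms(3)])
    have "int p ^ a dvd (if c = 0 then 0 else psi_coeff p k (c - 1) (q * ?y ^ (n - p)))"
    proof (cases c)
      case (Suc c')
      have "p * c = p + p * c'" using Suc by simp
      then have "(p - 1) * a + p * c' < n - p" using less.prems by linarith
      then have "int p ^ a dvd psi_coeff p k c' (q * ?y ^ (n - p))"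
        using p0 n by (intro less.IH) auto
      then show ?thesis using Suc by simp
    qed simp
    moreover have "int p ^ b dvd psi_coeff p k c ((q * Q) * ?y ^ Suc (n - p))"
    proof (rule less.IH)
      show "Suc (n - p) < n" using n prime_gt_1_nat[OF assms(1)] by linarith
      show "(p - 1) * b + p * c < Suc (n - p)"
        using less.prems \<open>(p - 1) * a = _\<close> n by linarith
    qed
    then have "int p ^ a dvd int p * psi_coeff p k c ((q * Q) * ?y ^ Suc (n - p))"
      using Suc by simp
    ultimately show ?thesis unfolding eq by (rule dvd_diff)
  qed
qed

text \<open>Both sides are the coefficient of X^j in (1 - (1 + X))^u (1 + X)^N. This collapses the
  sums over the basis index c, for the trace as well as for the cokernel.\<close>

lemma alternating_binomial_sum:
  assumes "u \<le> g"
  shows "(\<Sum>c\<le>g. (- 1) ^ c * int (u choose c) * int ((N + c) choose j))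
       = (if u \<le> j then (- 1) ^ u * int (N choose (j - u)) else 0)"
proof -
  let ?z = "[:1, 1:] :: int poly"
  have cf: "coeff (?z ^ n) i = int (n choose i)" for n i
  proof (cases "i \<le> n")
    case True
    then show ?thesis by (simp add: coeff_linear_poly_power)
  next
    case False
    then have "degree (?z ^ n) < i" by (simp add: degree_power_eq)
    then show ?thesis using False by (simp add: coeff_eq_0)
  qed
  have "(\<Sum>c\<le>g. (- 1) ^ c * int (u choose c) * int ((N + c) choose j))
      = (\<Sum>c\<le>u. (- 1) ^ c * int (u choose c) * int ((N + c) choose j))"
    using assms by (intro sum.mono_neutral_right) auto
  also have "\<dots> = coeff (\<Sum>c\<le>u. of_nat (u choose c) * (- ?z) ^ c * 1 ^ (u - c) * ?z ^ N) j"
    unfolding coeff_sum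
  proof (rule sum.cong[OF refl])
    fix c
    have "of_nat (u choose c) * (- ?z) ^ c * 1 ^ (u - c) * ?z ^ N
        = [:int (u choose c):] * ([:(- 1) ^ c:] * ?z ^ c) * ?z ^ N"
      by (subst power_minus[of ?z])
        (simp only: power_one mult_1_right, simp only: of_nat_poly poly_const_pow[symmetric] pCons_one[symmetric] minus_pCons minus_zero)
    also have "\<dots> = smult ((- 1) ^ c * int (u choose c)) (?z ^ (N + c))"
      by (simp add: power_add ac_simps)
    finally have "of_nat (u choose c) * (- ?z) ^ c * 1 ^ (u - c) * ?z ^ N = \<dots>" .
    then show "(- 1) ^ c * int (u choose c) * int ((N + c) choose j)
        = coeff (of_nat (u choose c) * (- ?z) ^ c * 1 ^ (u - c) * ?z ^ N) j"
      by (simp add: cf)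
  qed
  also have "(\<Sum>c\<le>u. of_nat (u choose c) * (- ?z) ^ c * 1 ^ (u - c) * ?z ^ N) = (- ?z + 1) ^ u * ?z ^ N"
    by (simp add: binomial_ring sum_distrib_right)
  also have "(- ?z + 1) = monom (- 1) 1"
    by (simp add: monom_altdef one_pCons)
  also have "monom (- 1) 1 ^ u = (monom ((- 1) ^ u) u :: int poly)"
    by (simp add: monom_power)
  finally show ?thesis by (simp add: coeff_monom_mult cf)
qed

section \<open>The matrix of the operator in the basis (1 - X)^c\<close>

lemma psi_coeff_one_minus_X_power:
  assumes "p > 0" "n < p * Suc B + k"
  shows "psi_coeff p k c ([:1, -1:] ^ n)
       = (- 1) ^ c * (\<Sum>u\<le>B. int (u choose c) * ((- 1) ^ (p * u + k) * int (n choose (p * u + k))))"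
proof -
  have 1: "psi_coeff p k c ([:1, -1:] ^ n)
      = (- 1) ^ c * (\<Sum>u\<le>max B n. int (u choose c) * ((- 1) ^ (p * u + k) * int (n choose (p * u + k))))"
    by (subst psi_coeff_bound[OF assms(1), where B = "max B n"])
      (simp_all add: coeff_one_minus_X_power degree_power_eq ac_simps)
  have "int (u choose c) * ((- 1) ^ (p * u + k) * int (n choose (p * u + k))) = 0" if "B < u" for u
  proof -
    have "p * Suc B \<le> p * u" using that by (intro mult_le_mono2) simp
    then have "n < p * u + k" using assms(2) by linarith
    then show ?thesis by simp
  qed
  then show ?thesis unfolding 1
    by (intro arg_cong[where f = "\<lambda>x. _ * x"] sum.mono_neutral_right) auto
qed

text \<open>Compare the operator with D = X d/dX: applied before the operator, D multiplies the
  coefficient with index p u + k by p u + k, applied after it by u. So p D after the operator equals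
  D - k before it. For y = 1 - X the left side uses D y^c = c (y^c - y^(c-1)), the right side D y^n
  = n (y^n - y^(n-1)).\<close>

lemma psi_coeff_recurrence:
  fixes p k :: nat
  assumes "p > 0"
  defines "T \<equiv> \<lambda>c n. psi_coeff p k c ([:1, -1:] ^ n)"
  shows "int p * (int c * T c n - int (Suc c) * T (Suc c) n) = (int n - int k) * T c n - int n * T c (n - 1)"
proof -
  define b where "b = (\<lambda>n u. (- 1) ^ (p * u + k) * int (n choose (p * u + k)))"
  have "1 * n \<le> p * n" using assms(1) by (intro mult_le_mono1) simp
  then have n: "n < p * Suc n + k" "n - 1 < p * Suc n + k"
    using assms(1) unfolding mult_Suc_right by linarith+
  have T: "T c n = (- 1) ^ c * (\<Sum>u\<le>n. int (u choose c) * b n u)"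
    "T c (n - 1) = (- 1) ^ c * (\<Sum>u\<le>n. int (u choose c) * b (n - 1) u)" for c
    using psi_coeff_one_minus_X_power[OF assms(1) n(1)] psi_coeff_one_minus_X_power[OF assms(1) n(2)]
    by (simp_all add: T_def b_def)
  have u: "int u * int (u choose c) = int c * int (u choose c) + int (Suc c) * int (u choose Suc c)" for u
  proof (cases "c \<le> u")
    case True
    have "Suc c * (u choose Suc c) = (u - c) * (u choose c)"
      using binomial_absorb_comp[of u c] binomial_absorption[of c u] by simp
    then have "int (Suc c) * int (u choose Suc c) = (int u - int c) * int (u choose c)"
      using True by (simp only: of_nat_mult[symmetric] of_nat_diff[symmetric])
    then show ?thesis by (simp add: algebra_simps)
  qed (simp add: binomial_eq_0)
  have b: "(int p * int u + int k - int n) * b n u = - int n * b (n - 1) u" for u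
  proof -
    let ?s = "(- 1 :: int) ^ (p * u + k)"
    have "int (n - (p * u + k)) * int (n choose (p * u + k)) = int n * int ((n - 1) choose (p * u + k))"
      unfolding of_nat_mult[symmetric] binomial_absorb_comp ..
    then have eq: "(int p * int u + int k - int n) * int (n choose (p * u + k)) = - int n * int ((n - 1) choose (p * u + k))"
      by (cases "p * u + k \<le> n") (simp_all add: of_nat_diff algebra_simps binomial_eq_0)
    have "(int p * int u + int k - int n) * b n u = ?s * ((int p * int u + int k - int n) * int (n choose (p * u + k)))"
      unfolding b_def by (rule mult.left_commute)
    then show ?thesis unfolding eq b_def by simp
  qed
  have b': "int p * int u * b n u = (int n - int k) * b n u - int n * b (n - 1) u" for u
    using b[of u] by (simp add: algebra_simps)
  have "int p * (int c * T c n - int (Suc c) * T (Suc c) n)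
      = (- 1) ^ c * (\<Sum>u\<le>n. int p * (int c * int (u choose c) + int (Suc c) * int (u choose Suc c)) * b n u)"
  proof -
    have "int p * (int c * T c n - int (Suc c) * T (Suc c) n)
      = (- 1) ^ c * (int p * int c * (\<Sum>u\<le>n. int (u choose c) * b n u)
          + int p * int (Suc c) * (\<Sum>u\<le>n. int (u choose Suc c) * b n u))"
      unfolding T by (simp add: algebra_simps)
    also have "int p * int c * (\<Sum>u\<le>n. int (u choose c) * b n u)
          + int p * int (Suc c) * (\<Sum>u\<le>n. int (u choose Suc c) * b n u)
        = (\<Sum>u\<le>n. int p * (int c * int (u choose c) + int (Suc c) * int (u choose Suc c)) * b n u)"
      unfolding sum_distrib_left sum.distrib[symmetric] by (intro sum.cong refl) (simp add: algebra_simps)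
    finally show ?thesis .
  qed
  also have "\<dots> = (- 1) ^ c * (\<Sum>u\<le>n. int (u choose c) * (int p * int u * b n u))"
    unfolding u[symmetric] by (simp add: ac_simps)
  also have "\<dots> = (- 1) ^ c * (\<Sum>u\<le>n. int (u choose c) * ((int n - int k) * b n u - int n * b (n - 1) u))"
    by (simp only: b')
  also have "\<dots> = (int n - int k) * T c n - int n * T c (n - 1)"
    unfolding T sum_distrib_left sum_subtractf[symmetric]
    by (intro sum.cong refl) (simp add: algebra_simps)
  finally show ?thesis .
qed

text \<open>Up to the sign (-1)^m, the weight is the coefficient of X^m in (1 - X)^c. The sum
  therefore reads off the coefficient of X^m in the image, which is the one with index p m + k in (1
  - X)^n.\<close>

lemma sum_weighted_psi_coeff:
  assumes "p > 0" "odd p" "n < p * Suc g + k" "m \<le> g"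
  shows "(\<Sum>c\<le>g. int (c choose m) * psi_coeff p k c ([:1, -1:] ^ n)) = (- 1) ^ k * int (n choose (p * m + k))"
proof -
  let ?b = "\<lambda>u. (- 1) ^ (p * u + k) * int (n choose (p * u + k))"
  have "(\<Sum>c\<le>g. int (c choose m) * psi_coeff p k c ([:1, -1:] ^ n))
     = (\<Sum>c\<le>g. \<Sum>u\<le>g. (- 1) ^ c * int (u choose c) * int (c choose m) * ?b u)"
    unfolding psi_coeff_one_minus_X_power[OF assms(1,3)]
    by (simp add: sum_distrib_left ac_simps)
  also have "\<dots> = (\<Sum>u\<le>g. (\<Sum>c\<le>g. (- 1) ^ c * int (u choose c) * int ((0 + c) choose m)) * ?b u)"
    by (subst sum.swap) (simp add: sum_distrib_right)
  also have "\<dots> = (\<Sum>u\<le>g. if u = m then (- 1) ^ u * ?b u else 0)"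
    by (intro sum.cong refl) (subst alternating_binomial_sum, auto simp: binomial_eq_0)
  also have "\<dots> = (- 1) ^ m * ?b m" using assms(4) by simp
  also have "\<dots> = (- 1) ^ k * int (n choose (p * m + k))"
    using assms(2) by (simp add: power_add power_mult minus_one_power_iff)
  finally show ?thesis .
qed

text \<open>This is the trace computed in the basis of monomials: the diagonal entry at X^u is the
  coefficient of (1 - X)^N with index p u + k - u. The bound on N + g makes the space of polynomials
  of degree at most g stable.\<close>

lemma trace_psi_coeff:
  assumes "odd p" "N + g < p * Suc g + k"
  shows "(\<Sum>c\<le>g. psi_coeff p k c ([:1, -1:] ^ (N + c))) = (- 1) ^ k * (\<Sum>u\<le>g. int (N choose ((p - 1) * u + k)))"
proof -
  have p: "p > 0" using assms(1) by (auto intro: Nat.gr0I)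
  let ?s = "\<lambda>u. (- 1 :: int) ^ (p * u + k)"
  have "(\<Sum>c\<le>g. psi_coeff p k c ([:1, -1:] ^ (N + c)))
     = (\<Sum>c\<le>g. \<Sum>u\<le>g. (- 1) ^ c * int (u choose c) * int ((N + c) choose (p * u + k)) * ?s u)"
  proof (intro sum.cong refl)
    fix c assume "c \<in> {..g}"
    then have "N + c < p * Suc g + k" using assms(2) by simp
    from psi_coeff_one_minus_X_power[OF p this, of c]
    show "psi_coeff p k c ([:1, -1:] ^ (N + c))
       = (\<Sum>u\<le>g. (- 1) ^ c * int (u choose c) * int ((N + c) choose (p * u + k)) * ?s u)"
      by (simp add: sum_distrib_left ac_simps)
  qed
  also have "\<dots> = (\<Sum>u\<le>g. (\<Sum>c\<le>g. (- 1) ^ c * int (u choose c) * int ((N + c) choose (p * u + k))) * ?s u)"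
    by (subst sum.swap) (simp add: sum_distrib_right)
  also have "\<dots> = (\<Sum>u\<le>g. (- 1) ^ k * int (N choose ((p - 1) * u + k)))"
  proof (intro sum.cong refl)
    fix u assume u: "u \<in> {..g}"
    have "1 * u \<le> p * u" using p by (intro mult_le_mono1) simp
    then have "u \<le> p * u + k" by linarith
    moreover have "p * u + k - u = (p - 1) * u + k"
      using \<open>1 * u \<le> p * u\<close> by (simp add: diff_mult_distrib)
    ultimately have "(\<Sum>c\<le>g. (- 1) ^ c * int (u choose c) * int ((N + c) choose (p * u + k)))
        = (- 1) ^ u * int (N choose ((p - 1) * u + k))"
      using u by (subst alternating_binomial_sum) auto
    moreover have "(- 1 :: int) ^ u * ?s u = (- 1) ^ k"
      using assms(1) by (simp add: power_add power_mult minus_one_power_iff)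
    ultimately show "(\<Sum>c\<le>g. (- 1) ^ c * int (u choose c) * int ((N + c) choose (p * u + k))) * ?s u
        = (- 1) ^ k * int (N choose ((p - 1) * u + k))"
      by (metis mult.commute mult.left_commute)
  qed
  finally show ?thesis by (simp add: sum_distrib_left)
qed

text \<open>
  Here \<open>t c d\<close> is the matrix of an operator \<open>L\<close> and the hypothesis says that
  \<open>p (D - m) L = L (D - m)\<close> up to the error \<open>e\<close>, where \<open>D\<close> maps the \<open>c\<close>-th basis vector \<open>y\<^sup>c\<close> to
  \<open>c (y\<^sup>c - y\<^sup>c\<^sup>-\<^sup>1)\<close>. The weights \<open>w\<close> are, up to sign, the matrix of the map that
  kills \<open>y\<^sup>g\<close> and is inverse to \<open>D - m\<close> modulo \<open>y\<^sup>g\<close>.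
\<close>

lemma telescoping_trace:
  fixes t e :: "nat \<Rightarrow> nat \<Rightarrow> 'a::field_char_0" and p m :: 'a
  defines "w \<equiv> \<lambda>c d. fact c / fact d * (\<Prod>r\<in>{c<..<d}. of_nat r - m)"
  assumes "\<And>c d. c < d \<Longrightarrow> d \<le> g \<Longrightarrow>
    (p * (of_nat c - m) - (of_nat d - m)) * t c d - p * of_nat (Suc c) * t (Suc c) d + of_nat d * t c (d - 1) = e c d"
  shows "(1 - p) * (\<Sum>c\<le>g. t c c) = (\<Sum>c\<le>g. fact c / fact g * (\<Prod>r\<in>{c<..g}. of_nat r - m) * t c g)
     - p * t 0 0 + p * m * (\<Sum>d\<in>{1..g}. w 0 d * t 0 d) + (\<Sum>d\<le>g. \<Sum>c<d. w c d * e c d)"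
  using assms(2)
proof (induction g)
  case 0
  then show ?case by (simp add: algebra_simps)
next
  case (Suc g)
  define h where "h = Suc g"
  have int: "{c<..<h} = {c<..g}" for c by (auto simp: h_def)
  have h0: "of_nat h \<noteq> (0 :: 'a)" unfolding h_def by (rule of_nat_neq_0)
  have fh: "fact h = of_nat h * (fact g :: 'a)" by (simp add: h_def)
  have wh: "fact c / fact g * (\<Prod>r\<in>{c<..g}. of_nat r - m) = of_nat h * w c h" if "c \<le> g" for c
    unfolding w_def int fh using h0 by simp
  have wh': "fact c / fact h * (\<Prod>r\<in>{c<..h}. of_nat r - m) = (of_nat h - m) * w c h" if "c \<le> g" for c
  proof -
    have "{c<..h} = insert h {c<..g}" using that by (auto simp: h_def)
    then have "(\<Prod>r\<in>{c<..h}. of_nat r - m) = (of_nat h - m) * (\<Prod>r\<in>{c<..g}. of_nat r - m)"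
      by (simp add: h_def)
    then show ?thesis unfolding w_def int by simp
  qed
  \<comment> \<open>For c <= g this is (c - m) \<open>w c h * t c h\<close>. The form with
    \<open>w (c - 1) h\<close> extends to c = h, where it gives \<open>t h h\<close>, so that the
    sum below telescopes up to the end; c = 0 has no predecessor and yields the boundary
    term.\<close>
  define A where "A = (\<lambda>c. (if c = 0 then - m * w 0 h else of_nat c * w (c - 1) h) * t c h)"
  have wA: "(of_nat c - m) * w c h * t c h = A c" if "c \<le> g" for c
  proof (cases c)
    case 0
    then show ?thesis by (simp add: A_def)
  next
    case (Suc b)
    have "{b<..g} = insert c {c<..g}" using Suc that by auto
    then have "(\<Prod>r\<in>{b<..<h}. of_nat r - m) = (of_nat c - m) * (\<Prod>r\<in>{c<..<h}. of_nat r - m)"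
      unfolding int by simp
    moreover have "fact c = of_nat c * (fact b :: 'a)" using Suc by simp
    ultimately have "of_nat c * w b h = (of_nat c - m) * w c h"
      unfolding w_def by (simp only: times_divide_eq_left times_divide_eq_right ac_simps)
    then show ?thesis using Suc by (simp add: A_def)
  qed
  have A0: "A 0 = - m * w 0 h * t 0 h" by (simp add: A_def)
  have Ah: "A h = t h h" 
  proof -
    have "{g<..<h} = {}" by (auto simp: h_def)
    then have "of_nat h * w g h = 1" unfolding w_def fh using h0 by simp
    then show ?thesis by (simp add: A_def h_def)
  qed
  \<comment> \<open>These are the relations of the new column d = h, weighted by
    \<open>w c h\<close>. The terms with \<open>t c g\<close> and \<open>t c h\<close> make up the
    first sum of the claim for g and, up to \<open>t h h\<close>, for h.\<close>
  have "(\<Sum>c<h. w c h * (e c h - of_nat h * t c g)) + (\<Sum>c<h. (of_nat h - m) * w c h * t c h)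
     = (\<Sum>c<h. p * (A c - A (Suc c)))"
    unfolding sum.distrib[symmetric]
  proof (intro sum.cong refl)
    fix c assume c: "c \<in> {..<h}"
    have e: "e c h = (p * (of_nat c - m) - (of_nat h - m)) * t c h - p * of_nat (Suc c) * t (Suc c) h + of_nat h * t c g"
      using Suc.prems[of c h] c by (simp add: h_def)
    have A1: "A c = (of_nat c - m) * w c h * t c h" using wA[of c] c by (simp add: h_def)
    have A2: "A (Suc c) = of_nat (Suc c) * w c h * t (Suc c) h" by (simp add: A_def)
    show "w c h * (e c h - of_nat h * t c g) + (of_nat h - m) * w c h * t c h = p * (A c - A (Suc c))"
      unfolding e A1 A2 by (simp add: algebra_simps del: of_nat_Suc)
  qed
  also have "\<dots> = p * (A 0 - A h)"
    by (simp add: sum_distrib_left[symmetric] sum_lessThan_telescope')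
  finally have key: "(\<Sum>c<h. w c h * e c h) - (\<Sum>c<h. of_nat h * w c h * t c g)
      + (\<Sum>c<h. (of_nat h - m) * w c h * t c h) = - p * m * w 0 h * t 0 h - p * t h h"
    unfolding A0 Ah by (simp add: sum_subtractf algebra_simps sum_distrib_left)
  have S1: "(\<Sum>c\<le>g. fact c / fact g * (\<Prod>r\<in>{c<..g}. of_nat r - m) * t c g) = (\<Sum>c<h. of_nat h * w c h * t c g)"
    unfolding h_def lessThan_Suc_atMost using wh by (intro sum.cong refl) (simp add: h_def)
  have S2: "(\<Sum>c\<le>h. fact c / fact h * (\<Prod>r\<in>{c<..h}. of_nat r - m) * t c h)
     = t h h + (\<Sum>c<h. (of_nat h - m) * w c h * t c h)"
    unfolding h_def atMost_Suc lessThan_Suc_atMost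
    using wh' h0 by (subst sum.insert) (auto intro!: sum.cong simp: h_def simp del: of_nat_Suc)
  have IH: "(1 - p) * (\<Sum>c\<le>g. t c c) = (\<Sum>c\<le>g. fact c / fact g * (\<Prod>r\<in>{c<..g}. of_nat r - m) * t c g)
     - p * t 0 0 + p * m * (\<Sum>d\<in>{1..g}. w 0 d * t 0 d) + (\<Sum>d\<le>g. \<Sum>c<d. w c d * e c d)"
    by (rule Suc.IH) (use Suc.prems in auto)
  have S3: "(\<Sum>c\<le>h. t c c) = (\<Sum>c\<le>g. t c c) + t h h"
    "(\<Sum>d\<in>{1..h}. w 0 d * t 0 d) = (\<Sum>d\<in>{1..g}. w 0 d * t 0 d) + w 0 h * t 0 h"
    "(\<Sum>d\<le>h. \<Sum>c<d. w c d * e c d) = (\<Sum>d\<le>g. \<Sum>c<d. w c d * e c d) + (\<Sum>c<h. w c h * e c h)"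
    by (simp_all add: h_def)
  show ?case
    using IH key unfolding h_def[symmetric] S1 S2 S3 by (simp add: algebra_simps)
qed

text \<open>Each factor (r - m)/r is the quotient of r - 1 choose m by r choose m, so the product
  telescopes. The multiplier thus turns the weights on the cokernel in
  \<open>telescoping_trace\<close> into integers.\<close>

lemma fact_prod_eq_choose:
  fixes m :: nat
  assumes "c \<le> g"
  shows "of_nat (g choose m) * (fact c / fact g * (\<Prod>r\<in>{c<..g}. of_nat r - of_nat m)) = (of_nat (c choose m) :: 'a::field_char_0)"
  using assms
proof (induction g rule: dec_induct)
  case base
  then show ?case by simp
next
  case (step g)
  have "{c<..Suc g} = insert (Suc g) {c<..g}" using step(1) by auto
  then have P: "(\<Prod>r\<in>{c<..Suc g}. of_nat r - of_nat m :: 'a) = (of_nat (Suc g) - of_nat m) * (\<Prod>r\<in>{c<..g}. of_nat r - of_nat m)"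
    by simp
  have "of_nat (Suc g choose m) * (of_nat (Suc g) - of_nat m) = (of_nat (Suc g) * of_nat (g choose m) :: 'a)"
  proof (cases "m \<le> Suc g")
    case True
    have "of_nat (Suc g - m) * of_nat (Suc g choose m) = (of_nat (Suc g) * of_nat (g choose m) :: 'a)"
      unfolding of_nat_mult[symmetric] binomial_absorb_comp by simp
    then show ?thesis using True by (simp add: of_nat_diff ac_simps)
  qed (simp add: binomial_eq_0)
  note C = this
  have g0: "of_nat (Suc g) \<noteq> (0 :: 'a)" by (rule of_nat_neq_0)
  have "of_nat (Suc g choose m) * (fact c / fact (Suc g) * ((of_nat (Suc g) - of_nat m) * (\<Prod>r\<in>{c<..g}. of_nat r - of_nat m)))
      = (of_nat (Suc g choose m) * (of_nat (Suc g) - of_nat m)) * (fact c * (\<Prod>r\<in>{c<..g}. of_nat r - of_nat m)) / (of_nat (Suc g) * fact g :: 'a)"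
    by (simp del: of_nat_Suc)
  also have "\<dots> = of_nat (g choose m) * (fact c / fact g * (\<Prod>r\<in>{c<..g}. of_nat r - of_nat m))"
    unfolding C using g0 by (simp del: of_nat_Suc)
  finally have "of_nat (Suc g choose m) * (fact c / fact (Suc g) * ((of_nat (Suc g) - of_nat m) * (\<Prod>r\<in>{c<..g}. of_nat r - of_nat m)))
      = (of_nat (g choose m) * (fact c / fact g * (\<Prod>r\<in>{c<..g}. of_nat r - of_nat m)) :: 'a)" .
  then show ?case unfolding P using step by simp
qed

section \<open>p-integral rational numbers and factorials\<close>

text \<open>This is the local ring of the rationals at p. The trace identity lives there because its
  weights have factorial denominators; asking for some denominator prime to p, not the reduced one,
  makes closure under the ring operations immediate.\<close>

definition p_integral :: "nat \<Rightarrow> rat \<Rightarrow> bool" where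
  "p_integral p r \<longleftrightarrow> (\<exists>a b. \<not> int p dvd b \<and> r * of_int b = of_int a)"

lemma p_integral_of_int [intro]: "prime p \<Longrightarrow> p_integral p (of_int a)"
  unfolding p_integral_def by (rule exI[of _ a], rule exI[of _ 1]) (auto dest: prime_gt_1_nat)

lemma p_integral_of_nat [intro]: "prime p \<Longrightarrow> p_integral p (of_nat a)"
  using p_integral_of_int[of p "int a"] by simp

lemma p_integral_add [intro]:
  assumes "prime p" "p_integral p x" "p_integral p y"
  shows "p_integral p (x + y)"
proof -
  obtain a b a' b' where *: "\<not> int p dvd b" "x * of_int b = of_int a" "\<not> int p dvd b'" "y * of_int b' = of_int a'"
    using assms(2,3) unfolding p_integral_def by blast
  have "\<not> int p dvd b * b'" using *(1,3) assms(1) by (simp add: prime_dvd_mult_iff)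
  moreover have "(x + y) * of_int (b * b') = of_int b' * (x * of_int b) + of_int b * (y * of_int b')"
    by (simp add: algebra_simps)
  then have "(x + y) * of_int (b * b') = of_int (b' * a + b * a')" unfolding *(2,4) by simp
  ultimately show ?thesis unfolding p_integral_def by blast
qed

lemma p_integral_mult [intro]:
  assumes "prime p" "p_integral p x" "p_integral p y"
  shows "p_integral p (x * y)"
proof -
  obtain a b a' b' where *: "\<not> int p dvd b" "x * of_int b = of_int a" "\<not> int p dvd b'" "y * of_int b' = of_int a'"
    using assms(2,3) unfolding p_integral_def by blast
  have "\<not> int p dvd b * b'" using *(1,3) assms(1) by (simp add: prime_dvd_mult_iff)
  moreover have "(x * y) * of_int (b * b') = (x * of_int b) * (y * of_int b')"
    by (simp add: algebra_simps)
  then have "(x * y) * of_int (b * b') = of_int (a * a')" unfolding *(2,4) by simp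
  ultimately show ?thesis unfolding p_integral_def by blast
qed

lemma p_integral_uminus [intro]: "prime p \<Longrightarrow> p_integral p x \<Longrightarrow> p_integral p (- x)"
  using p_integral_mult[OF _ p_integral_of_int[of p "- 1"]] by simp

lemma p_integral_diff [intro]: "prime p \<Longrightarrow> p_integral p x \<Longrightarrow> p_integral p y \<Longrightarrow> p_integral p (x - y)"
  using p_integral_add[of p x "- y"] p_integral_uminus[of p y] by simp

lemma p_integral_sum [intro]: "prime p \<Longrightarrow> (\<And>i. i \<in> A \<Longrightarrow> p_integral p (f i)) \<Longrightarrow> p_integral p (\<Sum>i\<in>A. f i)"
  by (induction A rule: infinite_finite_induct) (use p_integral_of_int[of p 0] in auto)

lemma p_integral_prod [intro]: "prime p \<Longrightarrow> (\<And>i. i \<in> A \<Longrightarrow> p_integral p (f i)) \<Longrightarrow> p_integral p (\<Prod>i\<in>A. f i)"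
  by (induction A rule: infinite_finite_induct) (use p_integral_of_int[of p 1] in auto)

lemma p_integral_divide:
  assumes "\<not> int p dvd b" "r * of_int b = of_int a"
  shows "p_integral p r"
  using assms unfolding p_integral_def by blast

lemma p_integral_imp_power_dvd:
  assumes "prime p" "p_integral p (of_int x / of_nat p ^ s)"
  shows "int p ^ s dvd x"
proof -
  obtain a b where *: "\<not> int p dvd b" "of_int x / of_nat p ^ s * of_int b = (of_int a :: rat)"
    using assms(2) unfolding p_integral_def by blast
  have "(of_int (x * b) :: rat) = of_int (a * int p ^ s)"
    using *(2) prime_gt_0_nat[OF assms(1)] by (simp add: field_simps)
  then have "x * b = a * int p ^ s" by (simp only: of_int_eq_iff)
  then have "int p ^ s dvd x * b" by simp
  moreover have "coprime (int p ^ s) b"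
    using *(1) assms(1) by (simp add: prime_imp_coprime)
  ultimately show ?thesis by (simp add: coprime_dvd_mult_left_iff)
qed

text \<open>The values of the p-adic gamma function at the natural numbers.\<close>

definition Gamma_nat :: "nat \<Rightarrow> nat \<Rightarrow> int" where
  "Gamma_nat p n = (- 1) ^ n * int (\<Prod>j | 0 < j \<and> j < n \<and> \<not> p dvd j. j)"

lemma Gamma_nat_0 [simp]: "Gamma_nat p 0 = 1"
  by (simp add: Gamma_nat_def)

lemma Gamma_nat_Suc: "Gamma_nat p (Suc n) = (if n = 0 \<or> p dvd n then - 1 else - int n) * Gamma_nat p n"
proof -
  have "{j. 0 < j \<and> j < Suc n \<and> \<not> p dvd j}
      = (if n = 0 \<or> p dvd n then {} else {n}) \<union> {j. 0 < j \<and> j < n \<and> \<not> p dvd j}"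
    by (auto simp: less_Suc_eq)
  then show ?thesis by (simp add: Gamma_nat_def)
qed

text \<open>The multiples of p up to n contribute p^(n div p) (n div p)!, and the other factors form
  the gamma value up to sign.\<close>

lemma fact_eq_Gamma_nat:
  assumes "p > 1"
  shows "fact n = (- 1) ^ Suc n * Gamma_nat p (Suc n) * int p ^ (n div p) * fact (n div p)"
proof (induction n)
  case 0
  then show ?case by (simp add: Gamma_nat_Suc)
next
  case (Suc n)
  show ?case
  proof (cases "p dvd Suc n")
    case True
    have d: "Suc n div p = Suc (n div p)" using True by (simp add: div_Suc dvd_eq_mod_eq_0)
    have "p * (Suc n div p) = Suc n" using True by simp
    then have "int (Suc n) = int p * int (Suc (n div p))" unfolding d by (metis of_nat_mult)
    then have "fact (Suc n) = int p * int (Suc (n div p)) * fact n" by (simp only: fact_Suc of_nat_id)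
    also have "\<dots> = (- 1) ^ Suc (Suc n) * (- 1 * Gamma_nat p (Suc n)) * int p ^ Suc (n div p) * fact (Suc (n div p))"
      unfolding Suc.IH by simp
    finally show ?thesis unfolding d Gamma_nat_Suc[of p "Suc n"] using True by simp
  next
    case False
    then have d: "Suc n div p = n div p" by (simp add: div_Suc dvd_eq_mod_eq_0)
    have "fact (Suc n) = int (Suc n) * fact n" by simp
    also have "\<dots> = (- 1) ^ Suc (Suc n) * (- int (Suc n) * Gamma_nat p (Suc n)) * int p ^ (n div p) * fact (n div p)"
      unfolding Suc.IH by (simp add: algebra_simps)
    finally show ?thesis unfolding d Gamma_nat_Suc[of p "Suc n"] using False by simp
  qed
qed

lemma Gamma_nat_not_dvd: "prime p \<Longrightarrow> \<not> int p dvd Gamma_nat p n"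
proof (induction n)
  case 0
  then show ?case by (auto dest: prime_gt_1_nat)
next
  case (Suc n)
  then show ?case unfolding Gamma_nat_Suc
    by (auto simp: prime_dvd_mult_iff)
qed

text \<open>A weak form of Legendre's formula. With q = n div p the valuation of n! is q plus that
  of q!, so at most 3q/2, and 3q <= n since p >= 3.\<close>

lemma fact_prime_part:
  assumes "prime p" "3 \<le> p"
  obtains v b where "fact n = int p ^ v * b" "\<not> int p dvd b" "2 * v \<le> n"
proof -
  have "\<exists>v b. fact n = int p ^ v * b \<and> \<not> int p dvd b \<and> 2 * v \<le> n"
  proof (induction n rule: less_induct)
    case (less n)
    show ?case
    proof (cases "n = 0")
      case True
      then show ?thesis using assms by (intro exI[of _ 0] exI[of _ 1]) (auto dest: prime_gt_1_nat)
    next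
      case False
      define q where "q = n div p"
      have "q < n" unfolding q_def using False assms(2) by (intro div_less_dividend) auto
      then obtain v b where vb: "fact q = int p ^ v * b" "\<not> int p dvd b" "2 * v \<le> q"
        using less.IH by blast
      have "3 * q \<le> p * q" using assms(2) by (intro mult_le_mono1)
      also have "p * q \<le> n" by (simp add: q_def)
      finally have "2 * (q + v) \<le> n" using vb(3) by simp
      moreover have "fact n = int p ^ (q + v) * ((- 1) ^ Suc n * Gamma_nat p (Suc n) * b)"
        using fact_eq_Gamma_nat[of p n] assms(2) unfolding q_def[symmetric] vb(1)
        by (simp add: power_add)
      moreover have "\<not> int p dvd (- 1) ^ Suc n * Gamma_nat p (Suc n) * b"
        using vb(2) Gamma_nat_not_dvd[OF assms(1), of "Suc n"] assms(1)
        by (auto simp: prime_dvd_mult_iff minus_one_power_iff dest: prime_gt_1_nat)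
      ultimately show ?thesis by blast
    qed
  qed
  then show ?thesis using that by blast
qed

lemma p_integral_power_div_fact:
  assumes "prime p" "3 \<le> p" "n \<le> 2 * i"
  shows "p_integral p (of_nat p ^ i / fact n)"
proof -
  obtain v b where vb: "fact n = int p ^ v * b" "\<not> int p dvd b" "2 * v \<le> n"
    using fact_prime_part[OF assms(1,2)] by blast
  have vi: "v \<le> i" using vb(3) assms(3) by linarith
  have "(fact n :: rat) = of_int (fact n)" by simp
  then have f: "(fact n :: rat) = of_nat p ^ v * of_int b" unfolding vb(1) by simp
  have b0: "b \<noteq> 0" using vb(2) by auto
  have "(of_nat p :: rat) ^ i = of_nat p ^ v * of_nat p ^ (i - v)" using vi by (simp flip: power_add)
  then have "of_nat p ^ i / fact n * of_int b = (of_int (int p ^ (i - v)) :: rat)"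
    unfolding f using b0 assms(2) by simp
  then show ?thesis using p_integral_divide[OF vb(2)] by blast
qed

text \<open>As 0 < x < p^s, the valuation of x is below s, so p^s - x has the same
  valuation.\<close>

lemma p_integral_reflected_odd:
  assumes "prime p" "0 < x" "x < p ^ s"
  shows "p_integral p (of_nat x / (of_nat (p ^ s) - of_nat x))"
proof -
  obtain b where b: "x = p ^ multiplicity p x * b" "\<not> p dvd b"
    using assms multiplicity_decompose'[of x p] prime_gt_1_nat[OF assms(1)] by auto
  define e where "e = multiplicity p x"
  have "b > 0" using b(2) by (auto intro: Nat.gr0I)
  have "p ^ e * 1 \<le> p ^ e * b" using \<open>b > 0\<close> by (intro mult_le_mono2) simp
  then have "p ^ e < p ^ s" using assms(3) b(1) unfolding e_def by linarith
  then have es: "e < s" using prime_gt_1_nat[OF assms(1)] by simp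
  define d where "d = int p ^ (s - e) - int b"
  have "int p dvd int p ^ (s - e)" using es by simp
  then have nd: "\<not> int p dvd d" using b(2) unfolding d_def by (simp add: dvd_diff_right_iff)
  have "int (p ^ s) - int x = int p ^ e * d"
  proof -
    have "int x = int p ^ e * int b" using b(1) unfolding e_def by (metis of_nat_mult of_nat_power)
    moreover have "int (p ^ s) = int p ^ e * int p ^ (s - e)" using es by (simp flip: power_add)
    ultimately show ?thesis unfolding d_def by (simp add: right_diff_distrib)
  qed
  then have "(of_int (int (p ^ s) - int x) :: rat) = of_nat p ^ e * of_int d"
    by simp
  then have den: "(of_nat (p ^ s) - of_nat x :: rat) = of_nat p ^ e * of_int d" by simp
  have num: "(of_nat x :: rat) = of_nat p ^ e * of_nat b"
    using b(1) unfolding e_def by (metis of_nat_mult of_nat_power)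
  have "d \<noteq> 0" using nd by auto
  then have "of_nat x / (of_nat (p ^ s) - of_nat x) * of_int d = (of_int (int b) :: rat)"
    unfolding den unfolding num using prime_gt_0_nat[OF assms(1)] by simp
  then show ?thesis using p_integral_divide[OF nd] by blast
qed

text \<open>
  Up to powers of two, the factors of \<open>g! / (g - i)!\<close> are \<open>p\<^sup>s - (2l + 1)\<close> for \<open>l < i\<close>, and they have
  the same \<open>p\<close>-adic valuations as the factors \<open>2l + 1\<close> of \<open>(2i)!\<close>.
\<close>

lemma p_integral_power_fact_quotient:
  assumes "prime p" "3 \<le> p" "2 * g + 1 = p ^ s" "i \<le> g"
  shows "p_integral p (of_nat p ^ i * fact (g - i) / fact g)"
proof -
  have gen: "R * (a * f / F) / D = R * (Z / (2 * D)) * (4 * a * (S * f) / (2 * S * (Z * F)))"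
    if "Z \<noteq> 0" "S \<noteq> 0" "D \<noteq> 0" "F \<noteq> 0" for R a f F Z S D :: rat
    using that by (simp add: field_simps)
  define r where "r = (\<lambda>l. of_nat (2 * l + 1) / (of_nat (p ^ s) - of_nat (2 * l + 1)) :: rat)"
  \<comment> \<open>The left side is 2^i divided by the product of p^s - (2l + 1) over l < i.
    Replacing these factors by 2l + 1, whose product is (2i)!/(2^i i!), produces the factor 4^i
    i!/(2i)!.\<close>
  have eq: "fact (g - i) / fact g = (\<Prod>l<i. r l) * (4 ^ i * fact i / fact (2 * i) :: rat)"
    using assms(4)
  proof (induction i)
    case 0
    then show ?case by simp
  next
    case (Suc i)
    define D where "D = (of_nat (g - i) :: rat)"
    have D0: "D \<noteq> 0" using Suc.prems by (simp add: D_def)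
    have "g - i = Suc (g - Suc i)" using Suc.prems by simp
    then have f1: "(fact (g - i) :: rat) = D * fact (g - Suc i)" unfolding D_def by (metis fact_Suc)
    have "of_nat (p ^ s) - of_nat (2 * i + 1) = (2 * D :: rat)"
      unfolding assms(3)[symmetric] D_def using Suc.prems by (simp add: of_nat_diff)
    then have ri: "r i = of_nat (2 * i + 1) / (2 * D)" by (simp add: r_def)
    have f2: "(fact (2 * Suc i) :: rat) = of_nat (2 * i + 2) * (of_nat (2 * i + 1) * fact (2 * i))"
      by (simp add: algebra_simps)
    have nz: "(of_nat (2 * i + 1) :: rat) \<noteq> 0" "(of_nat (Suc i) :: rat) \<noteq> 0"
      by (simp_all del: of_nat_Suc)
    have e2: "(of_nat (2 * i + 2) :: rat) = 2 * of_nat (Suc i)" by simp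
    have "fact (g - Suc i) / fact g = (fact (g - i) / fact g) / (D :: rat)"
      unfolding f1 using D0 by simp
    also have "\<dots> = ((\<Prod>l<i. r l) * (4 ^ i * fact i / fact (2 * i))) / D"
      using Suc by simp
    also have "\<dots> = (\<Prod>l<Suc i. r l) * (4 ^ Suc i * fact (Suc i) / fact (2 * Suc i))"
      unfolding f2 e2 prod.lessThan_Suc ri fact_Suc power_Suc of_nat_id
      by (rule gen) (use D0 nz in simp_all)
    finally show ?case .
  qed
  have "p_integral p (r l)" if "l < i" for l
    unfolding r_def using that assms by (intro p_integral_reflected_odd) auto
  then have "p_integral p (\<Prod>l<i. r l)" using assms(1) by auto
  moreover have "p_integral p (4 ^ i * fact i)"
    using p_integral_of_nat[OF assms(1), of "4 ^ i * fact i"] by simp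
  moreover have "p_integral p (of_nat p ^ i / fact (2 * i))"
    using assms by (intro p_integral_power_div_fact) auto
  ultimately have "p_integral p ((\<Prod>l<i. r l) * ((4 ^ i * fact i) * (of_nat p ^ i / fact (2 * i))))"
    using assms(1) by blast
  moreover have "of_nat p ^ i * fact (g - i) / fact g = (of_nat p ^ i) * (fact (g - i) / fact g :: rat)" by simp
  ultimately show ?thesis unfolding eq by (simp add: ac_simps)
qed

section \<open>The trace congruence\<close>

text \<open>This gives 2s <= g for g = (p^s - 1)/2, the room for taking p^s out of p^g. For p = 3 it
  fails at s = 1.\<close>

lemma four_mult_less_power: "5 \<le> p \<Longrightarrow> 4 * s + 1 \<le> (p::nat) ^ s"
proof (induction s)
  case (Suc s)
  then have "5 * (4 * s + 1) \<le> p * p ^ s" by (intro mult_le_mono) auto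
  then show ?case by simp
qed simp

text \<open>In \<open>telescoping_trace\<close> for the matrix \<open>t\<close>, the sum over column
  g becomes the second binomial coefficient once multiplied by g choose m; every other term on the
  right is p^s times a p-integral number.\<close>

lemma binomial_trace_cong:
  fixes p \<mu> k s g m :: nat
  assumes p: "prime p" "p = 2 * \<mu> + 1" and k: "k < \<mu>"
    and g: "2 * g + 1 = p ^ s" and m: "2 * \<mu> * m + k = k * p ^ s" and mu2: "2 \<le> \<mu>"
  defines "N \<equiv> \<mu> * p ^ s"
  shows "int p ^ s dvd (1 - int p) * int (g choose m) * (\<Sum>u\<le>g. int (N choose ((p - 1) * u + k)))
           - int ((N + g) choose (p * m + k))"
proof -
  have p0: "p > 0" "odd p" "3 \<le> p" using p(2) mu2 by auto
  have p1: "p - 1 = 2 * \<mu>" using p(2) by simp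
  have Ng: "N = 2 * \<mu> * g + \<mu>" unfolding N_def g[symmetric] by (simp add: algebra_simps)
  have pg: "p * g = 2 * \<mu> * g + g" using p(2) by simp
  have bound: "N + g < p * Suc g + k" unfolding Ng mult_Suc_right pg using p(2) by linarith
  have mg: "m \<le> g"
  proof -
    have "2 * \<mu> * m \<le> k * p ^ s - k" using m by linarith
    also have "\<dots> = k * (2 * g)" unfolding g[symmetric] by simp
    also have "\<dots> \<le> \<mu> * (2 * g)" using k by (intro mult_le_mono1) simp
    finally have "2 * \<mu> * m \<le> 2 * \<mu> * g" by simp
    then show ?thesis using mu2 by simp
  qed
  have gs: "2 * s \<le> g" using four_mult_less_power[of p s] g mu2 p(2) by simp
  define T where "T = (\<lambda>c n. psi_coeff p k c ([:1, -1:] ^ n))"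
  define t where "t = (\<lambda>c d. of_int (T c (N + d)) :: rat)"
  define w where "w = (\<lambda>c d. fact c / fact d * (\<Prod>r\<in>{c<..<d}. of_nat r - of_nat m) :: rat)"
  define E where "E = (\<lambda>c d. int \<mu> * (T c (N + d) - T c (N + d - 1)) - int k * T c (N + d))"
  define e where "e = (\<lambda>c d. of_nat p ^ s * of_int (E c d) :: rat)"
  define \<Lambda> where "\<Lambda> = (\<Sum>c\<le>g. fact c / fact g * (\<Prod>r\<in>{c<..g}. of_nat r - of_nat m) * t c g)"
  \<comment> \<open>As N = (p - 1) g + \<mu>, the bound of \<open>power_dvd_psi_coeff\<close> holds
    with a = g - c: (p - 1)(g - c) + p c = (p - 1) g + c < N + c.\<close>
  have Tdvd: "int p ^ (g - c) dvd T c n" if "c \<le> g" "N + c \<le> n" for c n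
  proof -
    have "(p - 1) * (g - c) + p * c = (p - 1) * ((g - c) + c) + c"
      using p(2) by (simp add: algebra_simps)
    also have "\<dots> = 2 * \<mu> * g + c" using that(1) p1 by simp
    also have "\<dots> < N + c" unfolding Ng using mu2 by simp
    also have "\<dots> \<le> n" by fact
    finally have "int p ^ (g - c) dvd psi_coeff p k c (1 * [:1, -1:] ^ n)"
      using p p0 k by (intro power_dvd_psi_coeff) auto
    then show ?thesis by (simp add: T_def)
  qed
  have Edvd: "int p ^ (g - c) dvd E c d" if "c < d" "d \<le> g" for c d
    unfolding E_def using that by (intro dvd_diff dvd_mult Tdvd) auto
  have rec: "(of_nat p * (of_nat c - of_nat m) - (of_nat d - of_nat m)) * t c d - of_nat p * of_nat (Suc c) * t (Suc c) d
      + of_nat d * t c (d - 1) = e c d" if "c < d" "d \<le> g" for c d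
  proof -
    have d: "N + (d - 1) = N + d - 1" using that by simp
    \<comment> \<open>The defining property of m: it is -k/(p - 1) modulo p^s, so replacing p m + k
      by m changes the recurrence only by a multiple of p^s.\<close>
    have mk: "int p * int m = int m - int k + int k * int p ^ s"
    proof -
      have "p * m + k = m + k * p ^ s" unfolding m[symmetric] using p(2) by simp
      then have "int (p * m + k) = int (m + k * p ^ s)" by (simp only:)
      then show ?thesis by simp
    qed
    have "(int p * (int c - int m) - (int d - int m)) * T c (N + d) - int p * int (Suc c) * T (Suc c) (N + d)
        + int d * T c (N + d - 1)
      = int p * (int c * T c (N + d) - int (Suc c) * T (Suc c) (N + d))
        - (int p * int m) * T c (N + d) - (int d - int m) * T c (N + d) + int d * T c (N + d - 1)"
      by (simp add: algebra_simps)
    also have "\<dots> = int N * (T c (N + d) - T c (N + d - 1)) - int k * int p ^ s * T c (N + d)"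
      unfolding T_def psi_coeff_recurrence[OF p0(1)] mk by (simp add: algebra_simps)
    also have "\<dots> = int p ^ s * E c d" unfolding N_def E_def by (simp add: algebra_simps)
    finally have "(of_int ((int p * (int c - int m) - (int d - int m)) * T c (N + d) - int p * int (Suc c) * T (Suc c) (N + d)
        + int d * T c (N + d - 1)) :: rat) = of_int (int p ^ s * E c d)" by (simp only:)
    then show ?thesis unfolding t_def e_def d by simp
  qed
  have tele: "(1 - of_nat p) * (\<Sum>c\<le>g. t c c) = \<Lambda> - of_nat p * t 0 0
     + of_nat p * of_nat m * (\<Sum>d\<in>{1..g}. w 0 d * t 0 d) + (\<Sum>d\<le>g. \<Sum>c<d. w c d * e c d)"
    unfolding \<Lambda>_def w_def by (rule telescoping_trace) (rule rec)
  define q where "q = (of_nat p ^ s :: rat)"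
  have q0: "q \<noteq> 0" using p0(1) by (simp add: q_def)
  have int_prod: "p_integral p (\<Prod>r\<in>A. of_nat r - of_nat m)" for A
    using p(1) by blast
  \<comment> \<open>Row 0 carries p^g. Of this, p^s is the modulus, and p^(g - s) absorbs d! because
    d <= g <= 2 (g - s).\<close>
  have first: "p_integral p (w 0 d * t 0 d / q)" if "d \<le> g" for d
  proof -
    obtain z where "T 0 (N + d) = int p ^ (g - 0) * z" using Tdvd[of 0 "N + d"] by auto
    then have tz: "t 0 d = of_nat p ^ g * of_int z" by (simp add: t_def)
    have "(of_nat p :: rat) ^ g = q * of_nat p ^ (g - s)"
      unfolding q_def using gs by (simp flip: power_add)
    then have "w 0 d * t 0 d / q = (of_nat p ^ (g - s) / fact d) * ((\<Prod>r\<in>{0<..<d}. of_nat r - of_nat m) * of_int z)"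
      unfolding w_def tz using q0 by simp
    moreover have "p_integral p (of_nat p ^ (g - s) / fact d)"
      using that gs p p0 by (intro p_integral_power_div_fact) auto
    ultimately show ?thesis using int_prod p(1) by (simp only:) blast
  qed
  have second: "p_integral p (w c d * e c d / q)" if "c < d" "d \<le> g" for c d
  proof -
    obtain z where z: "E c d = int p ^ (g - c) * z" using Edvd[OF \<open>c < d\<close> \<open>d \<le> g\<close>] by auto
    \<comment> \<open>Here c!/d! is c!/g! times the integer g!/d!, so it suffices that p^(g - c)
      c!/g! is p-integral; the modulus p^s is already a factor of \<open>e\<close>.\<close>
    obtain f where f: "(fact g :: nat) = fact d * f" using fact_dvd[OF \<open>d \<le> g\<close>, where 'a = nat] by auto
    have f': "(fact g :: rat) = fact d * of_nat f" using f by (metis of_nat_fact of_nat_mult)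
    have f0: "f \<noteq> 0" using f by (metis fact_nonzero mult_zero_right)
    have gc: "g - (g - c) = c" using that by simp
    have "w c d * e c d / q = (fact c / fact d * of_nat p ^ (g - c)) * ((\<Prod>r\<in>{c<..<d}. of_nat r - of_nat m) * of_int z)"
      unfolding w_def e_def z q_def using p0 by simp
    also have "fact c / fact d * of_nat p ^ (g - c) = (of_nat p ^ (g - c) * fact (g - (g - c)) / fact g) * (of_nat f :: rat)"
      unfolding gc f' using f0 by simp
    finally have eq: "w c d * e c d / q = (of_nat p ^ (g - c) * fact (g - (g - c)) / fact g) * of_nat f
        * ((\<Prod>r\<in>{c<..<d}. of_nat r - of_nat m) * of_int z)" .
    have "p_integral p (of_nat p ^ (g - c) * fact (g - (g - c)) / fact g)"
      using p p0 g by (intro p_integral_power_fact_quotient) auto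
    then show ?thesis unfolding eq using int_prod p(1) by blast
  qed
  have t00: "t 0 0 = w 0 0 * t 0 0" by (simp add: w_def)
  have "((1 - of_nat p) * (\<Sum>c\<le>g. t c c) - \<Lambda>) / q = - of_nat p * (w 0 0 * t 0 0 / q)
     + of_nat p * of_nat m * (\<Sum>d\<in>{1..g}. w 0 d * t 0 d / q) + (\<Sum>d\<le>g. \<Sum>c<d. w c d * e c d / q)"
    unfolding tele t00[symmetric] sum_divide_distrib[symmetric] using q0 by (simp add: field_simps)
  also have "p_integral p \<dots>"
    using p(1) by (intro p_integral_add p_integral_mult p_integral_sum p_integral_uminus p_integral_of_nat first second) auto
  finally have "p_integral p (((1 - of_nat p) * (\<Sum>c\<le>g. t c c) - \<Lambda>) / q)" .
  then have int1: "p_integral p (of_nat (g choose m) * (((1 - of_nat p) * (\<Sum>c\<le>g. t c c) - \<Lambda>) / q))"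
    using p(1) by blast
  have "of_nat (g choose m) * \<Lambda> = (\<Sum>c\<le>g. (of_nat (g choose m) * (fact c / fact g * (\<Prod>r\<in>{c<..g}. of_nat r - of_nat m))) * t c g)"
    unfolding \<Lambda>_def sum_distrib_left by (simp only: mult.assoc)
  also have "\<dots> = (\<Sum>c\<le>g. of_nat (c choose m) * t c g)"
    by (intro sum.cong refl) (subst fact_prod_eq_choose, auto)
  also have "\<dots> = of_int (\<Sum>c\<le>g. int (c choose m) * T c (N + g))" by (simp add: t_def)
  also have "(\<Sum>c\<le>g. int (c choose m) * T c (N + g)) = (- 1) ^ k * int ((N + g) choose (p * m + k))"
    unfolding T_def by (rule sum_weighted_psi_coeff) (use p0 bound mg in auto)
  finally have L: "of_nat (g choose m) * \<Lambda> = of_int ((- 1) ^ k * int ((N + g) choose (p * m + k)))" .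
  have "(\<Sum>c\<le>g. t c c) = of_int (\<Sum>c\<le>g. T c (N + c))" by (simp add: t_def)
  also have "(\<Sum>c\<le>g. T c (N + c)) = (- 1) ^ k * (\<Sum>u\<le>g. int (N choose ((p - 1) * u + k)))"
    unfolding T_def by (rule trace_psi_coeff) (use p0 bound in auto)
  finally have S: "(\<Sum>c\<le>g. t c c) = of_int ((- 1) ^ k * (\<Sum>u\<le>g. int (N choose ((p - 1) * u + k))))" .
  define X where "X = (1 - int p) * int (g choose m) * (\<Sum>u\<le>g. int (N choose ((p - 1) * u + k)))
           - int ((N + g) choose (p * m + k))"
  have "of_nat (g choose m) * (((1 - of_nat p) * (\<Sum>c\<le>g. t c c) - \<Lambda>) / q)
      = (of_nat (g choose m) * (1 - of_nat p) * (\<Sum>c\<le>g. t c c) - of_nat (g choose m) * \<Lambda>) / q"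
    by (simp add: algebra_simps)
  also have "\<dots> = of_int ((- 1) ^ k * X) / q"
    unfolding L S X_def by (simp add: algebra_simps)
  finally have "p_integral p (of_int ((- 1) ^ k * X) / of_nat p ^ s)"
    using int1 unfolding q_def by (simp only:)
  then have "int p ^ s dvd (- 1) ^ k * X" by (rule p_integral_imp_power_dvd[OF p(1)])
  then show ?thesis unfolding X_def[symmetric] by (simp add: minus_one_power_iff split: if_splits)
qed

section \<open>Congruences and limits of p-adic integers\<close>

lemma padic_coord_of_int: "padic_coord (of_int a :: 'p::prime_card padic_int) n = a mod int CARD('p) ^ n"
proof -
  have nat: "padic_coord (of_nat m :: 'p padic_int) n = int m mod int CARD('p) ^ n" for m
    by (induction m) (simp_all add: padic_coord_add padic_coord_1 mod_simps)
  show ?thesis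
  proof (cases a rule: int_cases2)
    case (nonneg m)
    then show ?thesis using nat by simp
  next
    case (nonpos m)
    then show ?thesis using nat by (simp add: padic_coord_uminus mod_simps)
  qed
qed

lemma padic_coord_of_nat: "padic_coord (of_nat a :: 'p::prime_card padic_int) n = int a mod int CARD('p) ^ n"
  using padic_coord_of_int[of "int a" n] by simp

lemma padic_coord_surj:
  assumes "\<And>n. f n = f (Suc n) mod int CARD('p::prime_card) ^ n"
  shows "\<exists>z :: 'p::prime_card padic_int. \<forall>n. padic_coord z n = f n"
proof -
  have "f \<in> {f :: nat \<Rightarrow> int. \<forall>n. f n = f (Suc n) mod int CARD('p) ^ n}"
    by (intro CollectI allI assms)
  then have "Rep_padic_int (Abs_padic_int f :: 'p padic_int) = f" by (rule Abs_padic_int_inverse)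
  then have "padic_coord (Abs_padic_int f :: 'p padic_int) n = f n" for n
    by (simp only: padic_coord.rep_eq)
  then show ?thesis by blast
qed

text \<open>The quotient by p^n is obtained by shifting: its coordinate m is coordinate m + n of
  \<open>z\<close> divided by p^n.\<close>

lemma padic_power_dvd_iff: "of_nat CARD('p) ^ n dvd z \<longleftrightarrow> padic_coord (z :: 'p::prime_card padic_int) n = 0"
proof
  assume "of_nat CARD('p) ^ n dvd z"
  then obtain w where "z = of_nat (CARD('p) ^ n) * w" by auto
  then show "padic_coord z n = 0" by (simp only: padic_coord_mult padic_coord_of_nat) simp
next
  let ?p = "int CARD('p)"
  assume z: "padic_coord z n = 0"
  have compat: "padic_coord z (m + n) div ?p ^ n = padic_coord z (Suc m + n) div ?p ^ n mod ?p ^ m" for m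
  proof -
    have "padic_coord z (m + n) = padic_coord z (Suc m + n) mod ?p ^ (n + m)"
      using padic_coord_Suc[of z "m + n"] by (simp add: add.commute)
    also have "\<dots> div ?p ^ n = padic_coord z (Suc m + n) div ?p ^ n mod ?p ^ m"
      by (simp add: power_add mod_mult2_eq zmod_zmult2_eq)
    finally show ?thesis .
  qed
  have "\<exists>w :: 'p padic_int. \<forall>m. padic_coord w m = padic_coord z (m + n) div ?p ^ n"
    by (rule padic_coord_surj) (rule compat)
  then obtain w :: "'p padic_int" where w: "\<And>m. padic_coord w m = padic_coord z (m + n) div ?p ^ n"
    by metis
  have "z = of_nat (CARD('p) ^ n) * w"
  proof (rule padic_int_eqI)
    fix m
    have "padic_coord z (m + n) mod ?p ^ n = 0" using padic_coord_mod_le[of n "m + n" z] z by simp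
    then have "?p ^ n * (padic_coord z (m + n) div ?p ^ n) = padic_coord z (m + n)" by auto
    then show "padic_coord z m = padic_coord (of_nat (CARD('p) ^ n) * w) m"
      unfolding padic_coord_mult padic_coord_of_nat w mod_mult_left_eq
      using padic_coord_mod_le[of m "m + n" z] by simp
  qed
  then show "of_nat CARD('p) ^ n dvd z" by simp
qed

lemma padic_power_dvd_diff_iff:
  "of_nat CARD('p) ^ n dvd x - y \<longleftrightarrow> padic_coord x n = padic_coord (y :: 'p::prime_card padic_int) n"
  unfolding padic_power_dvd_iff by (rule padic_coord_diff_eq_0_iff)

lemma padic_eqI_dvd: "(\<And>n. of_nat CARD('p) ^ n dvd x - y) \<Longrightarrow> x = (y :: 'p::prime_card padic_int)"
  unfolding padic_power_dvd_diff_iff by (rule padic_int_eqI)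

lemma padic_eqI_dvd_Suc:
  assumes "\<And>n. of_nat CARD('p) ^ Suc n dvd x - y"
  shows "x = (y :: 'p::prime_card padic_int)"
proof (rule padic_eqI_dvd)
  fix n
  have "of_nat CARD('p) ^ n dvd (of_nat CARD('p) ^ Suc n :: 'p padic_int)" by (rule le_imp_power_dvd) simp
  then show "of_nat CARD('p) ^ n dvd x - y" using assms by (rule dvd_trans)
qed

lemma padic_power_dvd_of_int_iff: "of_nat CARD('p) ^ n dvd (of_int a :: 'p::prime_card padic_int) \<longleftrightarrow> int CARD('p) ^ n dvd a"
  unfolding padic_power_dvd_iff padic_coord_of_int by (simp add: dvd_eq_mod_eq_0)

text \<open>Completeness: the limit has the diagonal coordinates, number n being taken from
  \<open>X n\<close>.\<close>

lemma padic_limit: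
  fixes X :: "nat \<Rightarrow> 'p::prime_card padic_int"
  assumes "\<And>n. of_nat CARD('p) ^ n dvd X (Suc n) - X n"
  shows "\<exists>z. \<forall>n. of_nat CARD('p) ^ n dvd z - X n"
proof -
  have compat: "padic_coord (X n) n = padic_coord (X (Suc n)) (Suc n) mod int CARD('p) ^ n" for n
    using assms[of n] unfolding padic_power_dvd_diff_iff padic_coord_Suc by simp
  have "\<exists>z :: 'p padic_int. \<forall>n. padic_coord z n = padic_coord (X n) n"
    by (rule padic_coord_surj) (rule compat)
  then show ?thesis unfolding padic_power_dvd_diff_iff .
qed

instance padic_int :: (prime_card) ring_char_0
proof
  have "m = n" if "of_nat m = (of_nat n :: 'a padic_int)" for m n
  proof -
    have "int CARD('a) ^ k dvd int m - int n" for k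
      using padic_power_dvd_of_int_iff[of k "int m - int n", where 'p = 'a] that by simp
    moreover have "int CARD('a) ^ nat \<bar>int m - int n\<bar> > \<bar>int m - int n\<bar>"
    proof -
      have "nat \<bar>int m - int n\<bar> < CARD('a) ^ nat \<bar>int m - int n\<bar>"
        using nontriv[where 'a = 'a] by (intro power_gt_expt) simp
      then have "int (nat \<bar>int m - int n\<bar>) < int (CARD('a) ^ nat \<bar>int m - int n\<bar>)"
        by (simp only: of_nat_less_iff)
      then show ?thesis by simp
    qed
    ultimately have "int m - int n = 0"
      using dvd_imp_le_int[of "int m - int n" "int CARD('a) ^ nat \<bar>int m - int n\<bar>"] by fastforce
    then show "m = n" by simp
  qed
  then show "inj (of_nat :: nat \<Rightarrow> 'a padic_int)" by (simp add: inj_def)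
qed

section \<open>Reduction modulo p, units and Teichmueller representatives\<close>

lemma mod_ring_of_int_eq_iff: "of_int a = (of_int b :: 'p::prime_card mod_ring) \<longleftrightarrow> int CARD('p) dvd a - b"
  by (simp add: of_int_eq_iff_cong_CHAR cong_iff_dvd_diff)

lemma padic_residue_eq_iff: "padic_residue x = padic_residue y \<longleftrightarrow> of_nat CARD('p) dvd x - (y :: 'p::prime_card padic_int)"
proof -
  have "padic_residue x = padic_residue y \<longleftrightarrow> padic_coord x 1 mod int CARD('p) = padic_coord y 1 mod int CARD('p)"
    unfolding padic_residue_def mod_ring_of_int_eq_iff by (simp add: mod_eq_dvd_iff)
  also have "\<dots> \<longleftrightarrow> padic_coord x 1 = padic_coord y 1"
    using padic_coord_mod[of x 1] padic_coord_mod[of y 1] by simp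
  finally show ?thesis using padic_power_dvd_diff_iff[of 1 x y] by simp
qed

lemma mod_ring_of_int_mod: "of_int (a mod int CARD('p)) = (of_int a :: 'p::prime_card mod_ring)"
  unfolding mod_ring_of_int_eq_iff by (simp add: mod_eq_dvd_iff[symmetric])

lemma padic_residue_of_int [simp]: "padic_residue (of_int a :: 'p::prime_card padic_int) = of_int a"
  by (simp add: padic_residue_def padic_coord_of_int mod_ring_of_int_mod)

lemma padic_residue_0 [simp]: "padic_residue 0 = 0" and padic_residue_1 [simp]: "padic_residue 1 = 1"
  using padic_residue_of_int[of 0] padic_residue_of_int[of 1] by simp_all

lemma padic_residue_mult [simp]: "padic_residue (x * y) = padic_residue x * padic_residue (y :: 'p::prime_card padic_int)"
  by (simp add: padic_residue_def padic_coord_mult mod_ring_of_int_mod)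

lemma padic_residue_diff [simp]: "padic_residue (x - y) = padic_residue x - padic_residue (y :: 'p::prime_card padic_int)"
  by (simp add: padic_residue_def padic_coord_diff mod_ring_of_int_mod)

lemma padic_residue_power [simp]: "padic_residue (x ^ n) = padic_residue (x :: 'p::prime_card padic_int) ^ n"
  by (induction n) simp_all

lemma padic_residue_surj: "\<exists>n. a = padic_residue (of_int n :: 'p::prime_card padic_int)"
  using surj_of_nat_mod_ring[of a] by (metis padic_residue_of_int of_int_of_nat_eq)

text \<open>If b inverts x modulo p, then u = 1 - x b is divisible by p, and b times the geometric
  series in u inverts x.\<close>

lemma padic_unit_iff: "x dvd 1 \<longleftrightarrow> padic_residue (x :: 'p::prime_card padic_int) \<noteq> 0"
proof
  assume "x dvd 1"
  then obtain y where "1 = x * y" ..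
  then have "1 = padic_residue x * padic_residue y" by (metis padic_residue_1 padic_residue_mult)
  then show "padic_residue x \<noteq> 0" by auto
next
  assume x: "padic_residue x \<noteq> 0"
  obtain a where a: "inverse (padic_residue x) = padic_residue (of_int a :: 'p padic_int)"
    using padic_residue_surj by blast
  define b :: "'p padic_int" where "b = of_int a"
  define u where "u = 1 - x * b"
  have "padic_residue (x * b) = padic_residue 1" using a x by (simp add: b_def field_simps)
  then have u: "of_nat CARD('p) dvd u"
    unfolding u_def padic_residue_eq_iff by (subst (asm) dvd_minus_iff[symmetric]) simp
  define X where "X = (\<lambda>n. b * (\<Sum>i<n. u ^ i))"
  have un: "of_nat CARD('p) ^ n dvd u ^ n" for n using u by (rule dvd_power_same)
  have "of_nat CARD('p) ^ n dvd X (Suc n) - X n" for n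
    using un[of n] by (simp add: X_def distrib_left)
  then obtain y where y: "\<And>n. of_nat CARD('p) ^ n dvd y - X n" using padic_limit[of X] by metis
  have "x * y = 1"
  proof (rule padic_eqI_dvd)
    fix n
    have "(1 - u) * (\<Sum>i<n. u ^ i) = 1 - u ^ n" by (rule one_diff_power_eq[symmetric])
    then have "x * X n = 1 - u ^ n" by (simp add: X_def u_def mult.assoc)
    then have "x * y - 1 = x * (y - X n) - u ^ n" by (simp add: algebra_simps)
    then show "of_nat CARD('p) ^ n dvd x * y - 1" using y[of n] un[of n] by (simp add: dvd_diff)
  qed
  then show "x dvd 1" by (metis dvd_triv_left)
qed

lemma diff_dvd_power_diff: "x - y dvd x ^ i - (y :: 'a::comm_ring_1) ^ i"
  by (subst power_diff_sumr2) (rule dvd_triv_left)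

text \<open>In x^p - y^p = (x - y) S, each of the p terms of S is congruent to y^(p-1) modulo p, so
  p divides S.\<close>

lemma power_cong_raise:
  fixes x y q :: "'a::comm_ring_1"
  assumes "q dvd x - y" "of_nat p dvd x - y"
  shows "q * of_nat p dvd x ^ p - y ^ p"
proof -
  have "of_nat p dvd (\<Sum>i<p. x ^ i * y ^ (p - Suc i))"
  proof -
    have "of_nat p dvd x ^ i * y ^ (p - Suc i) - y ^ (p - 1)" if "i < p" for i
    proof -
      have "x ^ i * y ^ (p - Suc i) - y ^ (p - 1) = (x ^ i - y ^ i) * y ^ (p - Suc i)"
        using that by (simp add: left_diff_distrib flip: power_add)
      moreover have "x - y dvd x ^ i - y ^ i" by (rule diff_dvd_power_diff)
      ultimately show ?thesis using dvd_mult2[OF dvd_trans[OF assms(2)]] by simp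
    qed
    then have "of_nat p dvd (\<Sum>i<p. x ^ i * y ^ (p - Suc i) - y ^ (p - 1))" by (intro dvd_sum) auto
    then have "of_nat p dvd (\<Sum>i<p. x ^ i * y ^ (p - Suc i)) - of_nat p * y ^ (p - 1)"
      by (simp add: sum_subtractf)
    from dvd_add[OF this dvd_triv_left[of "of_nat p" "y ^ (p - 1)"]] show ?thesis by simp
  qed
  moreover have "x ^ p - y ^ p = (x - y) * (\<Sum>i<p. x ^ i * y ^ (p - Suc i))"
    by (subst power_diff_sumr2) (simp add: mult.commute)
  ultimately show ?thesis using assms(1) by (simp add: mult_dvd_mono)
qed

lemma power_power_cong:
  fixes x y :: "'a::comm_ring_1"
  assumes "of_nat p dvd x - y"
  shows "of_nat p ^ Suc s dvd x ^ (p ^ s) - y ^ (p ^ s)"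
proof (induction s)
  case (Suc s)
  have "of_nat p dvd x ^ (p ^ s) - y ^ (p ^ s)" using Suc by (rule dvd_trans[rotated]) simp
  from power_cong_raise[OF Suc this] show ?case by (simp add: mult.commute flip: power_mult)
qed (use assms in simp)

lemma mod_ring_power_card: "a ^ CARD('p) = (a :: 'p::prime_card mod_ring)"
  using finite_field_power_card_eq_same[of a] by simp

text \<open>The representative is the limit of x^(p^n) for any lift x of a; consecutive terms agree
  modulo p^(n+1) by \<open>power_power_cong\<close>.\<close>

lemma teichmueller_exists:
  assumes "a \<noteq> (0 :: 'p::prime_card mod_ring)"
  shows "\<exists>z. z ^ (CARD('p) - 1) = 1 \<and> padic_residue z = a"
proof -
  obtain n where n: "a = padic_residue (of_int n :: 'p padic_int)" using padic_residue_surj by blast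
  define x :: "'p padic_int" where "x = of_int n"
  define X where "X = (\<lambda>n. x ^ (CARD('p) ^ n))"
  have "padic_residue (x ^ CARD('p)) = padic_residue x" by (simp add: mod_ring_power_card)
  then have "of_nat CARD('p) dvd x ^ CARD('p) - x" unfolding padic_residue_eq_iff .
  from power_power_cong[OF this] have X: "of_nat CARD('p) ^ Suc n dvd X (Suc n) - X n" for n
    by (simp add: X_def flip: power_mult)
  have "of_nat CARD('p) ^ n dvd X (Suc n) - X n" for n by (rule dvd_trans[OF _ X]) simp
  then obtain z where z: "\<And>n. of_nat CARD('p) ^ n dvd z - X n" using padic_limit[of X] by metis
  have "z ^ CARD('p) = z"
  proof (rule padic_eqI_dvd_Suc)
    fix n
    let ?q = "of_nat CARD('p) ^ Suc n :: 'p padic_int"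
    have 1: "?q dvd z ^ CARD('p) - X (Suc n) ^ CARD('p)"
      by (rule dvd_trans[OF z diff_dvd_power_diff])
    have 2: "X (Suc n) ^ CARD('p) = X (Suc (Suc n))" by (simp add: X_def mult.commute flip: power_mult)
    have 3: "?q dvd X (Suc (Suc n)) - X (Suc n)" using X[of "Suc n"] by (rule dvd_trans[rotated]) simp
    have "z ^ CARD('p) - z = (z ^ CARD('p) - X (Suc n) ^ CARD('p)) + (X (Suc (Suc n)) - X (Suc n)) - (z - X (Suc n))"
      by (simp add: 2)
    then show "?q dvd z ^ CARD('p) - z" using dvd_diff[OF dvd_add[OF 1 3] z[of "Suc n"]] by simp
  qed
  moreover have res: "padic_residue z = a"
  proof -
    have "padic_residue z = padic_residue (X 1)" using z[of 1] by (simp add: padic_residue_eq_iff)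
    also have "\<dots> = a" by (simp add: X_def mod_ring_power_card n x_def)
    finally show ?thesis .
  qed
  moreover have "z \<noteq> 0" using res assms by auto
  moreover have "z ^ CARD('p) = z * z ^ (CARD('p) - 1)" using nontriv[where 'a = 'p] by (simp flip: power_Suc)
  ultimately have "z ^ (CARD('p) - 1) = 1" by simp
  then show ?thesis using res by blast
qed

text \<open>Roots of unity of order dividing p - 1 are fixed by raising to the power p^n, which
  turns a congruence modulo p into one modulo p^(n+1). Identities between Teichmueller values are
  thereby checked modulo p.\<close>

lemma teichmueller_unique:
  fixes y z :: "'p::prime_card padic_int"
  assumes "y ^ (CARD('p) - 1) = 1" "z ^ (CARD('p) - 1) = 1" "padic_residue y = padic_residue z"
  shows "y = z"
proof (rule padic_eqI_dvd_Suc)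
  fix n
  have fixed: "w ^ (CARD('p) ^ n) = w" if "w ^ (CARD('p) - 1) = 1" for w :: "'p padic_int"
  proof -
    have "w ^ CARD('p) = w * w ^ (CARD('p) - 1)" using nontriv[where 'a = 'p] by (simp flip: power_Suc)
    then have "w ^ CARD('p) = w" using that by simp
    then show ?thesis by (induction n) (simp_all add: power_mult)
  qed
  have "of_nat CARD('p) ^ Suc n dvd y ^ (CARD('p) ^ n) - z ^ (CARD('p) ^ n)"
    using assms(3) unfolding padic_residue_eq_iff by (rule power_power_cong)
  then show "of_nat CARD('p) ^ Suc n dvd y - z" by (simp only: fixed assms(1,2))
qed

lemma
  assumes "a \<noteq> (0 :: 'p::prime_card mod_ring)"
  shows teichmueller_power: "teichmueller a ^ (CARD('p) - 1) = 1"
    and padic_residue_teichmueller: "padic_residue (teichmueller a) = a"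
proof -
  have "\<exists>!z. z ^ (CARD('p) - 1) = 1 \<and> padic_residue z = a"
    using teichmueller_exists[OF assms] teichmueller_unique by blast
  from theI'[OF this] show "teichmueller a ^ (CARD('p) - 1) = 1" "padic_residue (teichmueller a) = a"
    unfolding teichmueller_def by blast+
qed

lemma teichmueller_mult:
  assumes "a \<noteq> 0" "b \<noteq> (0 :: 'p::prime_card mod_ring)"
  shows "teichmueller (a * b) = teichmueller a * teichmueller b"
  by (rule teichmueller_unique)
    (use assms in \<open>simp_all add: teichmueller_power padic_residue_teichmueller power_mult_distrib del: One_nat_def\<close>)

lemma teichmueller_1 [simp]: "teichmueller (1 :: 'p::prime_card mod_ring) = 1"
  by (rule teichmueller_unique) (simp_all add: teichmueller_power padic_residue_teichmueller del: One_nat_def)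

lemma teichmueller_neq_0: "a \<noteq> 0 \<Longrightarrow> teichmueller (a :: 'p::prime_card mod_ring) \<noteq> 0"
  using padic_residue_teichmueller[of a] by auto

section \<open>The p-adic gamma function\<close>

text \<open>The product expanded to first order in q. The multiplier 2 j avoids both the denominator
  in 0 + ... + (n - 1) = n (n - 1)/2 and the exponent n - 1.\<close>

lemma prod_arith_progression_cong:
  fixes j q M :: int
  assumes "M dvd q * q"
  shows "M dvd 2 * j * (\<Prod>b<n. j + int b * q) - (2 * j ^ Suc n + j ^ n * q * (int n * (int n - 1)))"
proof (induction n)
  case (Suc n)
  define A where "A = (\<Prod>b<n. j + int b * q)"
  define B where "B = 2 * j ^ Suc n + j ^ n * q * (int n * (int n - 1))"
  have IH: "M dvd 2 * j * A - B" using Suc unfolding A_def B_def .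
  have "2 * j * (\<Prod>b<Suc n. j + int b * q) - (2 * j ^ Suc (Suc n) + j ^ Suc n * q * (int (Suc n) * (int (Suc n) - 1)))
     = (2 * j * A - B) * (j + int n * q) + (q * q) * (j ^ n * int n * (int n - 1) * int n)"
    unfolding prod.lessThan_Suc A_def[symmetric] B_def by (simp add: algebra_simps)
  then show ?case using IH assms by (metis dvd_add dvd_mult2)
qed simp

text \<open>Induction on the exponent. With q the previous power, the units modulo p q are j + b q
  with b < p. For fixed j their product is j^p modulo p q, so the total is a p-th power of a number
  congruent to -1 modulo q, and taking p-th powers gains one factor p.\<close>

lemma Wilson_prime_power:
  assumes "prime p" "odd p"
  shows "int p ^ Suc s dvd (\<Prod>j | 0 < j \<and> j < p ^ Suc s \<and> \<not> p dvd j. int j) + 1"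
proof (induction s)
  case 0
  have "{j. 0 < j \<and> j < p \<and> \<not> p dvd j} = {1..p - 1}"
    using prime_gt_0_nat[OF assms(1)] by (auto dest: dvd_imp_le)
  then have "(\<Prod>j | 0 < j \<and> j < p \<and> \<not> p dvd j. int j) = fact (p - 1)"
    by (simp add: fact_prod)
  moreover have "[fact (p - 1) = (- 1 :: int)] (mod int p)"
    by (rule wilson_theorem) (rule assms(1))
  ultimately show ?case by (simp add: cong_iff_dvd_diff)
next
  case (Suc s)
  define q where "q = p ^ Suc s"
  define U where "U = {j. 0 < j \<and> j < q \<and> \<not> p dvd j}"
  define M where "M = int p ^ Suc (Suc s)"
  have p0: "p > 0" using prime_gt_0_nat[OF assms(1)] .
  have q0: "q > 0" "p dvd q" using p0 by (simp_all add: q_def)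
  have Mq: "M = int p * int q" by (simp add: M_def q_def)
  have inner: "[(\<Prod>b<p. int (j + b * q)) = int j ^ p] (mod M)" if "j \<in> U" for j
  proof -
    have "M dvd int q * int q" unfolding Mq using q0(2) by (intro mult_dvd_mono) simp_all
    from prod_arith_progression_cong[OF this, of "int j" p]
    have 1: "M dvd 2 * int j * (\<Prod>b<p. int j + int b * int q) - (2 * int j ^ Suc p + int j ^ p * int q * (int p * (int p - 1)))" .
    have 2: "M dvd int j ^ p * int q * (int p * (int p - 1))" unfolding Mq by (simp add: ac_simps)
    have "M dvd 2 * int j * (\<Prod>b<p. int j + int b * int q) - 2 * int j ^ Suc p"
      using dvd_add[OF 1 2] by simp
    then have "M dvd (2 * int j) * ((\<Prod>b<p. int j + int b * int q) - int j ^ p)" by (simp add: algebra_simps)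
    moreover have "coprime M (2 * int j)"
    proof -
      have "\<not> p dvd 2 * j" using that assms primes_dvd_imp_eq[of p 2] by (auto simp: U_def prime_dvd_mult_iff)
      with assms(1) have "coprime p (2 * j)" by (rule prime_imp_coprime)
      then have "coprime (int p) (2 * int j)" by (metis coprime_int_iff of_nat_mult of_nat_numeral)
      then show ?thesis unfolding M_def by simp
    qed
    ultimately have "M dvd (\<Prod>b<p. int j + int b * int q) - int j ^ p"
      by (simp add: coprime_dvd_mult_right_iff)
    then show ?thesis by (simp add: cong_iff_dvd_diff)
  qed
  have "(\<Prod>j | 0 < j \<and> j < p ^ Suc (Suc s) \<and> \<not> p dvd j. int j) = (\<Prod>(j, b)\<in>U \<times> {..<p}. int (j + b * q))"
  proof (rule prod.reindex_bij_witness[where i = "\<lambda>(j, b). j + b * q" and j = "\<lambda>x. (x mod q, x div q)"])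
    fix x assume "x \<in> {j. 0 < j \<and> j < p ^ Suc (Suc s) \<and> \<not> p dvd j}"
    then have x: "x < p * q" "\<not> p dvd x" by (simp_all add: q_def)
    have "\<not> p dvd x mod q" using x(2) q0(2) by (simp add: dvd_mod_iff)
    moreover from this have "0 < x mod q" by (auto intro: Nat.gr0I)
    moreover have "x div q < p" using x(1) by (simp add: less_mult_imp_div_less)
    ultimately show "(x mod q, x div q) \<in> U \<times> {..<p}" using q0 by (simp add: U_def)
    show "(case (x mod q, x div q) of (j, b) \<Rightarrow> j + b * q) = x" by simp
    show "(case (x mod q, x div q) of (j, b) \<Rightarrow> int (j + b * q)) = int x"
      by (simp only: prod.case mod_div_mult_eq)
  next
    fix z assume "z \<in> U \<times> {..<p}"
    then obtain j b where z: "z = (j, b)" "0 < j" "j < q" "\<not> p dvd j" "b < p" by (auto simp: U_def)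
    have "j + b * q < p * q"
    proof -
      have "Suc b * q \<le> p * q" using z(5) by (intro mult_le_mono1) simp
      then show ?thesis using z(3) by simp
    qed
    moreover have "\<not> p dvd j + b * q" using z(4) q0(2) by (simp add: dvd_add_left_iff)
    ultimately show "(case z of (j, b) \<Rightarrow> j + b * q) \<in> {j. 0 < j \<and> j < p ^ Suc (Suc s) \<and> \<not> p dvd j}"
      using z by (simp add: q_def)
    show "((case z of (j, b) \<Rightarrow> j + b * q) mod q, (case z of (j, b) \<Rightarrow> j + b * q) div q) = z"
      using z by simp
  qed
  also have "\<dots> = (\<Prod>j\<in>U. \<Prod>b<p. int (j + b * q))" by (simp add: prod.cartesian_product)
  finally have eq: "(\<Prod>j | 0 < j \<and> j < p ^ Suc (Suc s) \<and> \<not> p dvd j. int j) = \<dots>" .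
  have "[(\<Prod>j\<in>U. \<Prod>b<p. int (j + b * q)) = (\<Prod>j\<in>U. int j ^ p)] (mod M)"
    by (rule cong_prod) (rule inner)
  also have "(\<Prod>j\<in>U. int j ^ p) = (\<Prod>j\<in>U. int j) ^ p" by (simp add: prod_power_distrib)
  also have "[(\<Prod>j\<in>U. int j) ^ p = (- 1) ^ p] (mod M)"
  proof -
    have 1: "int q dvd (\<Prod>j\<in>U. int j) - (- 1)" using Suc by (simp add: U_def q_def)
    then have 2: "int p dvd (\<Prod>j\<in>U. int j) - (- 1)" using q0(2) by (metis dvd_trans int_dvd_int_iff)
    show ?thesis using power_cong_raise[OF 1 2] unfolding Mq by (simp add: cong_iff_dvd_diff mult.commute)
  qed
  finally show ?case using assms(2) unfolding eq M_def by (simp add: cong_iff_dvd_diff)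
qed

text \<open>Over one period p^s the recursion multiplies by (-1)^(p^s) times the product of the
  units modulo p^s, which is 1 by \<open>Wilson_prime_power\<close>.\<close>

lemma Gamma_nat_cong:
  assumes "prime p" "odd p" "int p ^ s dvd int a - int b"
  shows "int p ^ s dvd Gamma_nat p a - Gamma_nat p b"
proof (cases s)
  case (Suc r)
  define q where "q = p ^ s"
  have per: "[Gamma_nat p (n + q) = Gamma_nat p n] (mod int q)" for n
  proof (induction n)
    case 0
    have "(\<Prod>j | 0 < j \<and> j < p ^ s \<and> \<not> p dvd j. int j) = int (\<Prod>j | 0 < j \<and> j < p ^ s \<and> \<not> p dvd j. j)"
      by simp
    then show ?case using Wilson_prime_power[OF assms(1,2), of r] assms(2)
      by (simp add: Gamma_nat_def q_def Suc cong_iff_dvd_diff flip: dvd_minus_iff[of _ "_ + 1"])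
  next
    case (Suc n)
    have "p dvd q" using \<open>s = Suc r\<close> by (simp add: q_def)
    then have pd: "p dvd n + q \<longleftrightarrow> p dvd n" by (simp add: dvd_add_left_iff)
    have "q \<noteq> 0" using prime_gt_0_nat[OF assms(1)] by (simp add: q_def)
    have "[(if n + q = 0 \<or> p dvd n + q then - 1 else - int (n + q)) = (if n = 0 \<or> p dvd n then - 1 else - int n)] (mod int q)"
      unfolding pd using \<open>q \<noteq> 0\<close> by (auto simp: cong_iff_dvd_diff)
    from cong_mult[OF this Suc] show ?case by (simp add: Gamma_nat_Suc)
  qed
  have pers: "[Gamma_nat p (n + k * q) = Gamma_nat p n] (mod int q)" for n k
  proof (induction k)
    case (Suc k)
    show ?case using cong_trans[OF per[of "n + k * q"] Suc] by (simp add: ac_simps)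
  qed simp
  have wlog: "[Gamma_nat p a = Gamma_nat p b] (mod int q)" if "b \<le> a" "int q dvd int a - int b" for a b
  proof -
    have "q dvd a - b" using that by (metis of_nat_diff int_dvd_int_iff)
    then obtain k where "a - b = k * q" by (metis dvdE mult.commute)
    then have "a = b + k * q" using that by simp
    then show ?thesis using pers by simp
  qed
  have "[Gamma_nat p a = Gamma_nat p b] (mod int q)"
  proof (cases "b \<le> a")
    case True
    then show ?thesis using wlog assms(3) by (simp add: q_def)
  next
    case False
    then show ?thesis using wlog[of a b] assms(3) by (simp add: q_def cong_sym dvd_diff_commute)
  qed
  then show ?thesis by (simp add: cong_iff_dvd_diff q_def)
qed simp

section \<open>From congruences to the continuous gamma function\<close>

lemma dist_padic_le_iff:
  "dist x y \<le> inverse (real CARD('p) ^ n) \<longleftrightarrow> of_nat CARD('p) ^ n dvd x - (y :: 'p::prime_card padic_int)"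
  by (simp add: dist_padic_int_def padic_int_abs_le_iff padic_power_dvd_iff)

lemma inverse_card_power_less:
  assumes "e > 0"
  obtains n where "inverse (real CARD('p::prime_card) ^ n) < e"
proof -
  have "1 < real CARD('p)" using nontriv[where 'a = 'p] by simp
  then have "inverse (real CARD('p)) < 1" by (simp add: inverse_less_1_iff)
  then obtain n where "inverse (real CARD('p)) ^ n < e" using assms real_arch_pow_inv by blast
  then show ?thesis using that by (simp add: power_inverse)
qed

lemma padic_tendsto:
  fixes z :: "'p::prime_card padic_int"
  assumes "\<And>n. of_nat CARD('p) ^ n dvd X n - z"
  shows "X \<longlonglongrightarrow> z"
proof (rule metric_LIMSEQ_I)
  fix r :: real assume "0 < r"
  then obtain N where N: "inverse (real CARD('p) ^ N) < r" by (rule inverse_card_power_less[where 'p = 'p])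
  have "dist (X n) z < r" if "N \<le> n" for n
  proof -
    have "of_nat CARD('p) ^ N dvd X n - z"
      using that assms dvd_trans[OF le_imp_power_dvd] by blast
    then show ?thesis using N unfolding dist_padic_le_iff[symmetric] by linarith
  qed
  then show "\<exists>no. \<forall>n\<ge>no. dist (X n) z < r" by blast
qed

text \<open>The function is built as the limit of \<open>Gamma_nat\<close> along natural numbers
  approximating \<open>z\<close>. Density of the natural numbers makes it the only continuous
  solution, which resolves the definite description.\<close>

lemma
  assumes "odd CARD('p::prime_card)"
  shows padic_Gamma_unit: "(padic_Gamma :: 'p padic_int \<Rightarrow> _) z dvd 1"
    and padic_Gamma_of_nat: "padic_Gamma (of_nat n :: 'p padic_int) = of_int (Gamma_nat CARD('p) n)"
    and padic_Gamma_cong: "of_nat CARD('p) ^ s dvd x - y \<Longrightarrow> of_nat CARD('p) ^ s dvd padic_Gamma x - padic_Gamma (y :: 'p padic_int)"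
proof -
  let ?P = "of_nat CARD('p) :: 'p padic_int"
  let ?G = "\<lambda>n. of_int (Gamma_nat CARD('p) n) :: 'p padic_int"
  have prime: "prime CARD('p)" by (rule prime_card)
  have cong: "?P ^ s dvd ?G a - ?G b" if "?P ^ s dvd of_nat a - of_nat b" for s a b
  proof -
    have "int CARD('p) ^ s dvd int a - int b"
      using that padic_power_dvd_of_int_iff[of s "int a - int b", where 'p = 'p] by simp
    from Gamma_nat_cong[OF prime assms this] show ?thesis
      using padic_power_dvd_of_int_iff[of s "Gamma_nat CARD('p) a - Gamma_nat CARD('p) b", where 'p = 'p] by simp
  qed
  define c where "c = (\<lambda>(z :: 'p padic_int) n. nat (padic_coord z n))"
  have coord_nonneg: "0 \<le> padic_coord z n" for z :: "'p padic_int" and n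
    by (subst padic_coord_mod[symmetric]) (simp add: pos_mod_sign)
  have c: "?P ^ n dvd of_nat (c z n) - z" for z n
    unfolding padic_power_dvd_diff_iff padic_coord_of_nat c_def using coord_nonneg[of z n]
    by (simp add: padic_coord_mod)
  have step: "?P ^ n dvd ?G (c z (Suc n)) - ?G (c z n)" for z n
  proof (rule cong)
    have "?P ^ n dvd of_nat (c z (Suc n)) - z" by (rule dvd_trans[OF _ c]) simp
    from dvd_diff[OF this c[of n z]] show "?P ^ n dvd of_nat (c z (Suc n)) - of_nat (c z n)" by simp
  qed
  have "\<exists>w. \<forall>n. ?P ^ n dvd w - ?G (c z n)" for z
    by (rule padic_limit) (rule step)
  then obtain g where g: "\<And>z n. ?P ^ n dvd g z - ?G (c z n)" by metis
  have g_cong: "?P ^ s dvd g x - g y" if "?P ^ s dvd x - y" for s x y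
  proof -
    have "?P ^ s dvd (of_nat (c x s) - x) + (x - y) - (of_nat (c y s) - y)"
      by (rule dvd_diff[OF dvd_add[OF c that] c])
    then have "?P ^ s dvd ?G (c x s) - ?G (c y s)" by (intro cong) simp
    from dvd_diff[OF dvd_add[OF g[of s x] this] g[of s y]] show ?thesis by simp
  qed
  have g_nat: "g (of_nat n) = ?G n" for n
  proof (rule padic_eqI_dvd)
    fix s
    have "?P ^ s dvd ?G (c (of_nat n) s) - ?G n" by (rule cong[OF c])
    from dvd_add[OF g[of s "of_nat n"] this] show "?P ^ s dvd g (of_nat n) - ?G n" by simp
  qed
  have g_unit: "g z dvd 1" for z
  proof -
    have "padic_residue (g z) = padic_residue (?G (c z 1))"
      unfolding padic_residue_eq_iff using g[of 1 z] by (simp only: power_one_right)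
    also have "\<dots> \<noteq> 0"
      using Gamma_nat_not_dvd[OF prime] mod_ring_of_int_eq_iff[of _ 0, where 'p = 'p] by simp
    finally show ?thesis by (simp add: padic_unit_iff)
  qed
  have g_cont: "continuous_on UNIV g"
    unfolding continuous_on_iff
  proof (intro ballI allI impI)
    fix x :: "'p padic_int" and e :: real assume "0 < e"
    then obtain n where n: "inverse (real CARD('p) ^ n) < e" by (rule inverse_card_power_less[where 'p = 'p])
    have "dist (g y) (g x) < e" if "dist y x < inverse (real CARD('p) ^ n)" for y
    proof -
      have "dist y x \<le> inverse (real CARD('p) ^ n)" using that by simp
      then have "dist (g y) (g x) \<le> inverse (real CARD('p) ^ n)"
        unfolding dist_padic_le_iff by (rule g_cong)
      then show ?thesis using n by simp
    qed
    moreover have "0 < inverse (real CARD('p) ^ n)" by simp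
    ultimately show "\<exists>d>0. \<forall>y\<in>UNIV. dist y x < d \<longrightarrow> dist (g y) (g x) < e" by blast
  qed
  have Geq: "?G n = (-1) ^ n * of_nat (\<Prod>j | 0 < j \<and> j < n \<and> \<not> CARD('p) dvd j. j)" for n
    unfolding Gamma_nat_def by simp
  have "padic_Gamma = g"
    unfolding padic_Gamma_def
  proof (rule the_equality)
    show "continuous_on UNIV g \<and> (\<forall>z. g z dvd 1) \<and> g 0 = 1 \<and>
     (\<forall>n::nat. n > 0 \<longrightarrow> g (of_nat n) = (-1) ^ n * of_nat (\<Prod>j | 0 < j \<and> j < n \<and> \<not> CARD('p) dvd j. j))"
      using g_cont g_unit g_nat[of 0] g_nat Geq by simp
  next
    fix f :: "'p padic_int \<Rightarrow> 'p padic_int"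
    assume f: "continuous_on UNIV f \<and> (\<forall>z. f z dvd 1) \<and> f 0 = 1 \<and>
     (\<forall>n::nat. n > 0 \<longrightarrow> f (of_nat n) = (-1) ^ n * of_nat (\<Prod>j | 0 < j \<and> j < n \<and> \<not> CARD('p) dvd j. j))"
    have fn: "f (of_nat n) = g (of_nat n)" for n
    proof (cases "n = 0")
      case True
      then show ?thesis using f g_nat[of 0] by simp
    next
      case False
      then show ?thesis using f g_nat[of n] Geq[of n] by simp
    qed
    show "f = g"
    proof
      fix z
      have lim: "(\<lambda>n. of_nat (c z n)) \<longlonglongrightarrow> z" by (rule padic_tendsto) (rule c)
      have "(\<lambda>n. f (of_nat (c z n))) \<longlonglongrightarrow> f z"
        by (rule continuous_on_tendsto_compose[OF _ lim]) (use f in auto)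
      moreover have "(\<lambda>n. g (of_nat (c z n))) \<longlonglongrightarrow> g z"
        by (rule continuous_on_tendsto_compose[OF g_cont lim]) auto
      ultimately show "f z = g z" unfolding fn by (rule LIMSEQ_unique)
    qed
  qed
  then show "(padic_Gamma :: 'p padic_int \<Rightarrow> _) z dvd 1"
    "padic_Gamma (of_nat n :: 'p padic_int) = of_int (Gamma_nat CARD('p) n)"
    "?P ^ s dvd x - y \<Longrightarrow> ?P ^ s dvd padic_Gamma x - padic_Gamma y"
    using g_unit g_nat g_cong by auto
qed

text \<open>The finite form of the reflection formula; n - n div p counts the numbers from 1 to n
  prime to p. Passing to such an n + 1 exchanges a factor -r, with r = p^s - (n + 1), for -(n + 1),
  and -r is n + 1 modulo p^s, so the sign flips. At a multiple of p two factors -1 cancel.\<close>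

lemma Gamma_nat_reflection:
  assumes "prime p" "odd p" "n < p ^ s" "s > 0"
  shows "[Gamma_nat p (p ^ s - n) * Gamma_nat p (Suc n) = - ((- 1) ^ (n - n div p))] (mod int p ^ s)"
  using assms(3)
proof (induction n)
  case 0
  have "int p ^ s dvd Gamma_nat p (p ^ s) - Gamma_nat p 0" by (rule Gamma_nat_cong) (use assms in auto)
  then have "[Gamma_nat p (p ^ s) = 1] (mod int p ^ s)" by (simp add: cong_iff_dvd_diff)
  from cong_scalar_right[OF this, of "- 1"] show ?case by (simp add: Gamma_nat_Suc)
next
  case (Suc n)
  have IH: "[Gamma_nat p (p ^ s - n) * Gamma_nat p (Suc n) = - ((- 1) ^ (n - n div p))] (mod int p ^ s)"
    using Suc by simp
  define r where "r = p ^ s - Suc n"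
  have r: "p ^ s - n = Suc r" "r > 0" using Suc.prems by (simp_all add: r_def)
  have ri: "int r = int p ^ s - int (Suc n)" using Suc.prems unfolding r_def by (subst of_nat_diff) auto
  have pd: "p dvd r \<longleftrightarrow> p dvd Suc n"
  proof -
    have "p dvd p ^ s" using assms(4) by simp
    moreover have "r + Suc n = p ^ s" using Suc.prems by (simp add: r_def)
    ultimately show ?thesis by (metis dvd_add_right_iff dvd_add_left_iff)
  qed
  show ?case
  proof (cases "p dvd Suc n")
    case True
    then have d: "Suc n div p = Suc (n div p)" by (simp add: div_Suc dvd_eq_mod_eq_0)
    show ?thesis using IH True pd r
      by (simp add: Gamma_nat_Suc[of p r] Gamma_nat_Suc[of p "Suc n"] d flip: r_def)
  next
    case False
    then have d: "Suc n div p = n div p" by (simp add: div_Suc dvd_eq_mod_eq_0)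
    have le: "n div p \<le> n" by simp
    have "[- int r = int (Suc n)] (mod int p ^ s)"
      unfolding ri by (simp add: cong_iff_dvd_diff)
    from cong_scalar_right[OF this, of "Gamma_nat p r * Gamma_nat p (Suc n)"]
    have "[int (Suc n) * (Gamma_nat p r * Gamma_nat p (Suc n)) = Gamma_nat p (p ^ s - n) * Gamma_nat p (Suc n)] (mod int p ^ s)"
      using False pd r by (simp add: Gamma_nat_Suc[of p r] cong_sym mult.assoc)
    from cong_trans[OF this IH]
    have "[- (int (Suc n) * (Gamma_nat p r * Gamma_nat p (Suc n))) = - (- ((- 1) ^ (n - n div p)))] (mod int p ^ s)"
      by (simp only: cong_minus_minus_iff)
    moreover have "Gamma_nat p (p ^ s - Suc n) * Gamma_nat p (Suc (Suc n)) = - (int (Suc n) * (Gamma_nat p r * Gamma_nat p (Suc n)))"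
      using False by (simp add: Gamma_nat_Suc[of p "Suc n"] algebra_simps flip: r_def)
    ultimately show ?thesis unfolding d by (simp add: Suc_diff_le le)
  qed
qed

text \<open>As k <= \<mu> < p, no borrow occurs: the three arguments divided by p leave g, m and g -
  m. So in \<open>fact_eq_Gamma_nat\<close> the powers of p cancel and the smaller factorials
  combine to g choose m.\<close>

lemma Gamma_nat_binomial:
  assumes "prime p" "m \<le> g" "k \<le> \<mu>" "\<mu> < p"
  shows "Gamma_nat p (Suc (p * g + \<mu>)) * int (g choose m)
       = - int ((p * g + \<mu>) choose (p * m + k)) * (Gamma_nat p (Suc (p * m + k)) * Gamma_nat p (Suc (p * (g - m) + (\<mu> - k))))"
proof -
  define G M D where "G = p * g + \<mu>" and "M = p * m + k" and "D = p * (g - m) + (\<mu> - k)"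
  define Fa where "Fa = (\<lambda>n. fact n :: int)"
  have p1: "p > 1" using prime_gt_1_nat[OF assms(1)] .
  have div_eq: "(p * a + b) div p = a" if "b < p" for a b using that by simp
  have div: "G div p = g" "M div p = m" "D div p = g - m"
    unfolding G_def M_def D_def using assms by (intro div_eq; linarith)+
  have GMD: "G = M + D"
  proof -
    have "p * g = p * m + p * (g - m)" using assms(2) by (simp flip: distrib_left)
    then show ?thesis using assms(3) by (simp add: G_def M_def D_def)
  qed
  have "fact M * fact D * (G choose M) = (fact G :: nat)"
    using binomial_fact_lemma[of M G] GMD by simp
  then have "int (fact M * fact D * (G choose M)) = int (fact G)" by (simp only:)
  then have 1: "fact G = fact M * fact D * int (G choose M)" by simp
  have "fact m * fact (g - m) * (g choose m) = (fact g :: nat)" using assms(2) by (rule binomial_fact_lemma)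
  then have "int (fact m * fact (g - m) * (g choose m)) = int (fact g)" by (simp only:)
  then have 2: "fact g = fact m * fact (g - m) * int (g choose m)" by simp
  have pg: "int p ^ g = int p ^ m * int p ^ (g - m)" using assms(2) by (simp flip: power_add)
  define Z where "Z = int p ^ m * int p ^ (g - m) * (fact m * fact (g - m))"
  have Z: "Z \<noteq> 0" using p1 by (simp add: Z_def)
  have "fact G = (- 1) ^ Suc G * Gamma_nat p (Suc G) * int (g choose m) * Z"
    unfolding fact_eq_Gamma_nat[OF p1, of G] div 2 pg Z_def by (simp only: ac_simps)
  moreover have "fact M * fact D * int (G choose M)
     = (- 1) ^ Suc M * (- 1) ^ Suc D * (Gamma_nat p (Suc M) * Gamma_nat p (Suc D)) * int (G choose M) * Z"
    unfolding fact_eq_Gamma_nat[OF p1, of M] fact_eq_Gamma_nat[OF p1, of D] div Z_def by (simp only: ac_simps)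
  ultimately have "(- 1) ^ Suc G * Gamma_nat p (Suc G) * int (g choose m) * Z
     = (- 1) ^ Suc M * (- 1) ^ Suc D * (Gamma_nat p (Suc M) * Gamma_nat p (Suc D)) * int (G choose M) * Z"
    using 1 by (simp only:)
  then have "(- 1) ^ Suc G * Gamma_nat p (Suc G) * int (g choose m)
     = (- 1) ^ Suc M * (- 1) ^ Suc D * (Gamma_nat p (Suc M) * Gamma_nat p (Suc D)) * int (G choose M)"
    using Z by (simp only: mult_cancel_right) simp
  moreover have "(- 1) ^ Suc M * (- 1) ^ Suc D = - ((- 1 :: int) ^ Suc G)"
    unfolding GMD by (simp add: power_add)
  ultimately have "(- 1 :: int) ^ Suc G * (Gamma_nat p (Suc G) * int (g choose m))
     = (- 1) ^ Suc G * (- int (G choose M) * (Gamma_nat p (Suc M) * Gamma_nat p (Suc D)))"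
    by (simp only: mult.assoc) (simp only: ac_simps mult_minus_left mult_minus_right)
  moreover have "(- 1 :: int) ^ Suc G \<noteq> 0" by simp
  ultimately have "Gamma_nat p (Suc G) * int (g choose m) = - int (G choose M) * (Gamma_nat p (Suc M) * Gamma_nat p (Suc D))"
    by (simp only: mult_cancel_left) simp
  then show ?thesis unfolding G_def M_def D_def .
qed

text \<open>
  The base-\<open>p\<close> number with \<open>s\<close> digits \<open>1\<close>. The numbers \<open>a rep_unit p s\<close> converge to \<open>- a / (p - 1)\<close>.
\<close>

definition rep_unit :: "nat \<Rightarrow> nat \<Rightarrow> nat" where
  "rep_unit p s = (\<Sum>i<s. p ^ i)"

lemma rep_unit_Suc: "rep_unit p (Suc s) = p * rep_unit p s + 1"
  unfolding rep_unit_def by (subst sum.lessThan_Suc_shift) (simp add: sum_distrib_left)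

lemma rep_unit_eq: "p > 0 \<Longrightarrow> (p - 1) * rep_unit p s + 1 = p ^ s"
proof (induction s)
  case 0
  then show ?case by (simp add: rep_unit_def)
next
  case (Suc s)
  obtain r where r: "p = Suc r" using Suc.prems by (cases p) auto
  have "(p - 1) * rep_unit p (Suc s) + 1 = p * ((p - 1) * rep_unit p s + 1)"
    unfolding rep_unit_Suc unfolding r by (simp add: algebra_simps)
  then show ?case unfolding Suc.IH[OF Suc.prems] by simp
qed

text \<open>All base-p digits are \<mu> above and k <= \<mu> below, the situation of Lucas' theorem.
  \<open>jacobi_phi_Gamma\<close> needs it to cancel g choose m modulo p^s.\<close>

lemma not_dvd_choose_rep_unit:
  assumes "prime p" "k \<le> \<mu>" "\<mu> < p"
  shows "\<not> p dvd (\<mu> * rep_unit p s) choose (k * rep_unit p s)"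
proof (induction s)
  case 0
  then show ?case using prime_gt_1_nat[OF assms(1)] by (simp add: rep_unit_def)
next
  case (Suc s)
  define R where "R = rep_unit p s"
  have "k * R \<le> \<mu> * R" using assms(2) by (rule mult_le_mono1)
  from Gamma_nat_binomial[OF assms(1) this assms(2,3)]
  have eq: "Gamma_nat p (Suc (p * (\<mu> * R) + \<mu>)) * int ((\<mu> * R) choose (k * R))
    = - int ((p * (\<mu> * R) + \<mu>) choose (p * (k * R) + k)) * (Gamma_nat p (Suc (p * (k * R) + k)) * Gamma_nat p (Suc (p * (\<mu> * R - k * R) + (\<mu> - k))))" .
  have "\<not> int p dvd Gamma_nat p (Suc (p * (\<mu> * R) + \<mu>)) * int ((\<mu> * R) choose (k * R))"
    using Suc Gamma_nat_not_dvd[OF assms(1)] assms(1) by (simp add: prime_dvd_mult_iff R_def)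
  then have "\<not> int p dvd int ((p * (\<mu> * R) + \<mu>) choose (p * (k * R) + k))"
    unfolding eq by (auto simp: dvd_minus_iff)
  moreover have "\<mu> * rep_unit p (Suc s) = p * (\<mu> * R) + \<mu>" "k * rep_unit p (Suc s) = p * (k * R) + k"
    by (simp_all add: rep_unit_Suc R_def algebra_simps)
  ultimately show ?case by simp
qed

section \<open>Values of the gamma function at multiples of 1/(p - 1)\<close>

lemma padic_of_rat_eqI:
  assumes "b \<noteq> 0" "of_int b * z = (of_int a :: 'p::prime_card padic_int)"
  shows "padic_of_rat (of_int a / of_int b) = z"
proof -
  define q where "q = (of_int a / of_int b :: rat)"
  obtain a' b' where ab: "quotient_of q = (a', b')" by fastforce
  have b': "b' > 0" using quotient_of_denom_pos[OF ab] .
  have "q = of_int a' / of_int b'" using quotient_of_div[OF ab] .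
  then have "(of_int (a * b') :: rat) = of_int (a' * b)"
    unfolding q_def using assms(1) b' by (simp add: field_simps)
  then have eq: "a * b' = a' * b" by (simp only: of_int_eq_iff)
  have "of_int b * (of_int b' * z) = (of_int (a * b') :: 'p padic_int)"
    using assms(2) by (metis mult.left_commute mult.commute of_int_mult)
  also have "\<dots> = of_int b * of_int a'" unfolding eq by simp
  finally have z: "of_int b' * z = of_int a'" using assms(1) by simp
  have "padic_of_rat q = z"
    unfolding padic_of_rat_def ab prod.sel
  proof (rule the_equality)
    fix w :: "'p padic_int" assume "of_int b' * w = of_int a'"
    then have "of_int b' * w = of_int b' * z" using z by simp
    then show "w = z" using b' by simp
  qed (rule z)
  then show ?thesis by (simp add: q_def)
qed

definition Gamma_frac :: "nat \<Rightarrow> 'p::prime_card padic_int" where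
  "Gamma_frac a = padic_Gamma (padic_of_rat (of_nat a / (of_nat CARD('p) - 1)))"

lemma Gamma_frac_unit: "odd CARD('p) \<Longrightarrow> (Gamma_frac a :: 'p::prime_card padic_int) dvd 1"
  unfolding Gamma_frac_def by (rule padic_Gamma_unit)

lemma Gamma_frac_neq_0: "odd CARD('p) \<Longrightarrow> (Gamma_frac a :: 'p::prime_card padic_int) \<noteq> 0"
  using Gamma_frac_unit[of a, where 'p = 'p] by auto

text \<open>As p - 1 is a p-adic unit, the hypothesis says that n approximates a/(p - 1) modulo
  p^s.\<close>

lemma Gamma_frac_cong:
  assumes "odd CARD('p)" "int CARD('p) ^ s dvd int (CARD('p) - 1) * int n - int a"
  shows "of_nat CARD('p) ^ s dvd Gamma_frac a - (of_int (Gamma_nat CARD('p) n) :: 'p::prime_card padic_int)"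
proof -
  have p1: "CARD('p) > 1" using nontriv[where 'a = 'p] by simp
  define m where "m = int (CARD('p) - 1)"
  have m0: "m \<noteq> 0" using p1 by (simp add: m_def)
  have "padic_residue (of_int m :: 'p padic_int) = - 1"
    unfolding padic_residue_of_int m_def using p1 by (simp add: of_nat_diff)
  then have "(of_int m :: 'p padic_int) dvd 1" by (simp add: padic_unit_iff)
  then obtain y where y: "1 = (of_int m :: 'p padic_int) * y" ..
  define z where "z = of_nat a * y"
  have "of_int m * z = of_nat a * (of_int m * y)" by (simp add: z_def ac_simps)
  then have mz: "of_int m * z = of_int (int a)" using y by simp
  have "(of_int m :: rat) = of_nat CARD('p) - 1" unfolding m_def using p1 by (simp add: of_nat_diff)
  then have "padic_of_rat (of_nat a / (of_nat CARD('p) - 1)) = z"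
    using padic_of_rat_eqI[OF m0 mz] by simp
  then have G: "Gamma_frac a = padic_Gamma z" by (simp add: Gamma_frac_def)
  have "of_nat CARD('p) ^ s dvd (of_int (m * int n - int a) :: 'p padic_int)"
    unfolding padic_power_dvd_of_int_iff using assms(2) by (simp add: m_def)
  then have "of_nat CARD('p) ^ s dvd of_int (m * int n - int a) * (- y)" by (rule dvd_mult2)
  also have "of_int (m * int n - int a) * (- y) = z - of_nat n * (of_int m * y)"
    by (simp add: z_def algebra_simps)
  also have "\<dots> = z - of_nat n" unfolding y[symmetric] by simp
  finally have "of_nat CARD('p) ^ s dvd z - of_nat n" .
  from padic_Gamma_cong[OF assms(1) this] show ?thesis
    unfolding G padic_Gamma_of_nat[OF assms(1)] .
qed

lemma Gamma_frac_0: "odd CARD('p) \<Longrightarrow> Gamma_frac 0 = (1 :: 'p::prime_card padic_int)"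
  by (rule padic_eqI_dvd) (use Gamma_frac_cong[of _ 0 0, where 'p = 'p] in simp)

lemma padic_of_int_dvd_cong:
  "[a = b] (mod int CARD('p) ^ s) \<Longrightarrow> of_nat CARD('p) ^ s dvd of_int a - (of_int b :: 'p::prime_card padic_int)"
  using padic_power_dvd_of_int_iff[of s "a - b", where 'p = 'p] by (simp add: cong_iff_dvd_diff)

lemma dvd_mult_diff:
  fixes a b c d q :: "'a::comm_ring_1"
  assumes "q dvd a - b" "q dvd c - d"
  shows "q dvd a * c - b * d"
proof -
  have "a * c - b * d = (a - b) * c + b * (c - d)" by (simp add: algebra_simps)
  then show ?thesis using assms by simp
qed

text \<open>For n = a \<open>rep_unit p s\<close>, the numbers p^s - n and n + 1 tend to a/(p - 1)
  and 1 - a/(p - 1), so \<open>Gamma_nat_reflection\<close> passes to the limit.\<close>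

lemma Gamma_frac_reflection:
  assumes "odd CARD('p)" "a < CARD('p)"
  shows "Gamma_frac a * Gamma_frac (CARD('p) - 1 - a) = (- ((- 1) ^ a) :: 'p::prime_card padic_int)"
proof (rule padic_eqI_dvd_Suc)
  fix r
  let ?p = "CARD('p)"
  define s where "s = Suc r"
  define R where "R = rep_unit ?p s"
  define n where "n = a * R"
  have prime: "prime ?p" by (rule prime_card)
  have p1: "?p > 1" using nontriv[where 'a = 'p] by simp
  have R: "(?p - 1) * R + 1 = ?p ^ s" unfolding R_def using p1 by (intro rep_unit_eq) simp
  have "n \<le> (?p - 1) * R" unfolding n_def using assms(2) by (intro mult_le_mono1) simp
  then have n: "n < ?p ^ s" using R by linarith
  define D where "D = int (?p - 1)"
  have iR: "D * int R = int ?p ^ s - 1"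
  proof -
    have "int ((?p - 1) * R + 1) = int (?p ^ s)" unfolding R ..
    then have "D * int R + 1 = int ?p ^ s" by (simp only: D_def of_nat_add of_nat_mult of_nat_power of_nat_1)
    then show ?thesis by simp
  qed
  have e1: "int (?p - 1) * int (?p ^ s - n) - int a = int ?p ^ s * (D - int a)"
  proof -
    have "int (?p ^ s - n) = int ?p ^ s - int a * int R" using n by (simp add: of_nat_diff n_def)
    then have "D * int (?p ^ s - n) = D * int ?p ^ s - int a * (D * int R)"
      by (simp only:) (simp add: algebra_simps)
    then show ?thesis unfolding D_def[symmetric] iR by (simp add: algebra_simps)
  qed
  have e2: "int (?p - 1) * int (Suc n) - int (?p - 1 - a) = int ?p ^ s * int a"
  proof -
    have "D * int (Suc n) = int a * (D * int R) + D"
      by (simp add: n_def algebra_simps)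
    moreover have "int (?p - 1 - a) = D - int a" unfolding D_def using assms(2) by (intro of_nat_diff) simp
    ultimately show ?thesis unfolding D_def[symmetric] iR by (simp add: algebra_simps)
  qed
  \<comment> \<open>Division by p drops the last of the s = r + 1 equal digits. The exponent a p^r
    has the parity of a because p is odd.\<close>
  have nd: "n - n div ?p = a * ?p ^ r"
  proof -
    have "n = ?p * (a * rep_unit ?p r) + a" by (simp add: n_def R_def s_def rep_unit_Suc algebra_simps)
    then have "n div ?p = a * rep_unit ?p r" using assms(2) by simp
    moreover have "R = rep_unit ?p r + ?p ^ r" by (simp add: R_def s_def rep_unit_def)
    ultimately show ?thesis by (simp add: n_def algebra_simps)
  qed
  have sgn: "(- 1 :: int) ^ (n - n div ?p) = (- 1) ^ a"
    unfolding nd using assms(1) by (simp add: minus_one_power_iff)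
  have A: "of_nat ?p ^ s dvd Gamma_frac a - (of_int (Gamma_nat ?p (?p ^ s - n)) :: 'p padic_int)"
    by (rule Gamma_frac_cong[OF assms(1)]) (simp only: e1 dvd_triv_left)
  have B: "of_nat ?p ^ s dvd Gamma_frac (?p - 1 - a) - (of_int (Gamma_nat ?p (Suc n)) :: 'p padic_int)"
    by (rule Gamma_frac_cong[OF assms(1)]) (simp only: e2 dvd_triv_left)
  have "[Gamma_nat ?p (?p ^ s - n) * Gamma_nat ?p (Suc n) = - ((- 1) ^ (n - n div ?p))] (mod int ?p ^ s)"
    by (rule Gamma_nat_reflection) (use prime assms n s_def in auto)
  from padic_of_int_dvd_cong[OF this]
  have C: "of_nat ?p ^ s dvd of_int (Gamma_nat ?p (?p ^ s - n)) * of_int (Gamma_nat ?p (Suc n)) - (- ((- 1) ^ a) :: 'p padic_int)"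
    unfolding sgn by simp
  from dvd_add[OF dvd_mult_diff[OF A B] C]
  show "of_nat ?p ^ Suc r dvd Gamma_frac a * Gamma_frac (?p - 1 - a) - (- ((- 1) ^ a) :: 'p padic_int)"
    by (simp only: s_def diff_add_cancel add_diff_eq)
qed

section \<open>Jacobi sums with the quadratic character\<close>

lemma quadratic_char_euler:
  assumes "odd CARD('p)"
  shows "of_int (quadratic_char a) = (a :: 'p::prime_card mod_ring) ^ ((CARD('p) - 1) div 2)"
proof -
  obtain n where n: "a = of_int n" using padic_residue_surj[of a] by auto
  have prime: "prime CARD('p)" by (rule prime_card)
  have "CARD('p) \<noteq> 2" using assms by auto
  then have p2: "2 < CARD('p)" using prime_gt_1_nat[OF prime] by simp
  have iff: "of_int x = (of_int y :: 'p mod_ring) \<longleftrightarrow> [x = y] (mod int CARD('p))" for x y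
    by (simp add: mod_ring_of_int_eq_iff cong_iff_dvd_diff)
  have sq: "(\<exists>b. a = b\<^sup>2) \<longleftrightarrow> QuadRes (int CARD('p)) n"
  proof
    assume "\<exists>b. a = b\<^sup>2"
    then obtain b where b: "a = b\<^sup>2" by blast
    obtain y where "b = of_int y" using padic_residue_surj[of b] by auto
    then have "of_int (y\<^sup>2) = (of_int n :: 'p mod_ring)" using b n by simp
    then show "QuadRes (int CARD('p)) n" unfolding QuadRes_def iff by blast
  next
    assume "QuadRes (int CARD('p)) n"
    then obtain y where "[y\<^sup>2 = n] (mod int CARD('p))" unfolding QuadRes_def by blast
    then have "a = (of_int y)\<^sup>2" unfolding iff[symmetric] using n by simp
    then show "\<exists>b. a = b\<^sup>2" by blast
  qed
  have z: "a = 0 \<longleftrightarrow> [n = 0] (mod int CARD('p))"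
    using iff[of n 0] n by simp
  have "quadratic_char a = Legendre n (int CARD('p))"
    unfolding quadratic_char_def Legendre_def sq z ..
  moreover have "[Legendre n (int CARD('p)) = n ^ ((CARD('p) - 1) div 2)] (mod int CARD('p))"
    using euler_criterion[OF prime p2] .
  ultimately show ?thesis unfolding n by (simp only: iff of_int_power[symmetric])
qed

lemma quadratic_char_cases: "quadratic_char a = 0 \<and> a = 0 \<or> (quadratic_char a = 1 \<or> quadratic_char a = -1) \<and> a \<noteq> 0"
  by (simp add: quadratic_char_def)

lemma quadratic_char_power_odd: "odd n \<Longrightarrow> quadratic_char a ^ n = quadratic_char a"
  using quadratic_char_cases[of a] by (elim disjE conjE) (auto simp: odd_pos)

lemma teichmueller_power_half:
  assumes "odd CARD('p)" "a \<noteq> (0 :: 'p::prime_card mod_ring)"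
  shows "teichmueller a ^ ((CARD('p) - 1) div 2) = of_int (quadratic_char a)"
proof (rule teichmueller_unique)
  show "(teichmueller a ^ ((CARD('p) - 1) div 2)) ^ (CARD('p) - 1) = 1"
    by (metis teichmueller_power[OF assms(2)] power_mult mult.commute power_one)
  have "even (CARD('p) - 1)" using assms(1) by simp
  then show "(of_int (quadratic_char a) :: 'p padic_int) ^ (CARD('p) - 1) = 1"
    using quadratic_char_cases[of a] assms(2) by (elim disjE conjE) (simp_all del: One_nat_def)
  show "padic_residue (teichmueller a ^ ((CARD('p) - 1) div 2)) = padic_residue (of_int (quadratic_char a) :: 'p padic_int)"
    using assms by (simp add: padic_residue_teichmueller quadratic_char_euler)
qed

lemma quadratic_char_mult:
  assumes "odd CARD('p)"
  shows "quadratic_char (a * b) = quadratic_char a * quadratic_char (b :: 'p::prime_card mod_ring)"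
proof (cases "a = 0 \<or> b = 0")
  case True
  then show ?thesis by (auto simp: quadratic_char_def)
next
  case False
  then have "of_int (quadratic_char (a * b)) = (of_int (quadratic_char a * quadratic_char b) :: 'p padic_int)"
    using assms by (simp add: teichmueller_power_half[symmetric] teichmueller_mult power_mult_distrib)
  then show ?thesis by (simp only: of_int_eq_iff)
qed

lemma sum_teichmueller_power:
  "(\<Sum>t\<in>UNIV - {0}. teichmueller (t :: 'p::prime_card mod_ring) ^ i) = (if CARD('p) - 1 dvd i then of_nat (CARD('p) - 1) else 0)"
proof (cases "CARD('p) - 1 dvd i")
  case True
  then obtain j where j: "i = (CARD('p) - 1) * j" ..
  have "(\<Sum>t\<in>UNIV - {0}. teichmueller t ^ i) = (\<Sum>t\<in>UNIV - {0 :: 'p mod_ring}. 1 :: 'p padic_int)"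
    by (intro sum.cong refl) (simp add: j power_mult teichmueller_power del: One_nat_def)
  then show ?thesis using True by (simp add: card_Diff_singleton)
next
  case False
  define d where "d = CARD('p) - 1"
  have p1: "CARD('p) > 1" using nontriv[where 'a = 'p] by simp
  define r where "r = i mod d"
  have r: "0 < r" "r < d" using False p1 unfolding r_def d_def by (auto simp: dvd_eq_mod_eq_0)
  \<comment> \<open>The polynomial X^r - 1 has at most r < p - 1 roots. Scaling t by such an a
    multiplies the sum by a factor other than 1.\<close>
  have "\<exists>a. a \<noteq> (0 :: 'p mod_ring) \<and> a ^ r \<noteq> 1"
  proof (rule ccontr)
    assume "\<not> ?thesis"
    then have "UNIV - {0 :: 'p mod_ring} \<subseteq> {a. poly (monom 1 r - 1) a = 0}"
      by (auto simp: poly_monom)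
    moreover have ne: "monom 1 r - 1 \<noteq> (0 :: 'p mod_ring poly)"
    proof
      assume "monom 1 r - 1 = (0 :: 'p mod_ring poly)"
      then have "coeff (monom 1 r - 1) r = (0 :: 'p mod_ring)" by (simp only: coeff_0)
      then show False using r by simp
    qed
    ultimately have "card (UNIV - {0 :: 'p mod_ring}) \<le> card {a. poly (monom 1 r - 1) a = (0 :: 'p mod_ring)}"
      by (intro card_mono) auto
    also have "\<dots> \<le> degree (monom 1 r - 1 :: 'p mod_ring poly)"
      using ne by (rule card_poly_roots_bound)
    also have "\<dots> \<le> r" by (intro degree_diff_le) (simp_all add: degree_monom_le)
    finally show False using r by (simp add: card_Diff_singleton d_def)
  qed
  then obtain a where a: "a \<noteq> (0 :: 'p mod_ring)" "a ^ r \<noteq> 1" by blast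
  define S where "S = (\<Sum>t\<in>UNIV - {0}. teichmueller (t :: 'p mod_ring) ^ i)"
  have "S = (\<Sum>t\<in>UNIV - {0}. teichmueller (a * t) ^ i)"
    unfolding S_def
    by (rule sum.reindex_bij_witness[of _ "\<lambda>t. a * t" "\<lambda>t. t / a"]) (use a in auto)
  also have "\<dots> = (\<Sum>t\<in>UNIV - {0}. teichmueller a ^ i * teichmueller t ^ i)"
    using a by (intro sum.cong refl) (simp add: teichmueller_mult power_mult_distrib)
  also have "\<dots> = teichmueller a ^ i * S" by (simp add: S_def sum_distrib_left)
  finally have "(teichmueller a ^ i - 1) * S = 0" by (simp add: algebra_simps)
  moreover have "teichmueller a ^ i \<noteq> 1"
  proof
    assume "teichmueller a ^ i = 1"
    then have "padic_residue (teichmueller a ^ i) = 1" by simp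
    then have "a ^ i = 1" using a by (simp add: padic_residue_teichmueller)
    moreover have "a ^ i = a ^ (d * (i div d) + r)" by (simp add: r_def)
    moreover have "a ^ d = 1"
    proof -
      have "a * a ^ d = a ^ CARD('p)" unfolding d_def using p1 by (simp flip: power_Suc)
      then show ?thesis unfolding mod_ring_power_card using a by simp
    qed
    ultimately show False using a by (simp add: power_add power_mult)
  qed
  ultimately have "S = 0" by simp
  then show ?thesis using False by (simp add: S_def)
qed

text \<open>
  The Jacobi sum of \<open>\<omega>\<^sup>-\<^sup>k\<close> and \<open>\<phi>\<close> for \<open>k \<le> p - 1\<close>; the truncated subtraction gives another value
  for larger \<open>k\<close>. The same convention applies to the sum \<open>twisted_phi\<close> below.
\<close>

definition jacobi_phi :: "nat \<Rightarrow> 'p::prime_card padic_int" where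
  "jacobi_phi k = (\<Sum>t\<in>UNIV - {0 :: 'p mod_ring}. teichmueller t ^ (CARD('p) - 1 - k) * of_int (quadratic_char (1 - t)))"

text \<open>Euler's criterion modulo p, raised to the power p^s; a value of \<phi> is unchanged by
  an odd power.\<close>

lemma one_minus_teichmueller_power_cong:
  assumes "odd CARD('p)" "t \<noteq> (0 :: 'p::prime_card mod_ring)"
  shows "of_nat CARD('p) ^ Suc s dvd of_int (quadratic_char (1 - t)) - (1 - teichmueller t) ^ ((CARD('p) - 1) div 2 * CARD('p) ^ s)"
proof -
  let ?c = "of_int (quadratic_char (1 - t)) :: 'p padic_int"
  let ?x = "(1 - teichmueller t) ^ ((CARD('p) - 1) div 2)"
  have "padic_residue ?c = padic_residue ?x"
    using assms by (simp add: padic_residue_teichmueller quadratic_char_euler)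
  then have "of_nat CARD('p) dvd ?c - ?x" unfolding padic_residue_eq_iff .
  from power_power_cong[OF this, of s]
  have "of_nat CARD('p) ^ Suc s dvd ?c ^ (CARD('p) ^ s) - (1 - teichmueller t) ^ ((CARD('p) - 1) div 2 * CARD('p) ^ s)"
    by (simp only: power_mult)
  moreover have "?c ^ (CARD('p) ^ s) = ?c"
    unfolding of_int_power[symmetric] using assms(1) by (simp add: quadratic_char_power_odd)
  ultimately show ?thesis by simp
qed

text \<open>After binomial expansion of (1 - \<omega>(t))^N, orthogonality keeps the exponents i
  congruent to k modulo p - 1, and N = 2 \<mu> g + \<mu> limits them to u <= g.\<close>

lemma jacobi_phi_cong_binomial_sum:
  fixes \<mu> s k :: nat
  assumes p: "CARD('p) = 2 * \<mu> + 1" and k: "k < 2 * \<mu>"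
  defines "N \<equiv> \<mu> * CARD('p) ^ s" and "g \<equiv> \<mu> * rep_unit CARD('p) s"
  shows "of_nat CARD('p) ^ Suc s dvd
    jacobi_phi k - (of_int ((- 1) ^ k * (2 * int \<mu>) * (\<Sum>u\<le>g. int (N choose (2 * \<mu> * u + k)))) :: 'p::prime_card padic_int)"
proof -
  have odd: "odd CARD('p)" and p1: "CARD('p) - 1 = 2 * \<mu>" and half: "(CARD('p) - 1) div 2 = \<mu>" using p by simp_all
  let ?T = "\<lambda>t :: 'p mod_ring. teichmueller t"
  let ?U = "UNIV - {0 :: 'p mod_ring}"
  have R: "2 * \<mu> * rep_unit CARD('p) s + 1 = CARD('p) ^ s" using rep_unit_eq[of "CARD('p)" s] p1 p by simp
  have "N = \<mu> * (2 * \<mu> * rep_unit CARD('p) s + 1)" unfolding N_def R ..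
  then have Ng: "N = 2 * \<mu> * g + \<mu>" by (simp add: g_def algebra_simps)
  have mu0: "\<mu> > 0" using k by simp
  have 1: "of_nat CARD('p) ^ Suc s dvd jacobi_phi k - (\<Sum>t\<in>?U. ?T t ^ (2 * \<mu> - k) * (1 - ?T t) ^ N)"
    unfolding jacobi_phi_def p1 sum_subtractf[symmetric] right_diff_distrib[symmetric] N_def
    using one_minus_teichmueller_power_cong[OF odd, unfolded half]
    by (intro dvd_sum dvd_mult) simp
  have "(\<Sum>t\<in>?U. ?T t ^ (2 * \<mu> - k) * (1 - ?T t) ^ N)
      = (\<Sum>t\<in>?U. \<Sum>i\<le>N. of_nat (N choose i) * (- 1) ^ i * ?T t ^ (2 * \<mu> - k + i))"
  proof (intro sum.cong refl)
    fix t
    have "(1 - ?T t) ^ N = (\<Sum>i\<le>N. of_nat (N choose i) * (- 1) ^ i * ?T t ^ i)"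
      using binomial_ring[of "- ?T t" 1 N] by (simp add: power_minus[of "?T t"] mult.assoc)
    then show "?T t ^ (2 * \<mu> - k) * (1 - ?T t) ^ N = (\<Sum>i\<le>N. of_nat (N choose i) * (- 1) ^ i * ?T t ^ (2 * \<mu> - k + i))"
      by (simp add: sum_distrib_left power_add ac_simps)
  qed
  also have "\<dots> = (\<Sum>i\<le>N. of_nat (N choose i) * (- 1) ^ i * (\<Sum>t\<in>?U. ?T t ^ (2 * \<mu> - k + i)))"
    by (subst sum.swap) (simp add: sum_distrib_left)
  also have "\<dots> = (\<Sum>i\<le>N. of_int (int (N choose i) * (- 1) ^ i * (if 2 * \<mu> dvd 2 * \<mu> - k + i then int (2 * \<mu>) else 0)))"
    by (intro sum.cong refl) (simp add: sum_teichmueller_power p1 del: One_nat_def)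
  also have "\<dots> = of_int (\<Sum>i\<le>N. int (N choose i) * (- 1) ^ i * (if 2 * \<mu> dvd 2 * \<mu> - k + i then int (2 * \<mu>) else 0))"
    by simp
  also have "(\<Sum>i\<le>N. int (N choose i) * (- 1) ^ i * (if 2 * \<mu> dvd 2 * \<mu> - k + i then int (2 * \<mu>) else 0))
      = (\<Sum>u\<le>g. int (N choose (2 * \<mu> * u + k)) * (- 1) ^ (2 * \<mu> * u + k) * int (2 * \<mu>))"
  proof -
    let ?f = "\<lambda>i. int (N choose i) * (- 1) ^ i * (if 2 * \<mu> dvd 2 * \<mu> - k + i then int (2 * \<mu>) else 0)"
    let ?h = "\<lambda>u. int (N choose (2 * \<mu> * u + k)) * (- 1) ^ (2 * \<mu> * u + k) * int (2 * \<mu>)"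
    let ?S = "{..N} - {i. i \<le> N \<and> \<not> 2 * \<mu> dvd 2 * \<mu> - k + i}"
    \<comment> \<open>For k > \<mu> the index u = g gives 2 \<mu> g + k > N, where the binomial
      coefficient is 0.\<close>
    let ?V = "{..g} - {u. u \<le> g \<and> N < 2 * \<mu> * u + k}"
    have "sum ?f {..N} = sum ?f ?S" by (intro sum.mono_neutral_right) auto
    also have "\<dots> = sum ?h ?V"
    proof (rule sum.reindex_bij_witness[where i = "\<lambda>u. 2 * \<mu> * u + k" and j = "\<lambda>i. i div (2 * \<mu>)"])
    fix i assume "i \<in> {..N} - {i. i \<le> N \<and> \<not> 2 * \<mu> dvd 2 * \<mu> - k + i}"
    then have i: "i \<le> N" "2 * \<mu> dvd 2 * \<mu> - k + i" by auto
    obtain w where w: "2 * \<mu> - k + i = 2 * \<mu> * w" using i(2) ..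
    then obtain v where v: "w = Suc v" using k by (cases w) auto
    have iv: "i = 2 * \<mu> * v + k" using w k unfolding v by simp
    have div: "i div (2 * \<mu>) = v" using k by (simp add: iv)
    show "2 * \<mu> * (i div (2 * \<mu>)) + k = i" unfolding div by (rule iv[symmetric])
    show "i div (2 * \<mu>) \<in> {..g} - {u. u \<le> g \<and> N < 2 * \<mu> * u + k}"
    proof -
      have "2 * \<mu> * v < 2 * \<mu> * (g + 1)" using i(1) mu0 unfolding iv Ng by simp
      then have "v < g + 1" using nat_mult_less_cancel_disj[of "2 * \<mu>" v "g + 1"] by blast
      then have "v \<le> g" by simp
      then show ?thesis using i(1) unfolding div unfolding iv by simp
    qed
    show "int (N choose (2 * \<mu> * (i div (2 * \<mu>)) + k)) * (- 1) ^ (2 * \<mu> * (i div (2 * \<mu>)) + k) * int (2 * \<mu>)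
       = int (N choose i) * (- 1) ^ i * (if 2 * \<mu> dvd 2 * \<mu> - k + i then int (2 * \<mu>) else 0)"
      using i(2) unfolding div iv[symmetric] by simp
  next
    fix u assume u: "u \<in> {..g} - {u. u \<le> g \<and> N < 2 * \<mu> * u + k}"
    show "(2 * \<mu> * u + k) div (2 * \<mu>) = u" using k by simp
    have "2 * \<mu> - k + (2 * \<mu> * u + k) = 2 * \<mu> * Suc u" using k by simp
    then show "2 * \<mu> * u + k \<in> {..N} - {i. i \<le> N \<and> \<not> 2 * \<mu> dvd 2 * \<mu> - k + i}" using u by auto
    qed
    also have "\<dots> = sum ?h {..g}" by (intro sum.mono_neutral_left) auto
    finally show ?thesis .
  qed
  also have "\<dots> = (- 1) ^ k * (2 * int \<mu>) * (\<Sum>u\<le>g. int (N choose (2 * \<mu> * u + k)))"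
    unfolding sum_distrib_left by (intro sum.cong refl) (simp add: power_add power_mult)
  finally show ?thesis using 1 by simp
qed

text \<open>The gamma arguments are 1 - k/(p - 1), 1/2 + k/(p - 1) and 1/2. Modulo p^s the trace
  congruence and \<open>Gamma_nat_binomial\<close> share the two binomial coefficients, which are
  eliminated.\<close>

lemma jacobi_phi_Gamma:
  fixes \<mu> k :: nat
  assumes p: "CARD('p) = 2 * \<mu> + 1" and mu2: "2 \<le> \<mu>" and k: "k < \<mu>"
  shows "jacobi_phi k * (Gamma_frac (2 * \<mu> - k) * Gamma_frac (\<mu> + k)) = ((- 1) ^ k * Gamma_frac \<mu> :: 'p::prime_card padic_int)"
proof (rule padic_eqI_dvd)
  fix s
  let ?p = "CARD('p)"
  let ?P = "of_nat ?p :: 'p padic_int"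
  have odd: "odd ?p" and p1: "?p - 1 = 2 * \<mu>" using p by simp_all
  have prime: "prime ?p" by (rule prime_card)
  define R where "R = rep_unit ?p s"
  define g m N where "g = \<mu> * R" and "m = k * R" and "N = \<mu> * ?p ^ s"
  have R: "2 * \<mu> * R + 1 = ?p ^ s" unfolding R_def using rep_unit_eq[of ?p s] p1 p by simp
  define c where "c = int (g choose m)"
  define C' where "C' = int ((?p * g + \<mu>) choose (?p * m + k))"
  define A B D where "A = Gamma_nat ?p (Suc (?p * g + \<mu>))" and "B = Gamma_nat ?p (Suc (?p * m + k))"
    and "D = Gamma_nat ?p (Suc (?p * (g - m) + (\<mu> - k)))"
  define Y where "Y = (- 1) ^ k * (2 * int \<mu>) * (\<Sum>u\<le>g. int (N choose (2 * \<mu> * u + k)))"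
  have mg: "m \<le> g" unfolding m_def g_def using k by (intro mult_le_mono1) simp
  have J: "?P ^ s dvd jacobi_phi k - of_int Y"
  proof (rule dvd_trans)
    show "?P ^ s dvd ?P ^ Suc s" by simp
    show "?P ^ Suc s dvd jacobi_phi k - of_int Y"
      unfolding Y_def N_def g_def R_def by (rule jacobi_phi_cong_binomial_sum) (use p k in auto)
  qed
  have NG: "N + g = ?p * g + \<mu>"
  proof -
    have "N = \<mu> * (2 * \<mu> * R + 1)" unfolding N_def R ..
    then show ?thesis unfolding g_def p by (simp add: algebra_simps)
  qed
  have "int ?p ^ s dvd (1 - int ?p) * int (g choose m) * (\<Sum>u\<le>g. int ((\<mu> * ?p ^ s) choose ((?p - 1) * u + k)))
           - int ((\<mu> * ?p ^ s + g) choose (?p * m + k))"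
  proof (rule binomial_trace_cong[OF prime p k])
    show "2 * g + 1 = ?p ^ s" unfolding R[symmetric] g_def by simp
    show "2 * \<mu> * m + k = k * ?p ^ s" unfolding R[symmetric] m_def by simp
  qed (rule mu2)
  then have "int ?p ^ s dvd - ((- 1) ^ k) * ((1 - int ?p) * c * (\<Sum>u\<le>g. int (N choose (2 * \<mu> * u + k))) - C')"
    unfolding N_def[symmetric] NG p1 c_def C'_def by (rule dvd_mult)
  \<comment> \<open>Here 1 - p = -2 \<mu> meets the factor 2 \<mu> of the Jacobi sum.\<close>
  also have "- ((- 1) ^ k) * ((1 - int ?p) * c * (\<Sum>u\<le>g. int (N choose (2 * \<mu> * u + k))) - C') = c * Y + (- 1) ^ k * C'"
    unfolding Y_def p by (simp add: algebra_simps)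
  finally have core: "int ?p ^ s dvd c * Y + (- 1) ^ k * C'" .
  have bin: "A * c = - C' * (B * D)"
    unfolding A_def B_def D_def c_def C'_def
    by (rule Gamma_nat_binomial) (use prime mg k p in auto)
  have "c * (Y * (B * D) - (- 1) ^ k * A) = c * Y * (B * D) - (- 1) ^ k * (A * c)" by (simp add: algebra_simps)
  also have "\<dots> = (c * Y + (- 1) ^ k * C') * (B * D)" unfolding bin by (simp add: algebra_simps)
  finally have "int ?p ^ s dvd c * (Y * (B * D) - (- 1) ^ k * A)" using core by simp
  moreover have "coprime (int ?p ^ s) c"
  proof -
    have "\<not> ?p dvd (g choose m)"
      unfolding g_def m_def R_def using prime k p by (intro not_dvd_choose_rep_unit) auto
    with prime have "coprime ?p (g choose m)" by (rule prime_imp_coprime)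
    then show ?thesis unfolding c_def by simp
  qed
  ultimately have "int ?p ^ s dvd Y * (B * D) - (- 1) ^ k * A" by (simp add: coprime_dvd_mult_right_iff)
  then have main: "?P ^ s dvd of_int (Y * (B * D) - (- 1) ^ k * A)" by (simp only: padic_power_dvd_of_int_iff)
  have iR: "2 * int \<mu> * int R = int ?p ^ s - 1"
  proof -
    have "int (2 * \<mu> * R + 1) = int (?p ^ s)" unfolding R ..
    then show ?thesis by simp
  qed
  have ip: "int ?p = 2 * int \<mu> + 1" using p by simp
  \<comment> \<open>Such an n is b \<open>rep_unit p (Suc s)\<close>, which tends to -b/(p - 1); so
    n + 1 tends to 1 - b/(p - 1) = a/(p - 1).\<close>
  have app: "?P ^ s dvd Gamma_frac a - of_int (Gamma_nat ?p (Suc n))" if "n = ?p * (b * R) + b" "int a = 2 * int \<mu> - int b" for a b n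
  proof (rule Gamma_frac_cong[OF odd])
    have "int (?p - 1) * int (Suc n) - int a = int b * (int ?p * (2 * int \<mu> * int R) + 2 * int \<mu> + 1)"
      unfolding p1 that by (simp add: algebra_simps)
    also have "\<dots> = int b * int ?p * int ?p ^ s" unfolding iR ip by (simp add: algebra_simps)
    finally show "int ?p ^ s dvd int (?p - 1) * int (Suc n) - int a" by simp
  qed
  have FA: "?P ^ s dvd Gamma_frac \<mu> - of_int A"
    unfolding A_def by (rule app[where b = \<mu>]) (simp_all add: g_def)
  have FB: "?P ^ s dvd Gamma_frac (2 * \<mu> - k) - of_int B"
    unfolding B_def by (rule app[where b = k]) (use k in \<open>simp_all add: m_def\<close>)
  have FD: "?P ^ s dvd Gamma_frac (\<mu> + k) - of_int D"
    unfolding D_def by (rule app[where b = "\<mu> - k"]) (use k in \<open>simp_all add: m_def g_def diff_mult_distrib\<close>)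
  have 1: "?P ^ s dvd jacobi_phi k * (Gamma_frac (2 * \<mu> - k) * Gamma_frac (\<mu> + k)) - of_int Y * (of_int B * of_int D)"
    by (intro dvd_mult_diff J FB FD)
  have "?P ^ s dvd (- 1) ^ k * (Gamma_frac \<mu> - of_int A)" using FA by (rule dvd_mult)
  note 2 = this
  have "?P ^ s dvd (jacobi_phi k * (Gamma_frac (2 * \<mu> - k) * Gamma_frac (\<mu> + k)) - of_int Y * (of_int B * of_int D))
     + of_int (Y * (B * D) - (- 1) ^ k * A) - (- 1) ^ k * (Gamma_frac \<mu> - of_int A)"
    by (rule dvd_diff[OF dvd_add[OF 1 main] 2])
  then show "?P ^ s dvd jacobi_phi k * (Gamma_frac (2 * \<mu> - k) * Gamma_frac (\<mu> + k)) - (- 1) ^ k * Gamma_frac \<mu>"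
    by (simp add: algebra_simps)
qed

lemma sum_quadratic_char:
  assumes "odd CARD('p)"
  shows "(\<Sum>a\<in>UNIV. quadratic_char (a :: 'p::prime_card mod_ring)) = 0"
proof -
  define \<mu> where "\<mu> = (CARD('p) - 1) div 2"
  have p1: "CARD('p) > 1" using nontriv[where 'a = 'p] by simp
  have mu: "CARD('p) - 1 = 2 * \<mu>" using assms by (simp add: \<mu>_def)
  have "(of_int (\<Sum>a\<in>UNIV - {0}. quadratic_char (a :: 'p mod_ring)) :: 'p padic_int)
      = (\<Sum>a\<in>UNIV - {0 :: 'p mod_ring}. teichmueller a ^ \<mu>)"
    unfolding of_int_sum \<mu>_def by (intro sum.cong refl) (simp add: teichmueller_power_half[OF assms] del: One_nat_def)
  also have "\<dots> = 0"
  proof -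
    have "\<not> 2 * \<mu> dvd \<mu>" using mu p1 by (auto dest: dvd_imp_le)
    then show ?thesis unfolding sum_teichmueller_power mu by simp
  qed
  finally have "(\<Sum>a\<in>UNIV - {0}. quadratic_char (a :: 'p mod_ring)) = 0" by (simp only: of_int_eq_0_iff)
  moreover have "quadratic_char (0 :: 'p mod_ring) = 0" by (simp add: quadratic_char_def)
  ultimately show ?thesis by (subst sum.remove[of _ 0]) auto
qed

lemma quadratic_char_square: "b \<noteq> 0 \<Longrightarrow> quadratic_char (b * b) = 1"
  by (auto simp: quadratic_char_def power2_eq_square)

lemma quadratic_char_mult_square:
  assumes "odd CARD('p)" "b \<noteq> 0"
  shows "quadratic_char (a * (b * b)) = quadratic_char (a :: 'p::prime_card mod_ring)"
  unfolding quadratic_char_mult[OF assms(1), of a "b * b"] quadratic_char_square[OF assms(2)] by simp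

lemma quadratic_char_1 [simp]: "quadratic_char 1 = 1"
  using quadratic_char_square[of 1] by simp

lemma quadratic_char_0 [simp]: "quadratic_char 0 = 0"
  by (simp add: quadratic_char_def)

text \<open>For \<open>v \<noteq> 1\<close>, the values \<open>(1 - uv)/(1 - u)\<close> with \<open>u \<noteq> 1\<close> run through all elements but \<open>v\<close>.\<close>

lemma sum_quadratic_char_shifted:
  fixes v :: "'p::prime_card mod_ring"
  assumes odd: "odd CARD('p)" and "v \<noteq> 0"
  shows "(\<Sum>u\<in>UNIV - {0}. quadratic_char ((1 - u * v) * (1 - u)))
       = (if v = 1 then int CARD('p) - 2 else - quadratic_char v - 1)"
proof (cases "v = 1")
  case True
  have "(\<Sum>u\<in>UNIV - {0}. quadratic_char ((1 - u * v) * (1 - u)))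
      = (\<Sum>u\<in>UNIV - {0} - {1 :: 'p mod_ring}. 1)"
    using True by (intro sum.mono_neutral_cong_right) (auto simp: quadratic_char_square)
  also have "\<dots> = int (card (UNIV - {0} - {1 :: 'p mod_ring}))" by simp
  also have "card (UNIV - {0} - {1 :: 'p mod_ring}) = CARD('p) - 2"
    by (simp add: card_Diff_singleton)
  also have "int (CARD('p) - 2) = int CARD('p) - 2"
    using nontriv[where 'a = 'p] by (simp add: of_nat_diff)
  finally show ?thesis using True by simp
next
  case False
  have "(\<Sum>u\<in>UNIV. quadratic_char ((1 - u * v) * (1 - u)))
      = (\<Sum>u\<in>UNIV - {1}. quadratic_char ((1 - u * v) * (1 - u)))"
    by (intro sum.mono_neutral_right) auto
  also have "\<dots> = (\<Sum>x\<in>UNIV - {v}. quadratic_char x)"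
  proof (rule sum.reindex_bij_witness[where j = "\<lambda>u. (1 - u * v) / (1 - u)" and i = "\<lambda>x. (x - 1) / (x - v)"])
    fix u assume "u \<in> UNIV - {1 :: 'p mod_ring}"
    then have u: "1 - u \<noteq> 0" by simp
    have v1: "1 - v \<noteq> 0" using False by simp
    have a: "(1 - u * v) / (1 - u) - v = (1 - v) / (1 - u)" using u by (simp add: field_simps)
    have b: "(1 - u * v) / (1 - u) - 1 = u * (1 - v) / (1 - u)" using u by (simp add: field_simps)
    show "((1 - u * v) / (1 - u) - 1) / ((1 - u * v) / (1 - u) - v) = u"
      unfolding a b using u v1 by simp
    show "(1 - u * v) / (1 - u) \<in> UNIV - {v}" using a u v1 by auto
    have "(1 - u * v) * (1 - u) = (1 - u * v) / (1 - u) * ((1 - u) * (1 - u))" using u by simp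
    then show "quadratic_char ((1 - u * v) / (1 - u)) = quadratic_char ((1 - u * v) * (1 - u))"
      by (simp only: quadratic_char_mult_square[OF odd u])
  next
    fix x assume "x \<in> UNIV - {v}"
    then have x: "x - v \<noteq> 0" by simp
    have v1: "1 - v \<noteq> 0" using False by simp
    have a: "1 - (x - 1) / (x - v) = (1 - v) / (x - v)" using x by (simp add: field_simps)
    have b: "1 - (x - 1) / (x - v) * v = x * (1 - v) / (x - v)" using x by (simp add: field_simps)
    show "(1 - (x - 1) / (x - v) * v) / (1 - (x - 1) / (x - v)) = x"
      unfolding a b using x v1 by simp
    show "(x - 1) / (x - v) \<in> UNIV - {1}" using a x v1 by auto
  qed
  also have "\<dots> = - quadratic_char v"
    using sum_quadratic_char[OF odd] by (subst (asm) sum.remove[of _ v]) auto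
  finally have "(\<Sum>u\<in>UNIV. quadratic_char ((1 - u * v) * (1 - u))) = - quadratic_char v" .
  moreover have "(\<Sum>u\<in>UNIV. quadratic_char ((1 - u * v) * (1 - u)))
      = 1 + (\<Sum>u\<in>UNIV - {0}. quadratic_char ((1 - u * v) * (1 - u)))"
    by (subst sum.remove[of _ 0]) auto
  ultimately show ?thesis using False by simp
qed

text \<open>The counterpart of |J|^2 = p, with \<omega>^k as the conjugate of \<omega>^-k. After t =
  u v the inner sum over u is \<open>sum_quadratic_char_shifted\<close>; only v = 1 survives, since
  the excluded values of k are those making one of the two remaining character sums nonzero.\<close>

lemma jacobi_phi_mult:
  fixes \<mu> k :: nat
  assumes p: "CARD('p) = 2 * \<mu> + 1" and k: "0 < k" "k < 2 * \<mu>" "k \<noteq> \<mu>"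
  shows "jacobi_phi k * jacobi_phi (2 * \<mu> - k) = (of_nat CARD('p) :: 'p::prime_card padic_int)"
proof -
  have odd: "odd CARD('p)" and p1: "CARD('p) - 1 = 2 * \<mu>" and half: "(CARD('p) - 1) div 2 = \<mu>" using p by simp_all
  let ?T = "\<lambda>t :: 'p mod_ring. teichmueller t"
  let ?U = "UNIV - {0 :: 'p mod_ring}"
  let ?\<phi> = "\<lambda>a :: 'p mod_ring. of_int (quadratic_char a) :: 'p padic_int"
  have kk: "2 * \<mu> - (2 * \<mu> - k) = k" using k by simp
  have "jacobi_phi k * jacobi_phi (2 * \<mu> - k)
      = (\<Sum>u\<in>?U. \<Sum>t\<in>?U. ?T t ^ (2 * \<mu> - k) * ?T u ^ k * ?\<phi> ((1 - t) * (1 - u)))"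
    unfolding jacobi_phi_def p1 kk sum_product
    by (subst sum.swap) (simp add: quadratic_char_mult[OF odd] ac_simps)
  also have "\<dots> = (\<Sum>u\<in>?U. \<Sum>v\<in>?U. ?T v ^ (2 * \<mu> - k) * ?\<phi> ((1 - u * v) * (1 - u)))"
  proof (rule sum.cong[OF refl])
    fix u assume u: "u \<in> ?U"
    have "(\<Sum>t\<in>?U. ?T t ^ (2 * \<mu> - k) * ?T u ^ k * ?\<phi> ((1 - t) * (1 - u)))
        = (\<Sum>v\<in>?U. ?T (u * v) ^ (2 * \<mu> - k) * ?T u ^ k * ?\<phi> ((1 - u * v) * (1 - u)))"
      by (rule sum.reindex_bij_witness[where i = "\<lambda>v. u * v" and j = "\<lambda>t. t / u"]) (use u in auto)
    also have "\<dots> = (\<Sum>v\<in>?U. ?T v ^ (2 * \<mu> - k) * ?\<phi> ((1 - u * v) * (1 - u)))"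
    proof (intro sum.cong refl)
      fix v assume v: "v \<in> ?U"
      have "?T (u * v) ^ (2 * \<mu> - k) * ?T u ^ k = ?T v ^ (2 * \<mu> - k) * ?T u ^ (2 * \<mu> - k + k)"
        using u v by (simp add: teichmueller_mult power_mult_distrib power_add ac_simps)
      also have "2 * \<mu> - k + k = CARD('p) - 1" using k p by simp
      also have "?T u ^ (CARD('p) - 1) = 1" using u by (intro teichmueller_power) simp
      finally show "?T (u * v) ^ (2 * \<mu> - k) * ?T u ^ k * ?\<phi> ((1 - u * v) * (1 - u))
          = ?T v ^ (2 * \<mu> - k) * ?\<phi> ((1 - u * v) * (1 - u))" by simp
    qed
    finally show "(\<Sum>t\<in>?U. ?T t ^ (2 * \<mu> - k) * ?T u ^ k * ?\<phi> ((1 - t) * (1 - u)))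
        = (\<Sum>v\<in>?U. ?T v ^ (2 * \<mu> - k) * ?\<phi> ((1 - u * v) * (1 - u)))" .
  qed
  also have "\<dots> = (\<Sum>v\<in>?U. ?T v ^ (2 * \<mu> - k) * of_int (\<Sum>u\<in>?U. quadratic_char ((1 - u * v) * (1 - u))))"
    by (subst sum.swap) (simp add: sum_distrib_left)
  also have "\<dots> = (\<Sum>v\<in>?U. ?T v ^ (2 * \<mu> - k) * of_int (if v = 1 then int CARD('p) - 2 else - quadratic_char v - 1))"
    by (intro sum.cong refl) (simp add: sum_quadratic_char_shifted[OF odd])
  also have "\<dots> = (\<Sum>v\<in>?U. (if v = 1 then of_nat CARD('p) else 0) - ?T v ^ (2 * \<mu> - k + \<mu>) - ?T v ^ (2 * \<mu> - k))"
  proof (intro sum.cong refl)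
    fix v assume "v \<in> ?U"
    then have "?\<phi> v = ?T v ^ \<mu>" using teichmueller_power_half[OF odd, of v] half by simp
    then show "?T v ^ (2 * \<mu> - k) * of_int (if v = 1 then int CARD('p) - 2 else - quadratic_char v - 1)
        = (if v = 1 then of_nat CARD('p) else 0) - ?T v ^ (2 * \<mu> - k + \<mu>) - ?T v ^ (2 * \<mu> - k)"
      by (cases "v = 1") (simp_all add: power_add algebra_simps)
  qed
  also have "\<dots> = of_nat CARD('p) - (\<Sum>v\<in>?U. ?T v ^ (2 * \<mu> - k + \<mu>)) - (\<Sum>v\<in>?U. ?T v ^ (2 * \<mu> - k))"
    by (simp add: sum_subtractf)
  also have "(\<Sum>v\<in>?U. ?T v ^ (2 * \<mu> - k + \<mu>)) = 0"
  proof -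
    have "\<not> 2 * \<mu> dvd 2 * \<mu> - k + \<mu>"
    proof
      assume "2 * \<mu> dvd 2 * \<mu> - k + \<mu>"
      then obtain w where w: "2 * \<mu> - k + \<mu> = 2 * \<mu> * w" ..
      consider "w = 0" | "w = 1" | v where "w = Suc (Suc v)" by (metis One_nat_def not0_implies_Suc)
      then show False
      proof cases
        case 3
        have "2 * \<mu> - k + \<mu> = 4 * \<mu> + 2 * \<mu> * v" unfolding w 3 by simp
        then show False using k by linarith
      qed (use w k in auto)
    qed
    then show ?thesis unfolding sum_teichmueller_power p1 by simp
  qed
  also have "(\<Sum>v\<in>?U. ?T v ^ (2 * \<mu> - k)) = 0"
  proof -
    have "\<not> 2 * \<mu> dvd 2 * \<mu> - k" using k by (auto dest: dvd_imp_le)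
    then show ?thesis unfolding sum_teichmueller_power p1 by simp
  qed
  finally show ?thesis by simp
qed

definition twisted_phi :: "nat \<Rightarrow> 'p::prime_card padic_int" where
  "twisted_phi j = (\<Sum>t\<in>UNIV - {0 :: 'p mod_ring}. teichmueller t ^ (CARD('p) - 1 - j) * of_int (quadratic_char (t * (t - 1))))"

lemma jacobi_phi_trivial:
  assumes "odd CARD('p)" "k = 0 \<or> k = CARD('p) - 1"
  shows "jacobi_phi k = (- 1 :: 'p::prime_card padic_int)"
proof -
  have "jacobi_phi k = (\<Sum>t\<in>UNIV - {0 :: 'p mod_ring}. of_int (quadratic_char (1 - t)) :: 'p padic_int)"
    unfolding jacobi_phi_def using assms(2)
    by (intro sum.cong refl) (auto simp: teichmueller_power simp del: One_nat_def)
  also have "\<dots> = of_int (\<Sum>t\<in>UNIV - {0}. quadratic_char (1 - t :: 'p mod_ring))" by simp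
  also have "(\<Sum>t\<in>UNIV - {0}. quadratic_char (1 - t :: 'p mod_ring)) = (\<Sum>t\<in>UNIV - {1}. quadratic_char (t :: 'p mod_ring))"
    by (rule sum.reindex_bij_witness[where i = "\<lambda>t. 1 - t" and j = "\<lambda>t. 1 - t"]) auto
  also have "\<dots> = - 1"
    using sum_quadratic_char[OF assms(1)] by (subst (asm) sum.remove[of _ 1]) auto
  finally show ?thesis by simp
qed

text \<open>Substitute 1/t for t: t (t - 1) is 1 - 1/t times the square t^2.\<close>

lemma twisted_phi_eq_jacobi_phi:
  assumes odd: "odd CARD('p)" and j: "j \<le> CARD('p) - 1"
  shows "twisted_phi j = (jacobi_phi (CARD('p) - 1 - j) :: 'p::prime_card padic_int)"
  unfolding twisted_phi_def jacobi_phi_def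
proof (rule sum.reindex_bij_witness[where i = inverse and j = inverse])
  fix t :: "'p mod_ring" assume "t \<in> UNIV - {0}"
  then have t: "t \<noteq> 0" by simp
  have 1: "teichmueller t * teichmueller (inverse t) = 1"
    using t by (simp flip: teichmueller_mult)
  have "teichmueller t ^ (CARD('p) - 1 - j) = teichmueller t ^ (CARD('p) - 1 - j) * (teichmueller t * teichmueller (inverse t)) ^ j"
    unfolding 1 by simp
  also have "\<dots> = teichmueller t ^ (CARD('p) - 1 - j + j) * teichmueller (inverse t) ^ j"
    by (simp add: power_mult_distrib power_add ac_simps)
  also have "CARD('p) - 1 - j + j = CARD('p) - 1" using j by simp
  finally have T: "teichmueller t ^ (CARD('p) - 1 - j) = teichmueller (inverse t) ^ j"
    using t by (simp add: teichmueller_power del: One_nat_def)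
  have "t * (t - 1) = (1 - inverse t) * (t * t)" using t by (simp add: field_simps)
  then have Q: "quadratic_char (t * (t - 1)) = quadratic_char (1 - inverse t)"
    by (simp only: quadratic_char_mult_square[OF odd t])
  have "CARD('p) - 1 - (CARD('p) - 1 - j) = j" using j by simp
  then show "teichmueller (inverse t) ^ (CARD('p) - 1 - (CARD('p) - 1 - j)) * of_int (quadratic_char (1 - inverse t))
      = teichmueller t ^ (CARD('p) - 1 - j) * of_int (quadratic_char (t * (t - 1)))"
    by (simp only: T Q)
qed auto

text \<open>The factor \<phi>(t) is \<omega>(t)^\<mu>, which shifts the index by \<mu>; the sign
  comes from t - 1 = -(1 - t).\<close>

lemma twisted_phi_shift:
  assumes p: "CARD('p) = 2 * \<mu> + 1" and k: "k \<le> \<mu>"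
  shows "twisted_phi (\<mu> + k) = (of_int (quadratic_char (- 1 :: 'p mod_ring)) * jacobi_phi k :: 'p::prime_card padic_int)"
proof -
  have odd: "odd CARD('p)" and p1: "CARD('p) - 1 = 2 * \<mu>" and half: "(CARD('p) - 1) div 2 = \<mu>" using p by simp_all
  show ?thesis
    unfolding twisted_phi_def jacobi_phi_def p1 sum_distrib_left
  proof (intro sum.cong refl)
    fix t :: "'p mod_ring" assume "t \<in> UNIV - {0}"
    then have t: "of_int (quadratic_char t) = teichmueller t ^ \<mu>" using teichmueller_power_half[OF odd, of t] half by simp
    have "t * (t - 1) = t * ((- 1) * (1 - t))" by simp
    then have Q: "of_int (quadratic_char (t * (t - 1)))
       = (of_int (quadratic_char t) * (of_int (quadratic_char (- 1 :: 'p mod_ring)) * of_int (quadratic_char (1 - t))) :: 'p padic_int)"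
      by (simp only: quadratic_char_mult[OF odd] of_int_mult)
    have "2 * \<mu> - (\<mu> + k) + \<mu> = 2 * \<mu> - k" using k by simp
    then have "teichmueller t ^ (2 * \<mu> - (\<mu> + k)) * teichmueller t ^ \<mu> = teichmueller t ^ (2 * \<mu> - k)"
      by (simp only: power_add[symmetric])
    note T = this
    have "teichmueller t ^ (2 * \<mu> - (\<mu> + k)) * of_int (quadratic_char (t * (t - 1)))
        = of_int (quadratic_char (- 1 :: 'p mod_ring)) * ((teichmueller t ^ (2 * \<mu> - (\<mu> + k)) * teichmueller t ^ \<mu>) * of_int (quadratic_char (1 - t)))"
      unfolding Q t by (simp only: ac_simps)
    then show "teichmueller t ^ (2 * \<mu> - (\<mu> + k)) * of_int (quadratic_char (t * (t - 1)))
        = of_int (quadratic_char (- 1 :: 'p mod_ring)) * (teichmueller t ^ (2 * \<mu> - k) * of_int (quadratic_char (1 - t)))"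
      unfolding T .
  qed
qed

lemma quadratic_char_minus_1:
  assumes p: "CARD('p) = 2 * \<mu> + 1"
  shows "quadratic_char (- 1 :: 'p::prime_card mod_ring) = (- 1) ^ \<mu>"
proof -
  have odd: "odd CARD('p)" and half: "(CARD('p) - 1) div 2 = \<mu>" using p by simp_all
  have c: "quadratic_char (- 1 :: 'p mod_ring) = 1 \<or> quadratic_char (- 1 :: 'p mod_ring) = - 1"
    using quadratic_char_cases[of "- 1 :: 'p mod_ring"] by simp
  have eq: "of_int (quadratic_char (- 1 :: 'p mod_ring)) = (of_int ((- 1) ^ \<mu>) :: 'p mod_ring)"
    using quadratic_char_euler[OF odd, of "- 1"] half by simp
  have "\<mu> > 0" using p nontriv[where 'a = 'p] by (cases \<mu>) auto
  then have "int CARD('p) > 2" using p by simp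
  then have "of_int 1 \<noteq> (of_int (- 1) :: 'p mod_ring)"
    unfolding mod_ring_of_int_eq_iff by (auto dest: zdvd_imp_le)
  then show ?thesis using c eq by (cases "even \<mu>") auto
qed

text \<open>Both ranges reduce to \<open>jacobi_phi_Gamma\<close> with index below \<mu>: for j >=
  \<mu> through the shift to j - \<mu>, for j < \<mu> through inversion and
  \<open>jacobi_phi_mult\<close>, the source of the factor p.\<close>

lemma twisted_phi_Gamma:
  fixes \<mu> j :: nat
  assumes p: "CARD('p) = 2 * \<mu> + 1" and j: "0 < j" "j < 2 * \<mu>"
  shows "twisted_phi j * (Gamma_frac j * Gamma_frac \<mu>)
       = (if j < \<mu> then - of_nat CARD('p) * Gamma_frac (\<mu> + j) else Gamma_frac (j - \<mu>) :: 'p::prime_card padic_int)"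
proof -
  have odd: "odd CARD('p)" and p1: "CARD('p) - 1 = 2 * \<mu>" using p by simp_all
  let ?G = "Gamma_frac :: nat \<Rightarrow> 'p padic_int"
  have G0: "?G a \<noteq> 0" for a by (rule Gamma_frac_neq_0[OF odd])
  have refl: "?G a * ?G (2 * \<mu> - a) = - ((- 1) ^ a)" if "a \<le> 2 * \<mu>" for a
    using Gamma_frac_reflection[OF odd, of a] that p by simp
  have half_sq: "?G \<mu> * ?G \<mu> = - ((- 1) ^ \<mu>)" using refl[of \<mu>] by simp
  have phi1: "(of_int (quadratic_char (- 1 :: 'p mod_ring)) :: 'p padic_int) = (- 1) ^ \<mu>"
    unfolding quadratic_char_minus_1[OF p] by simp
  show ?thesis
  proof (cases "j < \<mu>")
    case True
    define J where "J = (jacobi_phi j :: 'p padic_int)"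
    have mu2: "2 \<le> \<mu>" using True j by simp
    have JG: "J * (?G (2 * \<mu> - j) * ?G (\<mu> + j)) = (- 1) ^ j * ?G \<mu>"
      unfolding J_def by (rule jacobi_phi_Gamma[OF p mu2 True])
    have tw: "twisted_phi j = (jacobi_phi (2 * \<mu> - j) :: 'p padic_int)"
      using twisted_phi_eq_jacobi_phi[OF odd, of j] j unfolding p1 by simp
    have JJ: "J * twisted_phi j = of_nat CARD('p)"
      unfolding J_def tw by (rule jacobi_phi_mult[OF p]) (use j True in auto)
    have "J \<noteq> 0" using JG G0 by auto
    have "(J * ?G (2 * \<mu> - j)) * (twisted_phi j * (?G j * ?G \<mu>))
        = (J * twisted_phi j) * (?G j * ?G (2 * \<mu> - j)) * ?G \<mu>" by (simp only: ac_simps)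
    also have "\<dots> = of_nat CARD('p) * (- ((- 1) ^ j)) * ?G \<mu>" unfolding JJ using refl[of j] j by simp
    also have "\<dots> = - of_nat CARD('p) * ((- 1) ^ j * ?G \<mu>)" by simp
    also have "\<dots> = (J * ?G (2 * \<mu> - j)) * (- of_nat CARD('p) * ?G (\<mu> + j))"
      unfolding JG[symmetric] by (simp only: ac_simps)
    finally have "twisted_phi j * (?G j * ?G \<mu>) = - of_nat CARD('p) * ?G (\<mu> + j)"
      using \<open>J \<noteq> 0\<close> G0 by (simp only: mult_cancel_left mult_eq_0_iff) simp
    then show ?thesis using True by simp
  next
    case False
    define k where "k = j - \<mu>"
    have jk: "j = \<mu> + k" "k < \<mu>" using False j by (simp_all add: k_def)
    have tw: "twisted_phi j = (- 1) ^ \<mu> * (jacobi_phi k :: 'p padic_int)"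
      unfolding jk(1) phi1[symmetric] by (rule twisted_phi_shift[OF p]) (use jk in simp)
    show ?thesis
    proof (cases "k = 0")
      case True
      have "jacobi_phi k = (- 1 :: 'p padic_int)" using True by (intro jacobi_phi_trivial[OF odd]) simp
      then have "twisted_phi j * (?G j * ?G \<mu>) = - ((- 1) ^ \<mu> * (?G \<mu> * ?G \<mu>))"
        unfolding tw using jk True by simp
      also have "\<dots> = 1" unfolding half_sq by (simp add: minus_one_power_iff)
      finally show ?thesis using False True Gamma_frac_0[OF odd] by (simp add: k_def)
    next
      case k0: False
      have mu2: "2 \<le> \<mu>" using k0 jk by simp
      have JG: "jacobi_phi k * (?G (2 * \<mu> - k) * ?G (\<mu> + k)) = (- 1) ^ k * ?G \<mu>"
        by (rule jacobi_phi_Gamma[OF p mu2 jk(2)])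
      have "?G (2 * \<mu> - k) * (twisted_phi j * (?G j * ?G \<mu>))
          = (- 1) ^ \<mu> * (jacobi_phi k * (?G (2 * \<mu> - k) * ?G (\<mu> + k))) * ?G \<mu>"
        unfolding tw unfolding jk(1) by (simp only: ac_simps)
      also have "\<dots> = (- 1) ^ k * ((- 1) ^ \<mu> * (?G \<mu> * ?G \<mu>))" unfolding JG by (simp only: ac_simps)
      also have "\<dots> = - ((- 1) ^ k)" unfolding half_sq by (simp add: minus_one_power_iff)
      also have "\<dots> = ?G (2 * \<mu> - k) * ?G k" using refl[of k] jk by (simp add: mult.commute)
      finally have "twisted_phi j * (?G j * ?G \<mu>) = ?G k" using G0 by simp
      then show ?thesis using False by (simp add: k_def)
    qed
  qed
qed

section \<open>The hypergeometric series\<close>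

lemma padic_embed_mult: "padic_embed (x * y) = padic_embed x * padic_embed (y :: 'p::prime_card padic_int)"
  by (simp add: padic_embed_def)

lemma padic_embed_add: "padic_embed (x + y) = padic_embed x + padic_embed (y :: 'p::prime_card padic_int)"
  by (simp add: padic_embed_def)

lemma padic_embed_0 [simp]: "padic_embed 0 = 0" and padic_embed_1 [simp]: "padic_embed 1 = 1"
  by (simp_all add: padic_embed_def Zero_fract_def One_fract_def)

lemma padic_embed_eq_0_iff [simp]: "padic_embed x = 0 \<longleftrightarrow> x = (0 :: 'p::prime_card padic_int)"
  by (simp add: padic_embed_def Zero_fract_def eq_fract)

lemma padic_embed_minus: "padic_embed (- x) = - padic_embed (x :: 'p::prime_card padic_int)"
  by (simp add: padic_embed_def)

lemma padic_embed_of_nat: "padic_embed (of_nat n :: 'p::prime_card padic_int) = of_nat n"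
  by (induction n) (simp_all add: padic_embed_add)

lemma padic_embed_of_int: "padic_embed (of_int n :: 'p::prime_card padic_int) = of_int n"
  by (cases n rule: int_cases2) (simp_all add: padic_embed_of_nat padic_embed_minus)

lemma padic_embed_power: "padic_embed (x ^ n) = padic_embed (x :: 'p::prime_card padic_int) ^ n"
  by (induction n) (simp_all add: padic_embed_mult)

lemma padic_embed_sum: "padic_embed (\<Sum>i\<in>A. f i) = (\<Sum>i\<in>A. padic_embed (f i :: 'p::prime_card padic_int))"
  by (induction A rule: infinite_finite_induct) (simp_all add: padic_embed_add)

section \<open>The contribution of a single parameter to the series\<close>

definition hyper_Gamma :: "rat \<Rightarrow> 'p::prime_card padic_int fract" where
  "hyper_Gamma q = padic_embed (padic_Gamma (padic_of_rat q))"

definition hyper_upper :: "nat \<Rightarrow> rat \<Rightarrow> 'p::prime_card padic_int fract" where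
  "hyper_upper j a = (let r = of_nat j / (of_nat CARD('p) - 1) in
     (- of_nat CARD('p)) powi (- \<lfloor>frac a - r\<rfloor>) * (hyper_Gamma (frac (a - r)) / hyper_Gamma (frac a)))"

definition hyper_lower :: "nat \<Rightarrow> rat \<Rightarrow> 'p::prime_card padic_int fract" where
  "hyper_lower j b = (let r = of_nat j / (of_nat CARD('p) - 1) in
     (- of_nat CARD('p)) powi (- \<lfloor>frac (- b) + r\<rfloor>) * (hyper_Gamma (frac (- b + r)) / hyper_Gamma (frac (- b))))"

lemma of_nat_padic_fract_eq_0_iff [simp]: "(of_nat n :: 'p::prime_card padic_int fract) = 0 \<longleftrightarrow> n = 0"
  by (metis padic_embed_of_nat padic_embed_eq_0_iff of_nat_eq_0_iff)

lemma hyper_Gamma_neq_0: "odd CARD('p) \<Longrightarrow> (hyper_Gamma q :: 'p::prime_card padic_int fract) \<noteq> 0"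
  unfolding hyper_Gamma_def using padic_Gamma_unit[where 'p = 'p and z = "padic_of_rat q"] by auto

lemma hyper_Gamma_frac_point:
  "hyper_Gamma (of_nat a / (of_nat CARD('p) - 1)) = padic_embed (Gamma_frac a :: 'p::prime_card padic_int)"
  by (simp add: hyper_Gamma_def Gamma_frac_def)

text \<open>Distributing the power of -p over the parameters makes each summand a product of one
  factor per parameter, so the two series can be compared parameter by parameter.\<close>

lemma padic_hyper_G_factorization:
  fixes t :: "'p::prime_card mod_ring"
  assumes "length bs = length as"
  shows "padic_hyper_G as bs t = (- 1) / (of_nat CARD('p) - 1) *
    (\<Sum>j = 0..CARD('p) - 2. (- 1) ^ (j * length as) * prod_list (map (hyper_upper j) as)
        * prod_list (map (hyper_lower j) bs) * teichmueller_bar_pow j t)"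
proof -
  have P: "- of_nat CARD('p) \<noteq> (0 :: 'p padic_int fract)" by simp
  have powi: "(- of_nat CARD('p) :: 'p padic_int fract) powi (- a - b) = (- of_nat CARD('p)) powi (- a) * (- of_nat CARD('p)) powi (- b)" for a b
    using power_int_add[OF disjI1[OF P], of "- a" "- b"] by simp
  have "(\<Prod>i<length as.
      (- of_nat CARD('p)) powi (- \<lfloor>frac (as ! i) - of_nat j / (of_nat CARD('p) - 1)\<rfloor> - \<lfloor>frac (- bs ! i) + of_nat j / (of_nat CARD('p) - 1)\<rfloor>) *
      (hyper_Gamma (frac (as ! i - of_nat j / (of_nat CARD('p) - 1))) / hyper_Gamma (frac (as ! i))) *
      (hyper_Gamma (frac (- bs ! i + of_nat j / (of_nat CARD('p) - 1))) / hyper_Gamma (frac (- bs ! i))))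
     = (\<Prod>i<length as. hyper_upper j (as ! i) * hyper_lower j (bs ! i) :: 'p padic_int fract)" for j
    unfolding hyper_upper_def hyper_lower_def Let_def powi
    by (intro prod.cong refl) (simp only: ac_simps)
  also have "(\<Prod>i<length as. hyper_upper j (as ! i) * hyper_lower j (bs ! i) :: 'p padic_int fract)
      = prod_list (map (hyper_upper j) as) * prod_list (map (hyper_lower j) bs)" for j
    using assms by (simp add: prod.distrib prod.list_conv_set_nth atLeast0LessThan)
  finally show ?thesis
    unfolding padic_hyper_G_def Let_def hyper_Gamma_def by (simp add: ac_simps)
qed

lemma teichmueller_bar_pow_mult:
  "teichmueller_bar_pow j (a * b) = teichmueller_bar_pow j a * teichmueller_bar_pow j (b :: 'p::prime_card mod_ring)"
  by (auto simp: teichmueller_bar_pow_def teichmueller_mult padic_embed_mult power_mult_distrib)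

lemma sum_quadratic_char_teichmueller_bar_pow:
  assumes "j \<le> CARD('p) - 1"
  shows "(\<Sum>t\<in>UNIV. of_int (quadratic_char (t * (t - 1))) * teichmueller_bar_pow j (t :: 'p::prime_card mod_ring))
       = padic_embed (twisted_phi j)"
proof -
  have "(\<Sum>t\<in>UNIV. of_int (quadratic_char (t * (t - 1))) * teichmueller_bar_pow j (t :: 'p mod_ring))
      = (\<Sum>t\<in>UNIV - {0}. padic_embed (teichmueller t ^ (CARD('p) - 1 - j) * of_int (quadratic_char (t * (t - 1)))))"
  proof (rule sum.mono_neutral_cong_right)
    fix t :: "'p mod_ring" assume "t \<in> UNIV - {0}"
    then have t: "t \<noteq> 0" by simp
    define e where "e = padic_embed (teichmueller t)"
    have e0: "e \<noteq> 0" using teichmueller_neq_0[OF t] by (simp add: e_def)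
    have "CARD('p) - 1 - j + j = CARD('p) - 1" using assms by simp
    then have "e ^ (CARD('p) - 1 - j) * e ^ j = padic_embed (teichmueller t ^ (CARD('p) - 1))"
      unfolding e_def padic_embed_power by (simp only: power_add[symmetric])
    then have "e ^ (CARD('p) - 1 - j) * e ^ j = 1" by (simp only: teichmueller_power[OF t] padic_embed_1)
    then have "inverse e ^ j = e ^ (CARD('p) - 1 - j)" using e0 by (simp add: field_simps)
    then show "of_int (quadratic_char (t * (t - 1))) * teichmueller_bar_pow j t
        = padic_embed (teichmueller t ^ (CARD('p) - 1 - j) * of_int (quadratic_char (t * (t - 1))))"
      using t by (simp add: teichmueller_bar_pow_def padic_embed_mult padic_embed_of_int padic_embed_power e_def)
  qed (auto simp: teichmueller_bar_pow_def)
  then show ?thesis by (simp add: twisted_phi_def padic_embed_sum)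
qed

lemma prod_list_filter_neq:
  assumes "distinct xs" "m \<in> set xs"
  shows "prod_list (map f xs) = f m * (prod_list (map f (filter (\<lambda>h. h \<noteq> m) xs)) :: 'a::comm_monoid_mult)"
proof -
  have "prod_list (map f xs) = prod f (set xs)" using assms by (simp add: prod.distinct_set_conv_list)
  also have "\<dots> = f m * prod f (set xs - {m})" using assms by (intro prod.remove) auto
  also have "set xs - {m} = set (filter (\<lambda>h. h \<noteq> m) xs)" by auto
  also have "prod f \<dots> = prod_list (map f (filter (\<lambda>h. h \<noteq> m) xs))"
    using assms by (intro prod.distinct_set_conv_list) simp
  finally show ?thesis .
qed

lemma hyper_upper_0: "odd CARD('p) \<Longrightarrow> hyper_upper 0 a = (1 :: 'p::prime_card padic_int fract)"
  and hyper_lower_0: "odd CARD('p) \<Longrightarrow> hyper_lower 0 b = (1 :: 'p::prime_card padic_int fract)"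
  using hyper_Gamma_neq_0[where 'p = 'p] by (simp_all add: hyper_upper_def hyper_lower_def floor_frac)

lemma hyper_lower_at_0:
  assumes p: "odd CARD('p)" "j < CARD('p) - 1"
  shows "hyper_lower j 0 = padic_embed (Gamma_frac j :: 'p::prime_card padic_int)"
proof -
  define r where "r = (of_nat j / (of_nat CARD('p) - 1) :: rat)"
  have "int j < int CARD('p) - 1" using p(2) by simp
  then have "(of_int (int j) :: rat) < of_int (int CARD('p) - 1)" by (simp only: of_int_less_iff)
  then have "0 \<le> r" "r < 1" by (simp_all add: r_def)
  then have r: "\<lfloor>r\<rfloor> = 0" "frac r = r" by (simp_all add: floor_eq_iff frac_eq)
  have "hyper_Gamma 0 = (1 :: 'p padic_int fract)"
    using hyper_Gamma_frac_point[of 0, where 'p = 'p] Gamma_frac_0[OF p(1)] by simp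
  then show ?thesis
    unfolding hyper_lower_def Let_def r_def[symmetric] using r hyper_Gamma_frac_point[of j, where 'p = 'p]
    by (simp add: r_def[symmetric])
qed

text \<open>The floor of 1/2 + j/(p - 1) jumps from 0 to 1 at j = \<mu>. The resulting factor -1/p
  offsets the case distinction in \<open>twisted_phi_Gamma\<close>.\<close>

lemma hyper_lower_at_half:
  assumes p: "CARD('p) = 2 * \<mu> + 1" and j: "j < 2 * \<mu>"
  shows "hyper_lower j (1 / 2) = (if j < \<mu> then padic_embed (Gamma_frac (\<mu> + j)) / padic_embed (Gamma_frac \<mu>)
     else - inverse (of_nat CARD('p)) * (padic_embed (Gamma_frac (j - \<mu>)) / padic_embed (Gamma_frac \<mu> :: 'p::prime_card padic_int)))"
proof -
  define r where "r = (\<lambda>a. of_nat a / (of_nat CARD('p) - 1) :: rat)"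
  have mu: "\<mu> > 0" using j by simp
  have pr: "of_nat CARD('p) - 1 = (2 * of_nat \<mu> :: rat)" using p by simp
  have "\<lfloor>- (1 / 2) :: rat\<rfloor> = - 1" by (simp add: floor_eq_iff)
  then have f: "frac (- (1 / 2)) = (1 / 2 :: rat)" by (simp add: frac_def)
  have rj: "of_nat a / (of_nat CARD('p) - 1) = r a" for a by (simp add: r_def)
  have rmu: "r \<mu> = 1 / 2" using mu by (simp add: r_def pr)
  have G: "hyper_Gamma (r a) = padic_embed (Gamma_frac a :: 'p padic_int)" for a
    unfolding r_def by (rule hyper_Gamma_frac_point)
  have jr: "(of_nat j :: rat) < 2 * of_nat \<mu>" using j by (metis of_nat_less_iff of_nat_mult of_nat_numeral)
  have L: "hyper_lower j (1 / 2) = (- of_nat CARD('p)) powi (- \<lfloor>1 / 2 + r j\<rfloor>) * (hyper_Gamma (frac (- (1 / 2) + r j)) / hyper_Gamma (r \<mu>) :: 'p padic_int fract)"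
    unfolding hyper_lower_def Let_def f rj rmu ..
  show ?thesis
  proof (cases "j < \<mu>")
    case True
    then have jm: "(of_nat j :: rat) < of_nat \<mu>" by simp
    have e: "1 / 2 + r j = r (\<mu> + j)" using mu by (simp add: r_def pr add_divide_distrib)
    have b: "0 \<le> r (\<mu> + j)" "r (\<mu> + j) < 1" using mu jm by (simp_all add: r_def pr)
    have "frac (- (1 / 2) + r j) = r (\<mu> + j)"
      unfolding frac_unique_iff using b e[symmetric] by simp
    moreover have "\<lfloor>1 / 2 + r j\<rfloor> = 0" unfolding e using b by (simp add: floor_eq_iff)
    ultimately show ?thesis unfolding L using True by (simp add: G)
  next
    case False
    then have jm: "(of_nat \<mu> :: rat) \<le> of_nat j" by simp
    have e: "- (1 / 2) + r j = r (j - \<mu>)"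
      using mu False by (simp add: r_def pr of_nat_diff diff_divide_distrib)
    have b: "0 \<le> r (j - \<mu>)" "r (j - \<mu>) < 1" using mu jm jr False by (simp_all add: r_def pr of_nat_diff)
    have "frac (- (1 / 2) + r j) = r (j - \<mu>)" unfolding e using b by (simp add: frac_eq)
    moreover have "\<lfloor>1 / 2 + r j\<rfloor> = 1" using b e by (simp add: floor_eq_iff)
    ultimately show ?thesis unfolding L using False by (simp add: G power_int_minus)
  qed
qed

text \<open>The exchange behind the theorem: summing over t replaces one lower parameter 0 by 1/2,
  at the price of -p.\<close>

lemma twisted_phi_hyper_lower:
  assumes p: "CARD('p) = 2 * \<mu> + 1" and j: "0 < j" "j < 2 * \<mu>"
  shows "padic_embed (twisted_phi j) * hyper_lower j 0 = - of_nat CARD('p) * (hyper_lower j (1 / 2) :: 'p::prime_card padic_int fract)"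
proof -
  have odd: "odd CARD('p)" using p by simp
  define Gmu where "Gmu = padic_embed (Gamma_frac \<mu> :: 'p padic_int)"
  have G0: "Gmu \<noteq> 0" unfolding Gmu_def using Gamma_frac_neq_0[OF odd] by simp
  have "padic_embed (twisted_phi j * (Gamma_frac j * Gamma_frac \<mu>))
      = padic_embed (if j < \<mu> then - of_nat CARD('p) * Gamma_frac (\<mu> + j) else Gamma_frac (j - \<mu>) :: 'p padic_int)"
    by (simp only: twisted_phi_Gamma[OF p j])
  then have eq: "padic_embed (twisted_phi j) * padic_embed (Gamma_frac j) * Gmu
      = (if j < \<mu> then - of_nat CARD('p) * padic_embed (Gamma_frac (\<mu> + j)) else padic_embed (Gamma_frac (j - \<mu>) :: 'p padic_int))"
    by (simp add: padic_embed_mult padic_embed_minus padic_embed_of_nat Gmu_def mult.assoc split: if_splits)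
  have lower0: "hyper_lower j 0 = padic_embed (Gamma_frac j :: 'p padic_int)"
    by (rule hyper_lower_at_0) (use p j in auto)
  show ?thesis
    unfolding lower0 hyper_lower_at_half[OF p j(2)] Gmu_def[symmetric]
    using eq G0 by (auto simp: field_simps split: if_splits)
qed

theorem theorem1p2:
  fixes d :: nat and x :: "'p::prime_card mod_ring"
  assumes "d \<ge> 3" and "odd d"
    and "odd CARD('p)" and "\<not> CARD('p) dvd d * (d - 1)"
    and "x \<noteq> 0"
  shows
    "(\<Sum>t\<in>UNIV. of_int (quadratic_char (t * (t - 1))) *
        padic_hyper_G
          (map (\<lambda>h. of_nat h / of_nat d) [1..<d])
          (map (\<lambda>h. of_nat h / of_nat (d - 1)) (filter (\<lambda>h. h \<noteq> (d - 1) div 2) [1..<d - 1]) @ [0, 0])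
          (x * t))
     = -1 - of_nat CARD('p) *
        padic_hyper_G
          (map (\<lambda>h. of_nat h / of_nat d) [1..<d])
          (map (\<lambda>h. of_nat h / of_nat (d - 1)) [0..<d - 1])
          x"
proof -
  define \<mu> where "\<mu> = (CARD('p) - 1) div 2"
  have p: "CARD('p) = 2 * \<mu> + 1" using assms(3) by (auto simp: \<mu>_def elim!: oddE)
  have p2: "CARD('p) - 2 = 2 * \<mu> - 1" using p by simp
  have mu: "\<mu> > 0" using p nontriv[where 'a = 'p] by (cases \<mu>) auto
  define P where "P = (of_nat CARD('p)  :: 'p padic_int fract)"
  have P1: "P - 1 \<noteq> 0"
  proof -
    have "P - 1 = of_nat (2 * \<mu>)" unfolding P_def p by simp
    then show ?thesis using mu by (simp only: of_nat_padic_fract_eq_0_iff)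
  qed
  define as where "as = (map (\<lambda>h. of_nat h / of_nat d) [1..<d] :: rat list)"
  define q where "q = (\<lambda>h. of_nat h / of_nat (d - 1) :: rat)"
  define m where "m = (d - 1) div 2"
  define fs where "fs = filter (\<lambda>h. h \<noteq> m) [1..<d - 1]"
  have m: "m \<in> set [1..<d - 1]" using assms(1,2) by (auto simp: m_def elim!: oddE)
  have qm: "q m = 1 / 2" using assms(1,2) by (auto simp: q_def m_def elim!: oddE)
  have up: "[0..<d - 1] = 0 # [1..<d - 1]" using assms(1) by (subst upt_conv_Cons) auto
  have len_fs: "length fs = d - 3"
  proof -
    have "length fs = card (set fs)" by (rule distinct_card[symmetric]) (simp add: fs_def)
    also have "set fs = set [1..<d - 1] - {m}" by (auto simp: fs_def)
    also have "card \<dots> = d - 3" using m by (subst card_Diff_singleton) auto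
    finally show ?thesis .
  qed
  have lenL: "length (map q fs @ [0, 0]) = length as" using len_fs assms(1) by (simp add: as_def)
  have lenR: "length (map q [0..<d - 1]) = length as" by (simp add: as_def)
  \<comment> \<open>The part common to both series: the upper parameters, the lower ones h/(d - 1)
    other than 1/2, and one 0. What remains is a second 0 on the left and 1/2 on the right.\<close>
  define M where "M = (\<lambda>j. (- 1) ^ (j * length as) * prod_list (map (hyper_upper j) as)
      * (prod_list (map (\<lambda>h. hyper_lower j (q h)) fs) * hyper_lower j 0)  :: 'p padic_int fract)"
  have prodL: "prod_list (map (hyper_lower j) (map q fs @ [0, 0]))
      = prod_list (map (\<lambda>h. hyper_lower j (q h)) fs) * hyper_lower j 0 * (hyper_lower j 0  :: 'p padic_int fract)" for j
    by (simp add: o_def mult.assoc)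
  have prodR: "prod_list (map (hyper_lower j) (map q [0..<d - 1]))
      = prod_list (map (\<lambda>h. hyper_lower j (q h)) fs) * hyper_lower j 0 * (hyper_lower j (1 / 2)  :: 'p padic_int fract)" for j
  proof -
    have "prod_list (map (\<lambda>h. hyper_lower j (q h)) [1..<d - 1])
        = hyper_lower j (q m) * (prod_list (map (\<lambda>h. hyper_lower j (q h)) fs)  :: 'p padic_int fract)"
      unfolding fs_def by (rule prod_list_filter_neq) (use m in auto)
    then show ?thesis unfolding up qm by (simp add: o_def q_def ac_simps)
  qed
  let ?tb = "\<lambda>j t. teichmueller_bar_pow j t  :: 'p padic_int fract"
  define H where "H = (\<lambda>j. ?tb j x * M j * hyper_lower j (1 / 2))"
  have GL: "padic_hyper_G as (map q fs @ [0, 0]) (x * t)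
      = (- 1) / (P - 1) * (\<Sum>j = 0..CARD('p) - 2. ?tb j x * M j * hyper_lower j 0 * ?tb j t)" for t
    unfolding padic_hyper_G_factorization[OF lenL] P_def[symmetric] prodL M_def teichmueller_bar_pow_mult
    by (simp only: ac_simps)
  have GR: "padic_hyper_G as (map q [0..<d - 1]) x = (- 1) / (P - 1) * (\<Sum>j = 0..CARD('p) - 2. H j)"
    unfolding padic_hyper_G_factorization[OF lenR] P_def[symmetric] prodR M_def H_def
    by (simp only: ac_simps)
  have "(\<Sum>t\<in>UNIV. of_int (quadratic_char (t * (t - 1))) * padic_hyper_G as (map q fs @ [0, 0]) (x * t))
     = (- 1) / (P - 1) * (\<Sum>t\<in>UNIV. \<Sum>j = 0..CARD('p) - 2.
          ?tb j x * M j * hyper_lower j 0 * (of_int (quadratic_char (t * (t - 1))) * ?tb j t))"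
    unfolding GL sum_distrib_left by (simp only: ac_simps)
  also have "(\<Sum>t\<in>UNIV. \<Sum>j = 0..CARD('p) - 2. ?tb j x * M j * hyper_lower j 0 * (of_int (quadratic_char (t * (t - 1))) * ?tb j t))
     = (\<Sum>j = 0..CARD('p) - 2. ?tb j x * M j * (padic_embed (twisted_phi j) * hyper_lower j 0))"
  proof (subst sum.swap, rule sum.cong[OF refl])
    fix j assume "j \<in> {0..CARD('p) - 2}"
    then have "j \<le> CARD('p) - 1" by simp
    from sum_quadratic_char_teichmueller_bar_pow[OF this]
    show "(\<Sum>t\<in>UNIV. ?tb j x * M j * hyper_lower j 0 * (of_int (quadratic_char (t * (t - 1))) * ?tb j t))
        = ?tb j x * M j * (padic_embed (twisted_phi j) * hyper_lower j 0)"
      unfolding sum_distrib_left[symmetric] by (simp add: ac_simps)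
  qed
  \<comment> \<open>At j = 0 the exchange fails: the term is -1 = (P - 1) - P with
    \<open>H 0\<close> equal to 1. The prefactor -1/(P - 1) turns the correction P - 1 into the -1
    of the claim.\<close>
  also have "\<dots> = (\<Sum>j = 0..CARD('p) - 2. (if j = 0 then P - 1 else 0) - P * H j)"
  proof (rule sum.cong[OF refl])
    fix j assume j: "j \<in> {0..CARD('p) - 2}"
    show "?tb j x * M j * (padic_embed (twisted_phi j) * hyper_lower j 0) = (if j = 0 then P - 1 else 0) - P * H j"
    proof (cases "j = 0")
      case True
      have neutral: "prod_list zs = 1" if "\<And>z. z \<in> set zs \<Longrightarrow> z = 1" for zs :: "'p padic_int fract list"
        using that by (induction zs) auto
      have "prod_list (map (hyper_upper 0) as) = (1 :: 'p padic_int fract)"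
        by (rule neutral) (auto simp: hyper_upper_0[OF assms(3)])
      moreover have "prod_list (map (\<lambda>h. hyper_lower 0 (q h)) fs) = (1 :: 'p padic_int fract)"
        by (rule neutral) (auto simp: hyper_lower_0[OF assms(3)])
      ultimately have "M 0 = 1" using hyper_lower_0[OF assms(3)] by (simp add: M_def)
      moreover have "twisted_phi 0 = (- 1 :: 'p padic_int)"
        using twisted_phi_eq_jacobi_phi[OF assms(3), of 0] jacobi_phi_trivial[OF assms(3)] by simp
      ultimately show ?thesis
        using True assms(3,5) by (simp add: H_def hyper_lower_0 teichmueller_bar_pow_def padic_embed_minus)
    next
      case False
      then have "0 < j" "j < 2 * \<mu>" using j mu unfolding p2 by auto
      from twisted_phi_hyper_lower[OF p this] show ?thesis
        using False by (simp add: H_def P_def)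
    qed
  qed
  also have "\<dots> = (P - 1) - P * (\<Sum>j = 0..CARD('p) - 2. H j)"
    by (simp add: sum_subtractf sum_distrib_left)
  finally have "(\<Sum>t\<in>UNIV. of_int (quadratic_char (t * (t - 1))) * padic_hyper_G as (map q fs @ [0, 0]) (x * t))
     = - 1 - P * padic_hyper_G as (map q [0..<d - 1]) x"
    unfolding GR using P1 by (simp add: field_simps)
  then show ?thesis unfolding as_def q_def fs_def m_def P_def .
qed

end
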